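(* Let $\mathbb{G}$ be a Carnot group and $|\cdot|_{\mathbb{G}}$ a homogeneous norm on $\mathbb{G}$. There exist positive constants $\beta,\mu$ and, for each $1\le p<\infty$, a positive constant $C_{p,Q}$, such that the inequality $$\int_{B}|f(x)-f_B|^p\,dx\le C_{p,Q}R^p\int_{\mu B}\int_{\mu B}\frac{|f(y)-f(x)|^p}{|y^{-1}\cdot x|_{\mathbb{G}}^{p+Q-1}}\frac{\varphi(|y^{-1}\cdot x|_{\mathbb{G}})}{\int_0^{\beta R}\varphi(\tau)d\tau}\,dx\,dy$$ holds for all balls $B$ of radius $R>0$, all $f\in L^p_{loc}(\mathbb{G})$ and all not identically zero nonincreasing $\varphi:(0,\infty)\to[0,\infty)$ integrable on bounded intervals, and such that, with these same constants, the following holds. Let $\{\rho_n\}$ be a family of radial mollifiers, with each $\rho_n$ nonincreasing as a function of $|x|_{\mathbb{G}}$, and normalized so that $\int_0^\infty\rho_n(r)r^{Q-1}\,dr=1$. Then for all $1\le p<\infty$, all $R>0$, all balls $B$ of radius $R$ and all $C>C_{p,Q}$ there exists $n_0$ such that $$\int_{B}|f(x)-f_B|^p\,dx\le C R^p\int_{\mu B}\int_{\mu B}\frac{|f(x)-f(y)|^p}{|y^{-1}\cdot x|_{\mathbb{G}}^p}\,\rho_n(|y^{-1}\cdot x|_{\mathbb{G}})\,dy\,dx$$ for all $n>n_0$ and all $f\in L^p_{loc}(\mathbb{G})$; here $n_0$ is determined by the condition $$\int_0^{\beta R}\rho_n(\tau)\tau^{Q-1}\,d\tau>\frac{C_{p,Q}}{C}\qquad\text{for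 all } n>n_0 .$$
   Context: Carnot group: a simply connected Lie group $\mathbb{G}$ whose Lie algebra $\mathfrak{g}$ is stratified: $\mathfrak g=\bigoplus_{j=1}^kW_j$, $W_{j+1}=[W_1,W_j]$ for $j<k$, $[W_1,W_k]=0$. Put $m_j=\dim W_j$, $N=\sum_j m_j$, $Q=\sum_j j\,m_j$ (homogeneous dimension). Fix a basis $X_1,\dots,X_N$ of $\mathfrak g$ adapted to the layers in increasing order. Via canonical coordinates $x=\exp(x_1X_1+\dots+x_NX_N)$, $\mathbb{G}$ is identified with $\mathbb{R}^N$ with the induced group law $\cdot$ and identity $0$; the Haar measure $dx$ is Lebesgue measure. The group dilations $\delta_\lambda$, $\lambda>0$, multiply coordinates of the $j$-th layer by $\lambda^j$. Homogeneous norm: a continuous $|\cdot|_{\mathbb{G}}:\mathbb{G}\to[0,\infty)$ with $|x|_{\mathbb{G}}=0\iff x=0$, $|x^{-1}|_{\mathbb{G}}=|x|_{\mathbb{G}}$, $|\delta_\lambda(x)|_{\mathbb{G}}=\lambda|x|_{\mathbb{G}}$. Balls: $B(x,r)=\{y:|y^{-1}\cdot x|_{\mathbb{G}}<r\}$; $c_B=|B(0,1)|$; $\mu B$ is the concentric ball with radius multiplied by $\mu$; $f_B$ is the average of $f$ on $B$. Radial mollifiers: functions $x\mapsto\tilde\rho_n(|x|_{\mathbb{G}})\ge0$, $n>0$, with $\int_{\mathbb{G}}\tilde\rho_n(|x|_{\mathbb{G}})dx=1$ for all $n$ and $\int_{\mathbb{G}\setminus B(0,\delta)}\tilde\rho_n(|x|_{\mathbb{G}})dx\to0$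 as $n\to\infty$ for every $\delta>0$. Since $\int_{\mathbb{G}}g(|x|_{\mathbb{G}})dx=Qc_B\int_0^\infty g(r)r^{Q-1}dr$, the normalized profile $\rho_n=Qc_B\tilde\rho_n$ satisfies $\int_0^\infty\rho_n(r)r^{Q-1}dr=1$ and $\int_\delta^\infty\rho_n(r)r^{Q-1}dr\to0$ for every $\delta>0$; in the claim $\rho_n$ denotes this normalized profile. Right-hand sides may be $+\infty$. *)

theory Defs
  imports "HOL-Analysis.Analysis"
begin

section \<open>Lie groups on Euclidean space\<close>

primrec times_differentiable ::
  "nat \<Rightarrow> ('a::real_normed_vector \<Rightarrow> 'b::real_normed_vector) \<Rightarrow> bool" where
  "times_differentiable 0 f \<longleftrightarrow> continuous_on UNIV f"
| "times_differentiable (Suc m) f \<longleftrightarrow>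
     (\<forall>x. f differentiable at x) \<and>
     (\<forall>v. times_differentiable m (\<lambda>x. frechet_derivative f (at x) v))"

definition smooth :: "('a::real_normed_vector \<Rightarrow> 'b::real_normed_vector) \<Rightarrow> bool" where
  "smooth f \<longleftrightarrow> (\<forall>m. times_differentiable m f)"

text \<open>The left-invariant vector field whose value at the identity \<open>0\<close> is \<open>v\<close>.\<close>

definition left_field ::
  "('a::real_normed_vector \<Rightarrow> 'a \<Rightarrow> 'a) \<Rightarrow> 'a \<Rightarrow> 'a \<Rightarrow> 'a" where
  "left_field mul v x = frechet_derivative (mul x) (at 0) v"

definition field_bracket ::
  "('a::real_normed_vector \<Rightarrow> 'a) \<Rightarrow> ('a \<Rightarrow> 'a) \<Rightarrow> 'a \<Rightarrow> 'a" where
  "field_bracket X Y x =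
     frechet_derivative Y (at x) (X x) - frechet_derivative X (at x) (Y x)"

text \<open>The Lie algebra is the tangent space at the identity, that is, the whole vector space.\<close>

definition lie_bracket :: "('a::real_normed_vector \<Rightarrow> 'a \<Rightarrow> 'a) \<Rightarrow> 'a \<Rightarrow> 'a \<Rightarrow> 'a" where
  "lie_bracket mul u v = field_bracket (left_field mul u) (left_field mul v) 0"

section \<open>Carnot groups in canonical coordinates\<close>

text \<open>
  The basis \<open>X\<^sub>i\<close> of the Lie algebra adapted to the stratification is the standard basis
  \<open>axis i 1\<close>, and \<open>wt i\<close> is the number of the layer that contains \<open>X\<^sub>i\<close>. The index type is
  an arbitrary finite type, so that the order of the basis vectors plays no role.
\<close>

definition layer :: "('n::finite \<Rightarrow> nat) \<Rightarrow> nat \<Rightarrow> (real ^ 'n) set" where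
  "layer wt j = span ((\<lambda>i. axis i 1) ` {i. wt i = j})"

text \<open>
  \<open>carnot_group mul iv k wt\<close>: a Carnot group with \<open>k\<close> layers, written in canonical coordinates.
  By \<open>one_param\<close> the curve \<open>t \<mapsto> t *\<^sub>R x\<close> is the one-parameter subgroup with velocity \<open>x\<close>
  at the identity; this says that the exponential map is the identity map, i.e. that the
  coordinates of a point are those of its logarithm. Simple connectedness is automatic, the
  underlying manifold being a Euclidean space.
\<close>

locale carnot_group =
  fixes mul :: "real ^ 'n::finite \<Rightarrow> real ^ 'n \<Rightarrow> real ^ 'n"
    and iv :: "real ^ 'n \<Rightarrow> real ^ 'n"
    and k :: nat
    and wt :: "'n \<Rightarrow> nat"
  assumes group: "Groups.group mul 0 iv"
    and smooth_mul: "smooth (\<lambda>(x, y). mul x y)"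
    and smooth_iv: "smooth iv"
    and one_param: "mul (s *\<^sub>R x) (t *\<^sub>R x) = (s + t) *\<^sub>R x"
    and wt_range: "wt i \<in> {1..k}"
    and bracket_step:
      "1 \<le> j \<Longrightarrow> j < k \<Longrightarrow>
         layer wt (Suc j) = span {lie_bracket mul u v |u v. u \<in> layer wt 1 \<and> v \<in> layer wt j}"
    and bracket_top:
      "u \<in> layer wt 1 \<Longrightarrow> v \<in> layer wt k \<Longrightarrow> lie_bracket mul u v = 0"

definition hom_dim :: "nat \<Rightarrow> ('n::finite \<Rightarrow> nat) \<Rightarrow> nat" where
  "hom_dim k wt = (\<Sum>j = 1..k. j * dim (layer wt j))"

definition dilation :: "('n::finite \<Rightarrow> nat) \<Rightarrow> real \<Rightarrow> real ^ 'n \<Rightarrow> real ^ 'n" where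
  "dilation wt l x = (\<chi> i. l ^ wt i * x $ i)"

definition homogeneous_norm ::
  "(real ^ 'n::finite \<Rightarrow> real ^ 'n) \<Rightarrow> ('n \<Rightarrow> nat) \<Rightarrow> (real ^ 'n \<Rightarrow> real) \<Rightarrow> bool" where
  "homogeneous_norm iv wt nrm \<longleftrightarrow>
     continuous_on UNIV nrm \<and>
     (\<forall>x. nrm x \<ge> 0) \<and>
     (\<forall>x. nrm x = 0 \<longleftrightarrow> x = 0) \<and>
     (\<forall>x. nrm (iv x) = nrm x) \<and>
     (\<forall>l>0. \<forall>x. nrm (dilation wt l x) = l * nrm x)"

definition gball ::
  "(real ^ 'n::finite \<Rightarrow> real ^ 'n \<Rightarrow> real ^ 'n) \<Rightarrow> (real ^ 'n \<Rightarrow> real ^ 'n) \<Rightarrow>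
   (real ^ 'n \<Rightarrow> real) \<Rightarrow> real ^ 'n \<Rightarrow> real \<Rightarrow> (real ^ 'n) set" where
  "gball mul iv nrm x r = {y. nrm (mul (iv y) x) < r}"

section \<open>Functions and mollifiers\<close>

definition Lp_loc :: "real \<Rightarrow> (real ^ 'n::finite \<Rightarrow> real) set" where
  "Lp_loc p = {f \<in> borel_measurable lebesgue.
     \<forall>K. compact K \<longrightarrow> set_integrable lebesgue K (\<lambda>x. \<bar>f x\<bar> powr p)}"

definition average :: "(real ^ 'n::finite) set \<Rightarrow> (real ^ 'n \<Rightarrow> real) \<Rightarrow> real" where
  "average B f = (LINT x:B|lebesgue. f x) / measure lebesgue B"

text \<open>
  The family is indexed by real \<open>n > 0\<close>. Profiles are functions on \<open>(0,\<infinity>)\<close>: the value at \<open>0\<close>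
  concerns a null set only, so that nothing is required of it. An integral equal to \<open>1\<close>
  entails integrability.
\<close>

definition radial_mollifiers ::
  "(real ^ 'n::finite \<Rightarrow> real ^ 'n \<Rightarrow> real ^ 'n) \<Rightarrow> (real ^ 'n \<Rightarrow> real ^ 'n) \<Rightarrow>
   (real ^ 'n \<Rightarrow> real) \<Rightarrow> (real \<Rightarrow> real \<Rightarrow> real) \<Rightarrow> bool" where
  "radial_mollifiers mul iv nrm \<sigma> \<longleftrightarrow>
     (\<forall>n>0. \<forall>r>0. \<sigma> n r \<ge> 0) \<and>
     (\<forall>n>0. (LINT x|lebesgue. \<sigma> n (nrm x)) = 1) \<and>
     (\<forall>\<delta>>0. ((\<lambda>n. LINT x:(- gball mul iv nrm 0 \<delta>)|lebesgue. \<sigma> n (nrm x)) \<longlongrightarrow> 0) at_top)"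

end

theory Submission
  imports Defs "HOL-Probability.Probability"
begin

text \<open>
  Fix \<open>x\<close> and \<open>h\<close> with \<open>h\<close> of size at most a multiple of \<open>R\<close>. The first layer generates the group,
  so for \<open>s \<le> R\<close> the point \<open>h\<close> is a product of about \<open>R / s\<close> elements of norm at most \<open>s\<close>.
  Telescoping along such a chain, averaging each increment over a ball of radius comparable to \<open>s\<close>
  and using the invariance of Lebesgue measure under both translations bounds the mean oscillation on
  a ball of radius \<open>R\<close> by \<open>(R / s)\<^sup>p s\<^sup>-\<^sup>Q\<close> times the integral of \<open>|f x - f y|\<^sup>p\<close> over the pairs of
  distance less than \<open>s\<close>. Multiplying by \<open>\<psi> s * s ^ q\<close> and integrating over \<open>0 < s < R\<close> gives both
  inequalities: \<open>q = 0\<close> for the kernel \<open>\<phi>\<close> and \<open>q = Q - 1\<close> for the mollifiers, with \<open>\<beta> = 1\<close>; the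
  monotonicity of \<open>\<psi>\<close> lets \<open>\<psi>\<close> be pulled out of the inner integral in \<open>s\<close>. That dilations are
  automorphisms, and that Lebesgue measure is bi-invariant, is derived from the Lie algebra structure.
\<close>

text \<open>A function in \<open>Lp_loc p\<close> has no derivative to integrate along a curve, and
  a single increment \<open>e\<close> corresponds to a null set of pairs, invisible to the double
  integral. This is why \<open>x\<close> and \<open>x \<odot> e\<close> are compared through
  \<open>x \<odot> g\<close> with \<open>g\<close> running over a ball; dividing by the volume of
  that ball produces the factor s^(-Q). The length of the chains must grow only linearly in R / s,
  since its p-th power is what becomes R^p. Density of the semigroup generated by the first layer
  gives approximate chains only, so the remaining error is connected again at a smaller scale. In
  the integration over s put c = p + Q - q - 1. The integral of s^(-c-1) over s > d is d^(-c) / c,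
  which is the power of the distance in the kernel, and q \<le> Q - 1 gives c \<ge> 1, so that 1 / c
  is harmless. All geometric constants are fixed before p, whence one \<mu> serves every p. The
  group law is known only through its bracket and its straight one-parameter subgroups. Integrating
  a Lie algebra map to a group map is done by showing that suitable curves have zero
  derivative.\<close>

section \<open>Derivatives of curves\<close>

lemma has_vector_derivative_line:
  assumes "(F has_derivative F') (at 0)"
  shows "((\<lambda>t. F (t *\<^sub>R x)) has_vector_derivative F' x) (at 0)"
proof -
  have "((F \<circ> (\<lambda>t. t *\<^sub>R x)) has_derivative F' \<circ> (\<lambda>t. t *\<^sub>R x)) (at 0)"
    by (rule diff_chain_at) (auto intro!: derivative_eq_intros assms)
  moreover have "F' (t *\<^sub>R x) = t *\<^sub>R F' x" for t
    using has_derivative_linear[OF assms] by (rule linear_cmul)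
  ultimately show ?thesis
    by (simp add: has_vector_derivative_def o_def)
qed

lemma has_vector_derivative_tendsto_at_0:
  assumes "(g has_vector_derivative d) (at 0)"
  shows "((\<lambda>t. (g t - g 0) /\<^sub>R t) \<longlongrightarrow> d) (at 0)"
proof -
  have "((\<lambda>y. norm (g y - g 0 - y *\<^sub>R d) / norm y) \<longlongrightarrow> 0) (at 0)"
    using assms unfolding has_vector_derivative_def has_derivative_iff_norm by simp
  moreover have "norm (g y - g 0 - y *\<^sub>R d) / norm y = norm ((g y - g 0) /\<^sub>R y - d)" if "y \<noteq> 0" for y
  proof -
    have "(g y - g 0) /\<^sub>R y - d = (g y - g 0 - y *\<^sub>R d) /\<^sub>R y"
      using that by (simp add: algebra_simps)
    then show ?thesis by (simp add: divide_inverse mult.commute)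
  qed
  ultimately have "((\<lambda>y. norm ((g y - g 0) /\<^sub>R y - d)) \<longlongrightarrow> 0) (at 0)"
    by (subst (asm) tendsto_cong) (auto simp: eventually_at_filter)
  then show ?thesis
    using LIM_zero_iff tendsto_norm_zero_iff by blast
qed

text \<open>The discrete form of the derivative fits the group structure:
  \<open>real (Suc n) *\<^sub>R x\<close> is a group power of \<open>x\<close>, so these sequences
  stay inside sets closed under products.\<close>

lemma has_vector_derivative_sequentially:
  assumes "(g has_vector_derivative d) (at 0)"
  shows "(\<lambda>n. real (Suc n) *\<^sub>R (g (1 / real (Suc n)) - g 0)) \<longlonglongrightarrow> d"
proof -
  have "filterlim (\<lambda>n. 1 / real (Suc n)) (at 0) sequentially"
    using LIMSEQ_inverse_real_of_nat by (auto simp: filterlim_at inverse_eq_divide)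
  from filterlim_compose[OF has_vector_derivative_tendsto_at_0[OF assms] this]
  show ?thesis by simp
qed

lemma has_derivative_partial:
  fixes D :: "'a::real_normed_vector \<times> 'b::real_normed_vector \<Rightarrow> 'c::real_normed_vector"
  assumes "(F has_derivative D) (at (x, y))"
  shows "((\<lambda>u. F (u, y)) has_derivative (\<lambda>u. D (u, 0))) (at x)"
    and "((\<lambda>v. F (x, v)) has_derivative (\<lambda>v. D (0, v))) (at y)"
proof -
  have "((F \<circ> (\<lambda>u. (u, y))) has_derivative D \<circ> (\<lambda>u. (u, 0))) (at x)"
    by (rule diff_chain_at) (use assms in \<open>auto intro!: derivative_eq_intros\<close>)
  then show "((\<lambda>u. F (u, y)) has_derivative (\<lambda>u. D (u, 0))) (at x)" by (simp add: o_def)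
  have "((F \<circ> (\<lambda>v. (x, v))) has_derivative D \<circ> (\<lambda>v. (0, v))) (at y)"
    by (rule diff_chain_at) (use assms in \<open>auto intro!: derivative_eq_intros\<close>)
  then show "((\<lambda>v. F (x, v)) has_derivative (\<lambda>v. D (0, v))) (at y)" by (simp add: o_def)
qed

lemma has_vector_derivative_comp:
  assumes "(g has_vector_derivative d) (at t)" "(F has_derivative F') (at (g t))"
  shows "((\<lambda>s. F (g s)) has_vector_derivative F' d) (at t)"
proof -
  have "((F \<circ> g) has_derivative F' \<circ> (\<lambda>s. s *\<^sub>R d)) (at t)"
    by (rule diff_chain_at) (use assms in \<open>auto simp: has_vector_derivative_def\<close>)
  moreover have "F' (s *\<^sub>R d) = s *\<^sub>R F' d" for s
    using has_derivative_linear[OF assms(2)] by (rule linear_cmul)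
  ultimately show ?thesis
    by (simp add: has_vector_derivative_def o_def)
qed

text \<open>By the one-parameter law the curves studied below factor at time \<open>t + h\<close>
  into a part for \<open>t\<close> and a part for \<open>h\<close>. All derivatives are therefore
  computed at \<open>0\<close> and moved to \<open>t\<close> by this lemma.\<close>

lemma has_vector_derivative_shift:
  assumes "((\<lambda>h. g (t + h)) has_vector_derivative d) (at 0)"
  shows "(g has_vector_derivative d) (at t)"
proof -
  have "((\<lambda>s. s - t) has_vector_derivative 1) (at t)"
    by (auto intro!: derivative_eq_intros)
  then have "((\<lambda>s. g (t + (s - t))) has_vector_derivative 1 *\<^sub>R d) (at t)"
    using has_vector_derivative_comp[of "\<lambda>s. s - t" 1 t "\<lambda>h. g (t + h)" "\<lambda>x. x *\<^sub>R d"] assms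
    by (auto simp: has_vector_derivative_def)
  then show ?thesis by simp
qed

text \<open>Stands in for uniqueness of solutions of differential equations: two candidates are
  compared through a quotient or a difference whose derivative is zero.\<close>

lemma constant_of_zero_vector_derivative:
  assumes "\<And>t. (g has_vector_derivative 0) (at t)"
  shows "g t = g (0::real)"
proof -
  have "\<And>x. x \<in> UNIV \<Longrightarrow> (g has_derivative (\<lambda>h. 0)) (at x within UNIV)"
    using assms by (simp add: has_vector_derivative_def)
  then obtain c where "\<And>x. x \<in> UNIV \<Longrightarrow> g x = c"
    using has_derivative_zero_constant[of UNIV g] by auto
  then show ?thesis by simp
qed

section \<open>The group law in canonical coordinates\<close>

context carnot_group
begin

notation mul (infixl "\<odot>" 70)

interpretation G: Groups.group mul 0 iv by (rule group)

lemma iv_eq: "iv x = - x"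
proof -
  have "(- x) \<odot> x = 0"
    using one_param[of "-1" x 1] by simp
  then show ?thesis by (metis G.inverse_unique G.inverse_inverse)
qed

lemma mul_minus [simp]: "x \<odot> (- x) = 0" "(- x) \<odot> x = 0"
  using one_param[of 1 x "-1"] one_param[of "-1" x 1] by simp_all

lemma mul_zero [simp]: "x \<odot> 0 = x" "0 \<odot> x = x"
  by (simp_all)

lemma mul_assoc: "(x \<odot> y) \<odot> z = x \<odot> (y \<odot> z)"
  by (rule G.assoc)

lemma mul_cancel [simp]: "x \<odot> (- x \<odot> y) = y" "- x \<odot> (x \<odot> y) = y"
    "(y \<odot> x) \<odot> - x = y" "(y \<odot> - x) \<odot> x = y"
  by (simp add: mul_assoc[symmetric])
     (simp add: mul_assoc[symmetric], simp_all add: mul_assoc)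

lemma minus_mul: "- (x \<odot> y) = - y \<odot> - x"
  using G.inverse_distrib_swap[of x y] by (simp add: iv_eq)

lemma mul_scaleR_Suc: "(real (Suc n) *\<^sub>R x) = (real n *\<^sub>R x) \<odot> x"
  using one_param[of "real n" x 1] by (simp add: add.commute)

definition MUL :: "(real^'n) \<times> (real^'n) \<Rightarrow> real^'n" where
  "MUL = (\<lambda>(x, y). x \<odot> y)"

text \<open>The total derivative of the product. Its values on \<open>(0, v)\<close> and on
  \<open>(v, 0)\<close> are the differentials of left and of right translation.\<close>

definition DM :: "(real^'n) \<times> (real^'n) \<Rightarrow> (real^'n) \<times> (real^'n) \<Rightarrow> real^'n" where
  "DM z = frechet_derivative MUL (at z)"

lemma MUL_differentiable: "MUL differentiable (at z)"
  and DM_differentiable: "(\<lambda>z. DM z v) differentiable (at z)"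
proof -
  have "smooth MUL" using smooth_mul by (simp add: MUL_def)
  then have *: "times_differentiable (Suc (Suc 0)) MUL" unfolding smooth_def by blast
  note ** = *[unfolded times_differentiable.simps(2)]
  show "MUL differentiable (at z)"
    by (rule **[THEN conjunct1, rule_format])
  show "(\<lambda>z. DM z v) differentiable (at z)"
    unfolding DM_def by (rule **[THEN conjunct2, rule_format, THEN conjunct1, rule_format])
qed

lemma MUL_has_derivative: "(MUL has_derivative DM z) (at z)"
  using MUL_differentiable unfolding DM_def by (simp add: frechet_derivative_works)

lemma DM_linear: "linear (DM z)"
  using MUL_has_derivative has_derivative_linear by blast

lemma mul_left_has_derivative: "((\<lambda>y. x \<odot> y) has_derivative (\<lambda>v. DM (x, y) (0, v))) (at y)"
  and mul_right_has_derivative: "((\<lambda>x. x \<odot> y) has_derivative (\<lambda>v. DM (x, y) (v, 0))) (at x)"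
  using has_derivative_partial[OF MUL_has_derivative] by (simp_all add: MUL_def)

lemma DM_00: "DM (0, 0) (u, v) = u + v"
proof -
  have "(\<lambda>v. DM (0, 0) (0, v)) = (\<lambda>v. v)" 
    by (rule has_derivative_unique[OF mul_left_has_derivative]) simp
  moreover have "(\<lambda>v. DM (0, 0) (v, 0)) = (\<lambda>v. v)" 
    by (rule has_derivative_unique[OF mul_right_has_derivative]) simp
  moreover have "DM (0, 0) (u, v) = DM (0, 0) (u, 0) + DM (0, 0) (0, v)"
    using linear_add[OF DM_linear, of "(0,0)" "(u,0)" "(0,v)"] by simp
  ultimately show ?thesis by metis
qed

lemma mul_curve_has_vector_derivative:
  assumes "(a has_vector_derivative a') (at t)" "(b has_vector_derivative b') (at t)"
  shows "((\<lambda>s. a s \<odot> b s) has_vector_derivative DM (a t, b t) (a', b')) (at t)"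
proof -
  have "((\<lambda>s. (a s, b s)) has_vector_derivative (a', b')) (at t)"
    using assms by (rule has_vector_derivative_Pair)
  from has_vector_derivative_comp[OF this MUL_has_derivative]
  show ?thesis by (simp add: MUL_def)
qed

lemma continuous_on_mul [continuous_intros]:
  assumes "continuous_on S f" "continuous_on S g"
  shows "continuous_on S (\<lambda>x. f x \<odot> g x)"
proof -
  have "continuous_on UNIV MUL"
    by (meson MUL_differentiable differentiable_imp_continuous_within continuous_at_imp_continuous_on)
  then have "continuous_on S (\<lambda>x. MUL (f x, g x))"
    by (rule continuous_on_compose2) (auto intro!: continuous_intros assms)
  then show ?thesis by (simp add: MUL_def)
qed

lemma differentiable_mul [derivative_intros]:
  assumes "f differentiable (at x)" "g differentiable (at x)"
  shows "(\<lambda>x. f x \<odot> g x) differentiable (at x)"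
proof -
  have "(\<lambda>x. (f x, g x)) differentiable (at x)"
    using assms by (rule differentiable_Pair)
  then have "(MUL \<circ> (\<lambda>x. (f x, g x))) differentiable (at x)"
    using MUL_differentiable by (intro differentiable_chain_at)
  then show ?thesis by (simp add: MUL_def o_def)
qed

text \<open>Since \<open>n *\<^sub>R x\<close> is the \<open>n\<close>-th power of \<open>x\<close>, an endomorphism satisfies
  \<open>n *\<^sub>R A (x / n) = A x\<close>; the left-hand side tends to the derivative at \<open>0\<close>.\<close>

lemma endomorphism_linear:
  assumes hom: "\<And>x y. A (x \<odot> y) = A x \<odot> A y" and diff: "(A has_derivative A') (at 0)"
  shows "A = A'"
proof
  fix x
  have A0: "A 0 = 0"
    using hom[of 0 0] by (metis mul_cancel(2) mul_minus(2) mul_zero(1))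
  have pow: "A (real n *\<^sub>R x) = real n *\<^sub>R A x" for n x
    by (induction n) (simp add: A0, simp only: mul_scaleR_Suc hom)
  have "real (Suc n) *\<^sub>R A ((1 / real (Suc n)) *\<^sub>R x) = A x" for n
    by (subst pow[symmetric]) simp
  moreover have "(\<lambda>n. real (Suc n) *\<^sub>R (A ((1 / real (Suc n)) *\<^sub>R x) - A (0 *\<^sub>R x))) \<longlonglongrightarrow> A' x"
    by (rule has_vector_derivative_sequentially[OF has_vector_derivative_line[OF diff]])
  ultimately have "(\<lambda>n. A x) \<longlonglongrightarrow> A' x" by (simp add: A0)
  then show "A x = A' x" by (simp add: LIMSEQ_const_iff)
qed

section \<open>The adjoint action and the bracket\<close>

text \<open>Conjugation on the group. In canonical coordinates it agrees with its own differential
  at \<open>0\<close>, so the same function serves as the adjoint action on the Lie algebra.\<close>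

definition Ad where "Ad x y = (x \<odot> y) \<odot> - x"

lemma Ad_0 [simp]: "Ad 0 y = y" by (simp add: Ad_def)

lemma Ad_Ad: "Ad x (Ad y z) = Ad (x \<odot> y) z"
  by (simp add: Ad_def mul_assoc minus_mul)

lemma Ad_add: "Ad (s *\<^sub>R x) (Ad (t *\<^sub>R x) z) = Ad ((s + t) *\<^sub>R x) z"
  by (simp add: Ad_Ad one_param)

lemma Ad_mul: "Ad x (y \<odot> z) = Ad x y \<odot> Ad x z"
  by (simp add: Ad_def mul_assoc)

lemma Ad_differentiable: "(\<lambda>(x, y). Ad x y) differentiable (at z)"
proof -
  have "(\<lambda>z. (fst z \<odot> snd z) \<odot> - fst z) differentiable (at z)"
    by (intro differentiable_mul differentiable_minus)
       (auto intro!: bounded_linear_imp_differentiable bounded_linear_fst bounded_linear_snd)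
  then show ?thesis by (simp add: Ad_def case_prod_unfold)
qed

text \<open>Conjugation is a differentiable endomorphism, hence equal to its derivative at
  \<open>0\<close> by \<open>endomorphism_linear\<close>.\<close>

lemma Ad_linear: "linear (Ad x)"
proof -
  obtain D where D: "((\<lambda>(x, y). Ad x y) has_derivative D) (at (x, 0))"
    using Ad_differentiable unfolding differentiable_def by blast
  have "(Ad x has_derivative (\<lambda>v. D (0, v))) (at 0)"
    using has_derivative_partial(2)[OF D] by simp
  note d = this
  have "Ad x = (\<lambda>v. D (0, v))" by (rule endomorphism_linear[OF Ad_mul d])
  moreover have "linear (\<lambda>v. D (0, v))" by (rule has_derivative_linear[OF d])
  ultimately show ?thesis by (simp only:)
qed

abbreviation LF where "LF v x \<equiv> left_field mul v x"

lemma LF_eq: "LF v x = DM (x, 0) (0, v)"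
  unfolding left_field_def using frechet_derivative_at[OF mul_left_has_derivative[of x 0]] 
  by metis

lemma LF_linear: "linear (\<lambda>v. LF v x)"
  unfolding LF_eq using mul_left_has_derivative has_derivative_linear by blast

lemma LF_0 [simp]: "LF v 0 = v"
  by (simp add: LF_eq DM_00)

lemma mul_left_has_derivative_0: "((\<lambda>y. x \<odot> y) has_derivative (\<lambda>v. LF v x)) (at 0)"
  using mul_left_has_derivative[of x 0] by (simp add: LF_eq)

text \<open>Right translation is left translation conjugated by inversion, which here is negation.
  The two signs cancel and leave the left-invariant field at \<open>- x\<close>.\<close>

lemma mul_right_has_derivative_0: "((\<lambda>y. y \<odot> x) has_derivative (\<lambda>v. LF v (- x))) (at 0)"
proof -
  have "((\<lambda>y. - x \<odot> y) has_derivative (\<lambda>v. LF v (- x))) (at (- 0))"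
    using mul_left_has_derivative_0[of "- x"] by simp
  moreover have "(uminus has_derivative (uminus :: real^'n \<Rightarrow> _)) (at 0)"
    by (auto intro!: derivative_eq_intros)
  ultimately have "((\<lambda>y. - x \<odot> y) \<circ> uminus has_derivative (\<lambda>v. LF v (- x)) \<circ> uminus) (at 0)"
    by (intro diff_chain_at) auto
  then have "((\<lambda>y. - (- x \<odot> - y)) has_derivative (\<lambda>v. - LF (- v) (- x))) (at 0)"
    by (intro has_derivative_minus) (simp add: o_def)
  then show ?thesis by (simp add: minus_mul linear_neg[OF LF_linear])
qed

lemma LF_differentiable: "(\<lambda>x. LF v x) differentiable (at x)"
proof -
  have "((\<lambda>z. DM z (0, v)) \<circ> (\<lambda>x. (x, 0))) differentiable (at x)"
    by (intro differentiable_chain_at DM_differentiable differentiable_Pair)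
       (auto intro!: derivative_intros)
  then show ?thesis by (simp add: LF_eq[abs_def] o_def)
qed

definition B where "B u v = frechet_derivative (\<lambda>x. LF v x) (at 0) u"

lemma LF_has_derivative: "((\<lambda>x. LF v x) has_derivative (\<lambda>u. B u v)) (at 0)"
  unfolding B_def using LF_differentiable by (simp add: frechet_derivative_works[symmetric])

lemma B_linear_left: "linear (\<lambda>u. B u v)"
  using LF_has_derivative has_derivative_linear by blast

lemma B_linear_right: "linear (B u)"
proof (rule linearI)
  fix v w c
  have "((\<lambda>x. LF (v + w) x) has_derivative (\<lambda>u. B u v + B u w)) (at 0)"
    unfolding linear_add[OF LF_linear] by (intro has_derivative_add LF_has_derivative)
  from has_derivative_unique[OF LF_has_derivative this] show "B u (v + w) = B u v + B u w" by metis
  have "((\<lambda>x. LF (c *\<^sub>R v) x) has_derivative (\<lambda>u. c *\<^sub>R B u v)) (at 0)"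
    unfolding linear_cmul[OF LF_linear] by (intro has_derivative_scaleR_right LF_has_derivative)
  from has_derivative_unique[OF LF_has_derivative this] show "B u (c *\<^sub>R v) = c *\<^sub>R B u v" by metis
qed

text \<open>The straight line through \<open>u\<close> is an integral curve of the left-invariant
  field of \<open>u\<close>, so the field takes the constant value \<open>u\<close> along
  it.\<close>

lemma LF_self: "LF u (s *\<^sub>R u) = u"
proof -
  have "((\<lambda>t. s *\<^sub>R u \<odot> t *\<^sub>R u) has_vector_derivative LF u (s *\<^sub>R u)) (at 0)"
    by (rule has_vector_derivative_line[OF mul_left_has_derivative_0])
  moreover have "((\<lambda>t. s *\<^sub>R u \<odot> t *\<^sub>R u) has_vector_derivative u) (at 0)"
    unfolding one_param by (auto intro!: derivative_eq_intros)
  ultimately show ?thesis by (rule vector_derivative_unique_at)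
qed

text \<open>\<open>B\<close> is the mixed second derivative of the multiplication at the identity. Its antisymmetry
  is special to canonical coordinates; it replaces the symmetry of second derivatives below.\<close>

lemma B_self: "B u u = 0"
proof -
  have "((\<lambda>s. LF u (s *\<^sub>R u)) has_vector_derivative B u u) (at 0)"
    by (rule has_vector_derivative_line[OF LF_has_derivative])
  then have "((\<lambda>s::real. u) has_vector_derivative B u u) (at 0)" by (simp add: LF_self)
  from vector_derivative_unique_at[OF this has_vector_derivative_const] show ?thesis .
qed

lemma B_antisym: "B v u = - B u v"
proof -
  have "B (u + v) (u + v) = B u u + B u v + (B v u + B v v)"
    by (simp add: linear_add[OF B_linear_left] linear_add[OF B_linear_right])
  then show ?thesis by (simp add: B_self eq_neg_iff_add_eq_0 add.commute)
qed

abbreviation lb where "lb u v \<equiv> lie_bracket mul u v"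

text \<open>In these coordinates the product begins with x + y + [x, y] / 2, and \<open>B\<close> is
  its bilinear term; this accounts for the factor 2.\<close>

lemma lb_eq: "lb u v = 2 *\<^sub>R B u v"
proof -
  have "lb u v = B u v - B v u"
    by (simp add: lie_bracket_def field_bracket_def B_def)
  then show ?thesis by (simp add: B_antisym[of v u] scaleR_2)
qed

lemma lb_linear_left: "linear (\<lambda>u. lb u v)" and lb_linear_right: "linear (lb u)"
  unfolding lb_eq by (intro linear_compose_scale_right B_linear_left B_linear_right)+

text \<open>Differentiate \<open>Ad x y \<odot> x = x \<odot> y\<close> at \<open>y = 0\<close>;
  \<open>LF\<close> at \<open>- x\<close> is the differential of right translation by
  \<open>x\<close>.\<close>

lemma LF_Ad: "LF (Ad x v) (- x) = LF v x"
proof -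
  have "linear (Ad x)" by (rule Ad_linear)
  then have "(Ad x has_derivative Ad x) (at 0)"
    by (simp add: linear_imp_has_derivative)
  moreover have "((\<lambda>y. y \<odot> x) has_derivative (\<lambda>v. LF v (- x))) (at (Ad x 0))"
    using mul_right_has_derivative_0 by (simp add: Ad_def)
  ultimately have "((\<lambda>y. y \<odot> x) \<circ> Ad x has_derivative (\<lambda>v. LF v (- x)) \<circ> Ad x) (at 0)"
    by (rule diff_chain_at)
  moreover have "(\<lambda>y. y \<odot> x) \<circ> Ad x = (\<lambda>y. x \<odot> y)"
    by (auto simp: Ad_def)
  ultimately have "((\<lambda>y. x \<odot> y) has_derivative (\<lambda>v. LF v (- x)) \<circ> Ad x) (at 0)" by simp
  from has_derivative_unique[OF this mul_left_has_derivative_0] show ?thesis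
    by (metis comp_apply)
qed

text \<open>The product rule applied to \<open>LF_Ad\<close> along \<open>s *\<^sub>R u\<close>:
  with \<open>d\<close> the unknown derivative, the left side contributes \<open>d - B u v\<close>
  and the right side \<open>B u v\<close>. Hence \<open>d = 2 *\<^sub>R B u v\<close>, which is the
  bracket.\<close>

lemma Ad_has_vector_derivative:
  "((\<lambda>s. Ad (s *\<^sub>R u) v) has_vector_derivative lb u v) (at 0)"
proof -
  obtain D where D: "((\<lambda>(x, y). Ad x y) has_derivative D) (at (0, v))"
    using Ad_differentiable unfolding differentiable_def by blast
  define d where "d = D (u, 0)"
  have d: "((\<lambda>s. Ad (s *\<^sub>R u) v) has_vector_derivative d) (at 0)"
    unfolding d_def using has_derivative_partial(1)[OF D] by (intro has_vector_derivative_line) simp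
  \<comment> \<open>Expanding in the basis separates the dependence on the vector, which is linear,
    from that on the base point, so the rule for bilinear products applies to each summand.\<close>
  have expand: "LF w x = (\<Sum>i\<in>UNIV. (w $ i) *\<^sub>R LF (axis i 1) x)" for w x
    by (subst basis_expansion[symmetric, of w])
       (simp add: linear_sum[OF LF_linear] linear_cmul[OF LF_linear] scalar_mult_eq_scaleR)
  have Bexpand: "B u w = (\<Sum>i\<in>UNIV. (w $ i) *\<^sub>R B u (axis i 1))" for w
    by (subst basis_expansion[symmetric, of w])
       (simp add: linear_sum[OF B_linear_right] linear_cmul[OF B_linear_right] scalar_mult_eq_scaleR)
  have neg: "((\<lambda>s. LF w (- (s *\<^sub>R u))) has_vector_derivative - B u w) (at 0)" for w
    using has_vector_derivative_line[OF LF_has_derivative, of w "- u"]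
    by (simp add: linear_neg[OF B_linear_left])
  have comp: "((\<lambda>s. Ad (s *\<^sub>R u) v $ i) has_vector_derivative d $ i) (at 0)" for i
    using bounded_linear.has_vector_derivative[OF bounded_linear_vec_nth d] .
  have "((\<lambda>s. \<Sum>i\<in>UNIV. (Ad (s *\<^sub>R u) v $ i) *\<^sub>R LF (axis i 1) (- (s *\<^sub>R u)))
      has_vector_derivative (\<Sum>i\<in>UNIV. (v $ i) *\<^sub>R (- B u (axis i 1)) + (d $ i) *\<^sub>R axis i 1)) (at 0)"
    by (rule has_vector_derivative_sum)
       (use bounded_bilinear.has_vector_derivative[OF bounded_bilinear_scaleR comp neg] in
         \<open>simp\<close>)
  then have "((\<lambda>s. LF v (s *\<^sub>R u)) has_vector_derivative d - B u v) (at 0)"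
    unfolding expand[symmetric] LF_Ad
    by (simp add: sum.distrib sum_subtractf Bexpand[of v] basis_expansion[of d, unfolded scalar_mult_eq_scaleR])
  from vector_derivative_unique_at[OF this has_vector_derivative_line[OF LF_has_derivative]]
  have "d = lb u v" by (simp add: lb_eq scaleR_2 algebra_simps)
  then show ?thesis using d by simp
qed

lemma Ad_curve_has_vector_derivative:
  assumes a: "(a has_vector_derivative a') (at 0)" "a 0 = 0" and b: "(b has_vector_derivative b') (at 0)"
  shows "((\<lambda>s. Ad (a s) (b s)) has_vector_derivative lb a' (b 0) + b') (at 0)"
proof -
  obtain D where D: "((\<lambda>(x, y). Ad x y) has_derivative D) (at (0, b 0))"
    using Ad_differentiable unfolding differentiable_def by blast
  have "((\<lambda>s. (a s, b s)) has_vector_derivative (a', b')) (at 0)"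
    using a(1) b by (rule has_vector_derivative_Pair)
  from has_vector_derivative_comp[OF this, of "\<lambda>(x, y). Ad x y" D] D a(2)
  have *: "((\<lambda>s. Ad (a s) (b s)) has_vector_derivative D (a', b')) (at 0)" by simp
  have "((\<lambda>s. Ad (s *\<^sub>R a') (b 0)) has_vector_derivative D (a', 0)) (at 0)"
    using has_derivative_partial(1)[OF D] by (intro has_vector_derivative_line) simp
  then have 1: "D (a', 0) = lb a' (b 0)"
    using Ad_has_vector_derivative vector_derivative_unique_at by blast
  have "((\<lambda>y. y) has_derivative (\<lambda>v. D (0, v))) (at (b 0))"
    using has_derivative_partial(2)[OF D] by simp
  then have 2: "D (0, b') = b'"
    using has_derivative_unique[OF _ has_derivative_ident] by metis
  have "D (a', b') = D (a', 0) + D (0, b')"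
    using linear_add[OF has_derivative_linear[OF D], of "(a', 0)" "(0, b')"] by simp
  then show ?thesis using * 1 2 by simp
qed

text \<open>An endomorphism intertwines conjugation by \<open>s *\<^sub>R u\<close> with conjugation
  by its image; the derivative at \<open>s = 0\<close> of this identity relates the
  brackets.\<close>

lemma endomorphism_lb:
  assumes hom: "\<And>x y. A (x \<odot> y) = A x \<odot> A y" and lin: "linear A"
  shows "A (lb u v) = lb (A u) (A v)"
proof -
  have "A (Ad (s *\<^sub>R u) v) = Ad (s *\<^sub>R A u) (A v)" for s
    unfolding Ad_def hom by (simp only: linear_cmul[OF lin] linear_neg[OF lin])
  then have "((\<lambda>s. A (Ad (s *\<^sub>R u) v)) has_vector_derivative lb (A u) (A v)) (at 0)"
    using Ad_has_vector_derivative by simp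
  moreover have "((\<lambda>s. A (Ad (s *\<^sub>R u) v)) has_vector_derivative A (lb u v)) (at 0)"
    using lin by (rule bounded_linear.has_vector_derivative[OF iffD1[OF linear_conv_bounded_linear] Ad_has_vector_derivative])
  ultimately show ?thesis by (rule vector_derivative_unique_at[rotated])
qed

lemma bounded_bilinear_lb: "bounded_bilinear lb"
  unfolding bilinear_conv_bounded_bilinear[symmetric] bilinear_def
  using lb_linear_left lb_linear_right by blast

text \<open>Conjugations preserve the bracket. Differentiating this along
  \<open>t *\<^sub>R w\<close> at \<open>t = 0\<close> says that bracketing with \<open>w\<close> is
  a derivation.\<close>

lemma jacobi: "lb w (lb u v) = lb (lb w u) v + lb u (lb w v)"
proof -
  have "Ad (t *\<^sub>R w) (lb u v) = lb (Ad (t *\<^sub>R w) u) (Ad (t *\<^sub>R w) v)" for t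
    by (rule endomorphism_lb[of "Ad (t *\<^sub>R w)", OF Ad_mul Ad_linear])
  moreover have "((\<lambda>t. lb (Ad (t *\<^sub>R w) u) (Ad (t *\<^sub>R w) v)) has_vector_derivative
      lb u (lb w v) + lb (lb w u) v) (at 0)"
    using bounded_bilinear.has_vector_derivative[OF bounded_bilinear_lb
        Ad_has_vector_derivative[of w u] Ad_has_vector_derivative[of w v]] by simp
  ultimately have "((\<lambda>t. Ad (t *\<^sub>R w) (lb u v)) has_vector_derivative
      lb u (lb w v) + lb (lb w u) v) (at 0)" by simp
  from vector_derivative_unique_at[OF Ad_has_vector_derivative this] show ?thesis
    by (simp add: add.commute)
qed

end

text \<open>The factor \<open>h\<close> makes continuity of \<open>g\<close> sufficient. It is
  applied to \<open>MC (h *\<^sub>R x) v\<close>, so that no derivative of \<open>MC\<close> has to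
  be computed.\<close>

lemma has_vector_derivative_scaleR_continuous:
  fixes g :: "real \<Rightarrow> 'a::real_normed_vector"
  assumes "isCont g 0"
  shows "((\<lambda>h. h *\<^sub>R g h) has_vector_derivative g 0) (at 0)"
  unfolding has_vector_derivative_def has_derivative_iff_norm
proof (intro conjI)
  show "bounded_linear (\<lambda>h. h *\<^sub>R g 0)" by (rule bounded_linear_scaleR_left)
  have "((\<lambda>h. norm (g h - g 0)) \<longlongrightarrow> 0) (at 0)"
    using assms by (simp add: isCont_def LIM_zero tendsto_norm_zero)
  moreover have "norm (h *\<^sub>R g h - 0 *\<^sub>R g 0 - (h - 0) *\<^sub>R g 0) / norm (h - 0) = norm (g h - g 0)"
    if "h \<noteq> 0" for h :: real
    using that by (simp flip: scaleR_diff_right)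
  ultimately show "((\<lambda>h. norm (h *\<^sub>R g h - 0 *\<^sub>R g 0 - (h - 0) *\<^sub>R g 0) / norm (h - 0)) \<longlongrightarrow> 0) (at 0)"
    by (subst tendsto_cong) (auto simp: eventually_at_filter)
qed

section \<open>The grading of the bracket and the dilations\<close>

context carnot_group
begin

lemma minus_one_param: "- ((s + t) *\<^sub>R x) = - (s *\<^sub>R x) \<odot> - (t *\<^sub>R x)"
  using one_param[of "- s" x "- t"] by (simp add: algebra_simps)

lemma layer_above: "m > k \<Longrightarrow> v \<in> layer wt m \<Longrightarrow> v = 0"
proof -
  assume "m > k" "v \<in> layer wt m"
  moreover have "{i. wt i = m} = {}"
    using wt_range \<open>m > k\<close> by (auto simp: leD)
  ultimately show "v = 0" by (simp add: layer_def)
qed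

lemma subspace_layer: "subspace (layer wt m)"
  by (simp add: layer_def)

lemma layer_lb_1:
  assumes "u \<in> layer wt 1" "v \<in> layer wt j" "1 \<le> j"
  shows "lb u v \<in> layer wt (Suc j)"
proof -
  consider "j < k" | "j = k" | "j > k" by linarith
  then show ?thesis
  proof cases
    case 1
    then show ?thesis using bracket_step[OF assms(3) 1] assms by (auto intro!: span_base)
  next
    case 2
    then show ?thesis using bracket_top assms subspace_0[OF subspace_layer] by auto
  next
    case 3
    then have "v = 0" using layer_above assms by blast
    then show ?thesis using linear_0[OF lb_linear_right] subspace_0[OF subspace_layer] by simp
  qed
qed

text \<open>Induction on \<open>i\<close>: the layer of number \<open>Suc i\<close> is spanned by
  brackets of the first layer with the previous one, and the Jacobi identity writes [[a, b], v] as
  [a, [b, v]] - [b, [a, v]]. Layers beyond \<open>k\<close> vanish, so the statement carries no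
  upper bound on the layer numbers.\<close>

lemma layer_lb:
  assumes "1 \<le> i" "u \<in> layer wt i" "v \<in> layer wt j" "1 \<le> j"
  shows "lb u v \<in> layer wt (i + j)"
  using assms
proof (induction i arbitrary: u v j rule: nat_induct_at_least)
  case base
  then show ?case using layer_lb_1 by simp
next
  case (Suc i)
  show ?case
  proof (cases "i < k")
    case True
    have "u \<in> span {lb a b |a b. a \<in> layer wt 1 \<and> b \<in> layer wt i}"
      using bracket_step[OF Suc.hyps True] Suc.prems by simp
    then show ?thesis
    proof (induction rule: span_induct)
      case base
      then have "subspace {u. lb u v \<in> layer wt (Suc i + j)}"
        using subspace_layer[of "Suc i + j"]
        by (auto simp: subspace_def linear_0[OF lb_linear_left] linear_add[OF lb_linear_left]
            linear_cmul[OF lb_linear_left])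
      then show ?case by simp
    next
      case (step x)
      then obtain a b where ab: "x = lb a b" "a \<in> layer wt 1" "b \<in> layer wt i" by blast
      have "lb x v = lb a (lb b v) - lb b (lb a v)"
        using jacobi[of a b v] ab(1) by simp
      moreover have "lb a (lb b v) \<in> layer wt (Suc (i + j))"
        using Suc ab by (intro layer_lb_1) auto
      moreover have "lb b (lb a v) \<in> layer wt (i + Suc j)"
        using Suc ab by (intro Suc.IH layer_lb_1) auto
      ultimately show ?case
        using subspace_diff[OF subspace_layer] by simp
    qed
  next
    case False
    then have "u = 0" using layer_above[of "Suc i" u] Suc.prems by simp
    then show ?thesis using linear_0[OF lb_linear_left] subspace_0[OF subspace_layer] by simp
  qed
qed

lemma linear_dilation: "linear (dilation wt l)"
  by (rule linearI) (simp_all add: dilation_def vec_eq_iff algebra_simps)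

lemma dilation_layer:
  assumes "v \<in> layer wt j"
  shows "dilation wt l v = l ^ j *\<^sub>R v"
proof -
  have "v \<in> span ((\<lambda>i. axis i 1) ` {i. wt i = j})" using assms by (simp add: layer_def)
  then show ?thesis
    by (rule linear_eq_on_span[OF linear_dilation linear_scaleR, rotated])
       (auto simp: dilation_def vec_eq_iff axis_def)
qed

lemma axis_in_layer: "axis i 1 \<in> layer wt (wt i)"
  unfolding layer_def by (rule span_base) auto

text \<open>Both sides are bilinear, so basis vectors suffice. The bracket of two of them lies in
  the layer whose number is the sum of their weights, where the dilation multiplies by the product
  of the two factors.\<close>

lemma dilation_lb: "dilation wt l (lb u v) = lb (dilation wt l u) (dilation wt l v)"
proof -
  have b: "bilinear lb" using bounded_bilinear_lb by (simp add: bilinear_conv_bounded_bilinear)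
  have "(\<lambda>u v. dilation wt l (lb u v)) = (\<lambda>u v. lb (dilation wt l u) (dilation wt l v))"
  proof (rule bilinear_eq_stdbasis)
    show "bilinear (\<lambda>u v. dilation wt l (lb u v))"
      using b linear_dilation by (auto simp: bilinear_def intro: linear_compose[unfolded o_def])
    show "bilinear (\<lambda>u v. lb (dilation wt l u) (dilation wt l v))"
      using b linear_dilation[of l]
      by (auto simp: bilinear_def intro: linear_compose[of "dilation wt l", unfolded o_def])
    fix a b :: "real^'n" assume "a \<in> Basis" "b \<in> Basis"
    then obtain i j where ij: "a = axis i 1" "b = axis j 1" by (auto simp: Basis_vec_def)
    have "lb a b \<in> layer wt (wt i + wt j)"
      using wt_range[of i] wt_range[of j] unfolding ij by (intro layer_lb axis_in_layer) auto
    then show "dilation wt l (lb a b) = lb (dilation wt l a) (dilation wt l b)"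
      by (simp add: dilation_layer ij dilation_layer[OF axis_in_layer] power_add
          linear_cmul[OF lb_linear_left] linear_cmul[OF lb_linear_right])
  qed
  then show ?thesis by metis
qed

section \<open>Lie algebra endomorphisms are group endomorphisms\<close>

context
  fixes A :: "real^'n \<Rightarrow> real^'n"
  assumes linA: "linear A" and lbA: "\<And>u v. A (lb u v) = lb (A u) (A v)"
begin

lemma bounded_linear_lb_hom: "bounded_linear A"
  using linA by (simp add: linear_conv_bounded_linear)

text \<open>The image of the adjoint orbit of \<open>v\<close> is pulled back by the adjoint action
  of \<open>- (t *\<^sub>R A x)\<close>. The derivative of the resulting curve is a conjugate of
  \<open>A (lb x w) - lb (A x) (A w)\<close>, which is zero.\<close>

lemma lb_hom_Ad: "A (Ad x v) = Ad (A x) (A v)"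
proof -
  define c where "c t = Ad (- (t *\<^sub>R A x)) (A (Ad (t *\<^sub>R x) v))" for t
  have "(c has_vector_derivative 0) (at t)" for t
  proof (rule has_vector_derivative_shift)
    define w where "w = Ad (t *\<^sub>R x) v"
    have "c (t + h) = Ad (- (t *\<^sub>R A x)) (Ad (h *\<^sub>R - A x) (A (Ad (h *\<^sub>R x) w)))" for h
    proof -
      have "Ad ((t + h) *\<^sub>R x) v = Ad (h *\<^sub>R x) w"
        by (simp add: w_def Ad_add add.commute)
      moreover have "- ((t + h) *\<^sub>R A x) = - (t *\<^sub>R A x) \<odot> (h *\<^sub>R - A x)"
        using minus_one_param[of t h "A x"] by simp
      ultimately show ?thesis by (simp only: c_def Ad_Ad)
    qed
    moreover have "((\<lambda>h. Ad (h *\<^sub>R - A x) (A (Ad (h *\<^sub>R x) w))) has_vector_derivative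
        lb (- A x) (A (Ad (0 *\<^sub>R x) w)) + A (lb x w)) (at 0)"
    proof (rule Ad_curve_has_vector_derivative)
      show "((\<lambda>h. h *\<^sub>R - A x) has_vector_derivative - A x) (at 0)"
        by (rule has_vector_derivative_line) simp
      show "((\<lambda>h. A (Ad (h *\<^sub>R x) w)) has_vector_derivative A (lb x w)) (at 0)"
        by (rule bounded_linear.has_vector_derivative[OF bounded_linear_lb_hom Ad_has_vector_derivative])
    qed simp
    moreover have "lb (- A x) (A (Ad (0 *\<^sub>R x) w)) + A (lb x w) = 0"
      by (simp add: lbA linear_neg[OF lb_linear_left])
    ultimately have *: "((\<lambda>h. Ad (h *\<^sub>R - A x) (A (Ad (h *\<^sub>R x) w))) has_vector_derivative 0) (at 0)"
      and **: "\<And>h. c (t + h) = Ad (- (t *\<^sub>R A x)) (Ad (h *\<^sub>R - A x) (A (Ad (h *\<^sub>R x) w)))"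
      by simp_all
    show "((\<lambda>h. c (t + h)) has_vector_derivative 0) (at 0)"
      unfolding **
      using bounded_linear.has_vector_derivative[OF Ad_linear[unfolded linear_conv_bounded_linear] *, of "- (t *\<^sub>R A x)"]
      by (simp add: linear_0[OF Ad_linear])
  qed
  then have "c 1 = c 0" by (rule constant_of_zero_vector_derivative)
  then have "Ad (- A x) (A (Ad x v)) = A v" by (simp add: c_def)
  then have "Ad (A x) (Ad (- A x) (A (Ad x v))) = Ad (A x) (A v)" by simp
  then show ?thesis by (simp only: Ad_Ad mul_minus Ad_0)
qed

end

text \<open>The inverse of the differential at \<open>0\<close> of left translation by \<open>x\<close>. Along a ray it is the
  primitive of the adjoint action (\<open>MC_line_has_vector_derivative\<close>), hence determined by the bracket;
  this takes the place of the Baker--Campbell--Hausdorff formula.\<close>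

definition MC where "MC x v = DM (- x, x) (0, v)"

lemma MC_has_derivative: "((\<lambda>y. - x \<odot> y) has_derivative MC x) (at x)"
  using mul_left_has_derivative[of "- x" x] by (simp add: MC_def[abs_def])

lemma MC_linear: "linear (MC x)"
  using MC_has_derivative has_derivative_linear by blast

lemma MC_0 [simp]: "MC 0 v = v"
  using DM_00[of 0 v] by (simp add: MC_def)

lemma MC_LF: "MC x (LF v x) = v"
proof -
  have "((\<lambda>y. - x \<odot> y) \<circ> (\<lambda>y. x \<odot> y) has_derivative MC x \<circ> (\<lambda>v. LF v x)) (at 0)"
    by (rule diff_chain_at[OF mul_left_has_derivative_0]) (simp add: MC_has_derivative)
  then have "((\<lambda>y. y) has_derivative MC x \<circ> (\<lambda>v. LF v x)) (at 0)" by (simp add: o_def)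
  from has_derivative_unique[OF this has_derivative_ident] show ?thesis by (metis comp_apply)
qed

lemma LF_MC: "LF (MC x v) x = v"
proof -
  have "((\<lambda>y. x \<odot> y) \<circ> (\<lambda>y. - x \<odot> y) has_derivative (\<lambda>v. LF v x) \<circ> MC x) (at x)"
    by (rule diff_chain_at[OF MC_has_derivative]) (simp add: mul_left_has_derivative_0)
  then have "((\<lambda>y. y) has_derivative (\<lambda>v. LF v x) \<circ> MC x) (at x)" by (simp add: o_def)
  from has_derivative_unique[OF this has_derivative_ident] show ?thesis by (metis comp_apply)
qed

lemma MC_curve_has_vector_derivative:
  "((\<lambda>t. - (s *\<^sub>R x) \<odot> s *\<^sub>R (x + t *\<^sub>R v)) has_vector_derivative s *\<^sub>R MC (s *\<^sub>R x) v) (at 0)"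
proof -
  have "((\<lambda>t. s *\<^sub>R (x + t *\<^sub>R v)) has_vector_derivative s *\<^sub>R v) (at 0)"
    by (auto intro!: derivative_eq_intros)
  from has_vector_derivative_comp[OF this, of "\<lambda>y. - (s *\<^sub>R x) \<odot> y" "MC (s *\<^sub>R x)"]
  show ?thesis using MC_has_derivative[of "s *\<^sub>R x"] linear_cmul[OF MC_linear] by simp
qed

text \<open>The element \<open>(s + h) *\<^sub>R (x + t *\<^sub>R v)\<close> is the product of its
  \<open>h\<close> part and its \<open>s\<close> part. Inserting this into the curve of
  \<open>MC_curve_has_vector_derivative\<close> and differentiating at \<open>t = 0\<close> gives
  the two summands.\<close>

lemma MC_cocycle:
  "(s + h) *\<^sub>R MC ((s + h) *\<^sub>R x) v =
     Ad (- (s *\<^sub>R x)) (h *\<^sub>R MC (h *\<^sub>R x) v) + s *\<^sub>R MC (s *\<^sub>R x) v"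
proof -
  define E where "E s t = - (s *\<^sub>R x) \<odot> s *\<^sub>R (x + t *\<^sub>R v)" for s t
  have E: "E (s + h) t = Ad (- (s *\<^sub>R x)) (E h t) \<odot> E s t" for t
  proof -
    have "- ((s + h) *\<^sub>R x) = - (s *\<^sub>R x) \<odot> - (h *\<^sub>R x)"
      by (rule minus_one_param)
    moreover have "(s + h) *\<^sub>R (x + t *\<^sub>R v) = h *\<^sub>R (x + t *\<^sub>R v) \<odot> s *\<^sub>R (x + t *\<^sub>R v)"
      by (simp only: one_param add.commute)
    ultimately show ?thesis unfolding E_def Ad_def by (simp add: mul_assoc)
  qed
  have E0: "E s 0 = 0" for s by (simp add: E_def)
  have dE: "(E s has_vector_derivative s *\<^sub>R MC (s *\<^sub>R x) v) (at 0)" for s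
    unfolding E_def[abs_def] by (rule MC_curve_has_vector_derivative)
  have "((\<lambda>t. Ad (- (s *\<^sub>R x)) (E h t)) has_vector_derivative
      Ad (- (s *\<^sub>R x)) (h *\<^sub>R MC (h *\<^sub>R x) v)) (at 0)"
    by (rule bounded_linear.has_vector_derivative[OF Ad_linear[unfolded linear_conv_bounded_linear] dE])
  from mul_curve_has_vector_derivative[OF this dE[of s]]
  have "(E (s + h) has_vector_derivative
     Ad (- (s *\<^sub>R x)) (h *\<^sub>R MC (h *\<^sub>R x) v) + s *\<^sub>R MC (s *\<^sub>R x) v) (at 0)"
    by (simp add: E0 linear_0[OF Ad_linear] DM_00 E[abs_def])
  from vector_derivative_unique_at[OF dE this] show ?thesis .
qed

text \<open>By the cocycle identity only the derivative at \<open>h = 0\<close> matters, and there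
  \<open>MC 0\<close> is the identity. In integrated form \<open>MC x\<close> is the mean of
  \<open>Ad (- (s *\<^sub>R x))\<close> over 0 < s < 1, classically (1 - exp(- ad x)) / ad
  x.\<close>

lemma MC_line_has_vector_derivative:
  "((\<lambda>s. s *\<^sub>R MC (s *\<^sub>R x) v) has_vector_derivative Ad (- (s *\<^sub>R x)) v) (at s)"
proof (rule has_vector_derivative_shift)
  have "isCont (\<lambda>h. DM (- (h *\<^sub>R x), h *\<^sub>R x) (0, v)) 0"
    by (rule isCont_o2[where g = "\<lambda>z. DM z (0, v)" and f = "\<lambda>h. (- (h *\<^sub>R x), h *\<^sub>R x)"])
       (auto intro!: continuous_intros differentiable_imp_continuous_within DM_differentiable)
  then have "((\<lambda>h. h *\<^sub>R MC (h *\<^sub>R x) v) has_vector_derivative v) (at 0)"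
    using has_vector_derivative_scaleR_continuous[of "\<lambda>h. MC (h *\<^sub>R x) v"]
    by (simp add: MC_def[abs_def] DM_00)
  from bounded_linear.has_vector_derivative[OF Ad_linear[unfolded linear_conv_bounded_linear] this, of "- (s *\<^sub>R x)"]
  show "((\<lambda>h. (s + h) *\<^sub>R MC ((s + h) *\<^sub>R x) v) has_vector_derivative Ad (- (s *\<^sub>R x)) v) (at 0)"
    unfolding MC_cocycle by (auto intro!: derivative_eq_intros)
qed

context
  fixes A :: "real^'n \<Rightarrow> real^'n"
  assumes linA: "linear A" and lbA: "\<And>u v. A (lb u v) = lb (A u) (A v)"
begin

text \<open>Both sides, along the ray and multiplied by \<open>s\<close>, vanish at
  \<open>s = 0\<close> and have equal derivatives by \<open>lb_hom_Ad\<close>.\<close>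

lemma lb_hom_MC: "A (MC x v) = MC (A x) (A v)"
proof -
  define c where "c s = A (s *\<^sub>R MC (s *\<^sub>R x) v) - s *\<^sub>R MC (s *\<^sub>R A x) (A v)" for s
  have "(c has_vector_derivative 0) (at s)" for s
  proof -
    have "(c has_vector_derivative A (Ad (- (s *\<^sub>R x)) v) - Ad (- (s *\<^sub>R A x)) (A v)) (at s)"
      unfolding c_def[abs_def]
      by (intro has_vector_derivative_diff MC_line_has_vector_derivative
         bounded_linear.has_vector_derivative[OF bounded_linear_lb_hom[OF linA lbA] MC_line_has_vector_derivative])
    moreover have "A (- (s *\<^sub>R x)) = - (s *\<^sub>R A x)"
      by (simp only: linear_neg[OF linA] linear_cmul[OF linA])
    ultimately show ?thesis by (simp add: lb_hom_Ad[OF linA lbA])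
  qed
  then have "c 1 = c 0" by (rule constant_of_zero_vector_derivative)
  then show ?thesis by (simp add: c_def linear_0[OF linA])
qed

lemma lb_hom_LF: "A (LF v x) = LF (A v) (A x)"
proof -
  have "MC (A x) (A (LF v x)) = A v"
    by (simp only: lb_hom_MC[symmetric] MC_LF)
  then show ?thesis using LF_MC by metis
qed

text \<open>By \<open>lb_hom_LF\<close>, the curves \<open>A (x \<odot> t *\<^sub>R y)\<close> and
  \<open>A x \<odot> t *\<^sub>R A y\<close> are integral curves of the same left-invariant field,
  with the same start. Dividing the first by \<open>t *\<^sub>R A y\<close> on the right gives a
  constant curve.\<close>

lemma lb_hom_imp_hom: "A (x \<odot> y) = A x \<odot> A y"
proof -
  define a where "a t = A (x \<odot> t *\<^sub>R y)" for t
  define c where "c t = a t \<odot> - (t *\<^sub>R A y)" for t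
  have "(c has_vector_derivative 0) (at t)" for t
  proof (rule has_vector_derivative_shift)
    define z where "z = x \<odot> t *\<^sub>R y"
    have "x \<odot> (t + h) *\<^sub>R y = z \<odot> h *\<^sub>R y" for h
      by (simp only: z_def mul_assoc one_param)
    moreover have "- ((t + h) *\<^sub>R A y) = h *\<^sub>R - A y \<odot> - (t *\<^sub>R A y)" for h
      using minus_one_param[of h t "A y"] by (metis add.commute scaleR_minus_right)
    ultimately have c: "c (t + h) = (A (z \<odot> h *\<^sub>R y) \<odot> h *\<^sub>R - A y) \<odot> - (t *\<^sub>R A y)" for h
      by (simp only: c_def a_def mul_assoc)
    have 1: "((\<lambda>h. A (z \<odot> h *\<^sub>R y)) has_vector_derivative LF (A y) (A z)) (at 0)"
      using bounded_linear.has_vector_derivative[OF bounded_linear_lb_hom[OF linA lbA]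
         has_vector_derivative_line[OF mul_left_has_derivative_0]] by (simp add: lb_hom_LF)
    have 2: "((\<lambda>h. h *\<^sub>R - A y) has_vector_derivative - A y) (at 0)"
      by (rule has_vector_derivative_line) simp
    have "(\<lambda>v. DM (A z, 0) (v, 0)) = (\<lambda>v. v)" 
      by (rule has_derivative_unique[OF mul_right_has_derivative]) simp
    then have "DM (A z, 0) (LF (A y) (A z), 0) = LF (A y) (A z)" by metis
    moreover have "DM (A z, 0) (LF (A y) (A z), - A y) = DM (A z, 0) (LF (A y) (A z), 0) + DM (A z, 0) (0, - A y)"
      using linear_add[OF DM_linear, of "(A z, 0)" "(LF (A y) (A z), 0)" "(0, - A y)"] by simp
    ultimately have "DM (A z, 0) (LF (A y) (A z), - A y) = 0"
      by (simp add: linear_neg[OF LF_linear] flip: LF_eq)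
    with mul_curve_has_vector_derivative[OF 1 2]
    have "((\<lambda>h. A (z \<odot> h *\<^sub>R y) \<odot> h *\<^sub>R - A y) has_vector_derivative 0) (at 0)" by simp
    from has_vector_derivative_comp[OF this mul_right_has_derivative]
    show "((\<lambda>h. c (t + h)) has_vector_derivative 0) (at 0)"
      unfolding c using linear_0[OF DM_linear] by (simp add: zero_prod_def)
  qed
  then have "c 1 = c 0" by (rule constant_of_zero_vector_derivative)
  then have "A (x \<odot> y) \<odot> - A y = A x" by (simp add: c_def a_def)
  then show ?thesis by (metis mul_cancel(4))
qed

end

theorem dilation_mul: "dilation wt l (x \<odot> y) = dilation wt l x \<odot> dilation wt l y"
  by (rule lb_hom_imp_hom[OF linear_dilation dilation_lb])

end

section \<open>Lebesgue measure under translations, inversion and dilations\<close>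

lemma prod_Basis_vec: "(\<Prod>b\<in>(Basis :: (real^'n::finite) set). f b) = (\<Prod>i\<in>UNIV. f (axis i 1))"
proof -
  have "(Basis :: (real^'n) set) = range (\<lambda>i. axis i 1)" by (auto simp: Basis_vec_def)
  moreover have "inj (\<lambda>i. axis i (1::real) :: real^'n)" by (auto simp: inj_def axis_eq_axis)
  ultimately show ?thesis using prod.reindex[of "\<lambda>i. axis i (1::real) :: real^'n" UNIV f] by (simp add: o_def)
qed

lemma distr_lborel_uminus: "distr lborel borel uminus = (lborel :: 'a::euclidean_space measure)"
  using lborel_affine[of "-1" "0::'a"] by (simp add: density_1)

lemma emeasure_lborel_box_vec:
  fixes l u :: "real^'n::finite"
  assumes "\<And>i. l $ i \<le> u $ i"
  shows "emeasure lborel (box l u) = (\<Prod>i\<in>UNIV. u $ i - l $ i)"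
proof -
  have "emeasure lborel (box l u) = (\<Prod>b\<in>Basis. (u - l) \<bullet> b)"
    by (rule emeasure_lborel_box) (use assms in \<open>auto simp: Basis_vec_def inner_axis\<close>)
  then show ?thesis by (simp add: prod_Basis_vec inner_axis)
qed

lemma lborel_vec_eqI:
  fixes M :: "(real^'n::finite) measure"
  assumes "\<And>l u. (\<And>i. l $ i \<le> u $ i) \<Longrightarrow> emeasure M (box l u) = ennreal (\<Prod>i\<in>UNIV. u $ i - l $ i)"
    and "sets M = sets borel"
  shows "lborel = M"
proof (rule lborel_eqI)
  fix l u :: "real^'n" assume le: "\<And>b. b \<in> Basis \<Longrightarrow> l \<bullet> b \<le> u \<bullet> b"
  have "l $ i \<le> u $ i" for i using le[of "axis i 1"] by (simp add: inner_axis)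
  then show "emeasure M (box l u) = ennreal (\<Prod>b\<in>Basis. (u - l) \<bullet> b)"
    by (simp add: assms prod_Basis_vec inner_axis)
qed (rule assms)

lemma distr_lborel_reindex:
  fixes b :: "'m::finite \<Rightarrow> 'n::finite"
  assumes "bij b"
  shows "distr lborel borel (\<lambda>x::real^'n. \<chi> i. x $ b i) = (lborel :: (real^'m) measure)"
proof (rule lborel_vec_eqI[symmetric])
  have [measurable]: "(\<lambda>x::real^'n. \<chi> i. x $ b i) \<in> borel_measurable borel"
    by (intro borel_measurable_continuous_onI continuous_intros)
  fix l u :: "real^'m" assume le: "\<And>i. l $ i \<le> u $ i"
  define l' u' where "l' = (\<chi> j. l $ inv b j)" and "u' = (\<chi> j. u $ inv b j)"
  have "(\<lambda>x::real^'n. \<chi> i. x $ b i) -` box l u = box l' u'"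
  proof (intro set_eqI)
    fix x :: "real^'n"
    have "(\<forall>i. l $ i < x $ b i \<and> x $ b i < u $ i) \<longleftrightarrow> (\<forall>j. l $ inv b j < x $ j \<and> x $ j < u $ inv b j)"
      using assms by (metis bij_inv_eq_iff)
    then show "x \<in> (\<lambda>x::real^'n. \<chi> i. x $ b i) -` box l u \<longleftrightarrow> x \<in> box l' u'"
      by (simp add: mem_box_cart l'_def u'_def)
  qed
  then have "emeasure (distr lborel borel (\<lambda>x::real^'n. \<chi> i. x $ b i)) (box l u) = emeasure lborel (box l' u')"
    by (subst emeasure_distr) auto
  also have "\<dots> = (\<Prod>j\<in>UNIV. u' $ j - l' $ j)"
    by (rule emeasure_lborel_box_vec) (simp add: l'_def u'_def le)
  also have "(\<Prod>j\<in>UNIV. u' $ j - l' $ j) = (\<Prod>i\<in>UNIV. u $ i - l $ i)"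
    unfolding l'_def u'_def using assms
    by (intro prod.reindex_bij_witness[of _ b "inv b"]) (auto simp: bij_def surj_f_inv_f)
  finally show "emeasure (distr lborel borel (\<lambda>x::real^'n. \<chi> i. x $ b i)) (box l u) =
      ennreal (\<Prod>i\<in>UNIV. u $ i - l $ i)" .
qed simp

text \<open>It suffices to measure boxes. The preimage of a box under \<open>G\<close> is its image
  under \<open>F\<close>, and the change of variables formula gives that image the measure of the
  box.\<close>

lemma distr_lborel_unimodular_wellorder:
  fixes F G :: "real^'m::{finite,wellorder} \<Rightarrow> real^'m::_"
  assumes inv: "\<And>x. G (F x) = x" "\<And>x. F (G x) = x"
    and der: "\<And>x. (F has_derivative F' x) (at x)" and det: "\<And>x. \<bar>det (matrix (F' x))\<bar> = 1"
    and cont: "continuous_on UNIV G"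
  shows "distr lborel borel G = lborel"
proof (rule lborel_vec_eqI[symmetric])
  have [measurable]: "G \<in> borel_measurable borel" by (rule borel_measurable_continuous_onI[OF cont])
  fix l u :: "real^'m::_" assume le: "\<And>i. l $ i \<le> u $ i"
  have eq: "G -` box l u = F ` box l u" using inv by (auto simp: image_iff) metis
  have "G -` box l u \<in> sets borel"
    using measurable_sets[OF \<open>G \<in> borel_measurable borel\<close>, of "box l u"] by simp
  then have bor: "F ` box l u \<in> sets borel" by (simp add: eq)
  have "((\<lambda>x. 1::real) has_integral measure lborel (box l u)) (box l u)"
    using has_integral_measure_lborel[of "box l u"] by (simp add: emeasure_lborel_box_eq)
  then have "F ` box l u \<in> lmeasurable \<and> measure lebesgue (F ` box l u) = measure lborel (box l u)"
    by (subst has_measure_differentiable_image[where f' = F'])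
       (use der det inv in \<open>auto simp: inj_on_def intro: has_derivative_at_withinI dest: arg_cong[of _ _ G]\<close>)
  then have "emeasure lebesgue (F ` box l u) = ennreal (measure lborel (box l u))"
    by (metis emeasure_eq_measure2)
  moreover have "emeasure lborel (box l u) = ennreal (measure lborel (box l u))"
    by (rule emeasure_eq_ennreal_measure) (simp add: emeasure_lborel_box_eq)
  ultimately have "emeasure lborel (F ` box l u) = emeasure lborel (box l u)"
    using bor by simp
  then show "emeasure (distr lborel borel G) (box l u) = ennreal (\<Prod>i\<in>UNIV. u $ i - l $ i)"
    by (subst emeasure_distr) (simp_all add: eq emeasure_lborel_box_vec[OF le])
qed simp

text \<open>The change of variables theorems of the library need a well-ordered index type; the type
  below provides one of the right cardinality.\<close>

typedef ('n::finite) idx = "{..<CARD('n::finite)}"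
  by (auto intro!: exI[of _ 0])

instantiation idx :: (finite) wellorder
begin
definition less_eq_idx :: "'a idx \<Rightarrow> 'a idx \<Rightarrow> bool" where "less_eq_idx x y \<longleftrightarrow> Rep_idx x \<le> Rep_idx y"
definition less_idx :: "'a idx \<Rightarrow> 'a idx \<Rightarrow> bool" where "less_idx x y \<longleftrightarrow> Rep_idx x < Rep_idx y"
instance
proof
  fix P :: "'a idx \<Rightarrow> bool" and a
  assume step: "\<And>x. (\<And>y. y < x \<Longrightarrow> P y) \<Longrightarrow> P x"
  show "P a"
    by (induction a rule: measure_induct_rule[of Rep_idx]) (auto simp: less_idx_def intro: step)
qed (auto simp: less_eq_idx_def less_idx_def Rep_idx_inject)
end

lemma bij_betw_Rep_idx: "bij_betw (Rep_idx :: 'n::finite idx \<Rightarrow> nat) UNIV {..<CARD('n)}"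
  by (metis type_definition_idx bij_betw_def inj_onI type_definition.Rep_inject type_definition.Rep_range)

instance idx :: (finite) finite
  by standard (use bij_betw_finite[OF bij_betw_Rep_idx] in auto)

definition idx_index :: "'n::finite idx \<Rightarrow> 'n" where
  "idx_index = (SOME b. bij b)"

lemma bij_idx_index: "bij (idx_index :: 'n::finite idx \<Rightarrow> 'n)"
proof -
  have "card (UNIV :: 'n idx set) = card (UNIV :: 'n set)"
    using bij_betw_same_card[OF bij_betw_Rep_idx] by simp
  then have "\<exists>b :: 'n idx \<Rightarrow> 'n. bij b"
    by (intro finite_same_card_bij) auto
  then show ?thesis unfolding idx_index_def by (rule someI_ex)
qed

definition to_idx :: "real^'n::finite \<Rightarrow> real^'n idx" where
  "to_idx x = (\<chi> i. x $ idx_index i)"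

definition of_idx :: "real^'n::finite idx \<Rightarrow> real^'n" where
  "of_idx y = (\<chi> j. y $ inv idx_index j)"

lemma of_to_idx [simp]: "of_idx (to_idx (x :: real^'n::finite)) = x"
  and to_of_idx [simp]: "to_idx (of_idx (y :: real^'n idx)) = y"
  using bij_idx_index[where 'n='n]
  by (simp_all add: of_idx_def to_idx_def vec_eq_iff bij_is_surj surj_f_inv_f bij_is_inj inv_f_f)

lemma linear_to_idx: "linear to_idx" and linear_of_idx: "linear of_idx"
  by (rule linearI; simp add: to_idx_def of_idx_def vec_eq_iff)+

lemma continuous_on_to_idx: "continuous_on S to_idx" and continuous_on_of_idx: "continuous_on T of_idx"
  by (rule linear_continuous_on[OF linear_to_idx[unfolded linear_conv_bounded_linear]],
      rule linear_continuous_on[OF linear_of_idx[unfolded linear_conv_bounded_linear]])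

lemma distr_of_idx: "distr lborel borel of_idx = lborel"
  unfolding of_idx_def[abs_def] by (rule distr_lborel_reindex[OF bij_imp_bij_inv[OF bij_idx_index]])

text \<open>The volume factor of a linear map, computed after renumbering the coordinates by
  \<open>idx\<close>.\<close>

definition jac :: "(real^'n::finite \<Rightarrow> real^'n) \<Rightarrow> real" where
  "jac f = \<bar>det (matrix (\<lambda>y. to_idx (f (of_idx y))))\<bar>"

lemma jac_compose:
  assumes "linear f" "linear g"
  shows "jac (\<lambda>x. f (g x)) = jac f * jac g"
proof -
  have lin: "linear (\<lambda>y. to_idx (h (of_idx y)))" if "linear h" for h :: "real^'n \<Rightarrow> real^'n"
    using linear_compose[OF linear_compose[OF linear_of_idx that] linear_to_idx] by (simp add: o_def)
  have "matrix ((\<lambda>y. to_idx (f (of_idx y))) \<circ> (\<lambda>y. to_idx (g (of_idx y)))) =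
      matrix (\<lambda>y. to_idx (f (of_idx y))) ** matrix (\<lambda>y. to_idx (g (of_idx y)))"
    by (rule matrix_compose) (use lin assms in auto)
  then show ?thesis by (simp add: jac_def o_def det_mul abs_mult)
qed

lemma jac_ident [simp]: "jac (\<lambda>x. x) = 1"
  using matrix_id by (simp add: jac_def id_def)

lemma continuous_on_jac:
  assumes "\<And>v. continuous_on S (\<lambda>z. f z v)"
  shows "continuous_on S (\<lambda>z. jac (f z))"
proof -
  have "continuous_on S (\<lambda>z. to_idx (f z v))" for v
    by (rule continuous_on_compose2[OF continuous_on_to_idx[of UNIV] assms]) auto
  then show ?thesis
    unfolding jac_def det_def matrix_def
    by (auto intro!: continuous_intros)
qed

text \<open>The well-ordered case applied to the conjugate by \<open>to_idx\<close>, then pushed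
  back along the measure-preserving map \<open>of_idx\<close>.\<close>

lemma distr_lborel_unimodular:
  fixes F G :: "real^'n::finite \<Rightarrow> real^'n"
  assumes inv: "\<And>x. G (F x) = x" "\<And>x. F (G x) = x"
    and der: "\<And>x. (F has_derivative F' x) (at x)" and jac: "\<And>x. jac (F' x) = 1"
    and cont: "continuous_on UNIV G"
  shows "distr lborel borel G = lborel"
proof -
  have [measurable]: "G \<in> borel_measurable borel" "to_idx \<in> borel_measurable (borel :: (real^'n) measure)"
    "of_idx \<in> borel_measurable (borel :: (real^'n idx) measure)"
    by (auto intro!: borel_measurable_continuous_onI cont continuous_on_to_idx continuous_on_of_idx)
  have "distr lborel borel (\<lambda>y. to_idx (G (of_idx y))) = lborel"
  proof (rule distr_lborel_unimodular_wellorder)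
    show "((\<lambda>y. to_idx (F (of_idx y))) has_derivative (\<lambda>y. to_idx (F' (of_idx x) (of_idx y)))) (at x)" for x
    proof -
      have "(of_idx has_derivative of_idx) (at x)"
        by (simp add: linear_imp_has_derivative linear_of_idx)
      from diff_chain_at[OF diff_chain_at[OF this der] linear_imp_has_derivative[OF linear_to_idx]]
      show ?thesis by (simp add: o_def)
    qed
    show "\<bar>det (matrix (\<lambda>y. to_idx (F' (of_idx x) (of_idx y))))\<bar> = 1" for x
      using jac by (simp add: jac_def)
    show "continuous_on UNIV (\<lambda>y. to_idx (G (of_idx y)))"
      by (intro continuous_on_compose2[OF continuous_on_to_idx[of UNIV] continuous_on_compose2[OF cont continuous_on_of_idx]]) auto
  qed (auto simp: inv)
  then have "distr (distr lborel borel (\<lambda>y. to_idx (G (of_idx y)))) borel of_idx = lborel"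
    by (simp add: distr_of_idx)
  then have "distr lborel borel (\<lambda>y. G (of_idx y)) = lborel"
    by (subst (asm) distr_distr) (auto simp: o_def)
  then have "distr (distr lborel borel of_idx) borel G = lborel"
    by (subst distr_distr) (auto simp: o_def)
  then show ?thesis by (simp add: distr_of_idx)
qed

context carnot_group
begin

lemma continuous_on_dilation:
  "continuous_on UNIV (\<lambda>l. dilation wt l x)"
  unfolding dilation_def by (intro continuous_intros)

lemma dilation_0 [simp]: "dilation wt 0 x = 0"
proof -
  have "wt i \<noteq> 0" for i using wt_range[of i] by simp
  then show ?thesis by (simp only: dilation_def vec_eq_iff power_0_left) simp
qed

lemma dilation_1 [simp]: "dilation wt 1 x = x"
  by (simp add: dilation_def vec_eq_iff)

lemma dilation_dilation: "dilation wt a (dilation wt b x) = dilation wt (a * b) x"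
  by (simp add: dilation_def vec_eq_iff power_mult_distrib)

text \<open>Dilations conjugate left translations into left translations, so the Jacobian at \<open>(a, x)\<close>
  equals the one at \<open>(\<delta>\<^sub>l a, \<delta>\<^sub>l x)\<close>, which tends to \<open>1\<close> as \<open>l\<close> tends to \<open>0\<close>.\<close>

lemma jac_mul_left: "jac (\<lambda>v. DM (a, x) (0, v)) = 1"
proof -
  define J where "J l = jac (\<lambda>v. DM (dilation wt l a, dilation wt l x) (0, v))" for l
  have lin: "linear (\<lambda>v. DM z (0, v))" for z
    using mul_left_has_derivative[of "fst z" "snd z"] has_derivative_linear by force
  have "J l = J 1" if "l > 0" for l
  proof -
    let ?d = "dilation wt l"
    have "(?d \<circ> (\<lambda>y. a \<odot> y) has_derivative ?d \<circ> (\<lambda>v. DM (a, x) (0, v))) (at x)"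
      by (rule diff_chain_at[OF mul_left_has_derivative linear_imp_has_derivative[OF linear_dilation]])
    moreover have "((\<lambda>y. ?d a \<odot> y) \<circ> ?d has_derivative (\<lambda>v. DM (?d a, ?d x) (0, v)) \<circ> ?d) (at x)"
      by (rule diff_chain_at[OF linear_imp_has_derivative[OF linear_dilation] mul_left_has_derivative])
    moreover have "(\<lambda>y. ?d a \<odot> y) \<circ> ?d = ?d \<circ> (\<lambda>y. a \<odot> y)"
      by (simp add: o_def dilation_mul)
    ultimately have "?d \<circ> (\<lambda>v. DM (a, x) (0, v)) = (\<lambda>v. DM (?d a, ?d x) (0, v)) \<circ> ?d"
      using has_derivative_unique by metis
    then have "jac (\<lambda>v. ?d (DM (a, x) (0, v))) = jac (\<lambda>v. DM (?d a, ?d x) (0, ?d v))"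
      by (simp add: o_def)
    then have "jac ?d * J 1 = jac ?d * J l"
      using jac_compose[OF linear_dilation lin] jac_compose[OF lin linear_dilation]
      by (simp add: J_def mult.commute)
    moreover have "jac (dilation wt (1 / l)) * jac ?d = 1"
      using jac_compose[OF linear_dilation linear_dilation, of "1 / l" l] that
      by (simp add: dilation_dilation)
    then have "jac ?d \<noteq> 0" by auto
    ultimately show ?thesis by simp
  qed
  then have ev: "\<forall>\<^sub>F l in at_right 0. J l = J 1"
    using eventually_at_right_less[of "0::real"] by (rule eventually_mono[rotated]) simp
  have "continuous_on UNIV J"
    unfolding J_def
  proof (rule continuous_on_jac)
    fix v
    have "continuous_on UNIV (\<lambda>z. DM z (0, v))"
      by (intro continuous_at_imp_continuous_on ballI differentiable_imp_continuous_within DM_differentiable)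
    then show "continuous_on UNIV (\<lambda>l. DM (dilation wt l a, dilation wt l x) (0, v))"
      by (rule continuous_on_compose2) (auto intro!: continuous_intros continuous_on_dilation)
  qed
  then have "(J \<longlongrightarrow> J 0) (at_right 0)"
    unfolding continuous_on_def by (meson UNIV_I subset_UNIV tendsto_within_subset)
  then have "((\<lambda>_. J 1) \<longlongrightarrow> J 0) (at_right (0::real))"
    by (rule tendsto_cong[OF ev, THEN iffD1])
  then have "J 1 = J 0" by (simp add: tendsto_const_iff)
  also have "J 0 = 1" by (simp add: J_def DM_00)
  finally have "J 1 = 1" .
  then show ?thesis by (simp add: J_def)
qed

lemma measurable_mul [measurable (raw)]:
  assumes [measurable]: "f \<in> borel_measurable M" "g \<in> borel_measurable M"
  shows "(\<lambda>x. f x \<odot> g x) \<in> borel_measurable M"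
proof -
  have "continuous_on UNIV (\<lambda>z :: (real^'n) \<times> (real^'n). fst z \<odot> snd z)"
    by (intro continuous_intros)
  then have "(\<lambda>z. fst z \<odot> snd z) \<in> borel_measurable (borel :: ((real^'n) \<times> (real^'n)) measure)"
    by (rule borel_measurable_continuous_onI)
  moreover have "(\<lambda>x. (f x, g x)) \<in> M \<rightarrow>\<^sub>M borel" by measurable
  ultimately show ?thesis using measurable_compose[of "\<lambda>x. (f x, g x)" M borel "\<lambda>z. fst z \<odot> snd z" borel] by simp
qed

lemma distr_mul_left: "distr lborel borel (\<lambda>x. a \<odot> x) = lborel"
proof (rule distr_lborel_unimodular)
  show "((\<lambda>x. - a \<odot> x) has_derivative (\<lambda>v. DM (- a, x) (0, v))) (at x)" for x
    by (rule mul_left_has_derivative)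
qed (auto simp: jac_mul_left intro!: continuous_intros)

text \<open>Unimodularity: a right translation is a left translation between two inversions, and
  inversion is negation, which preserves Lebesgue measure.\<close>

lemma distr_mul_right: "distr lborel borel (\<lambda>x. x \<odot> a) = lborel"
proof -
  have "distr lborel borel (\<lambda>x. x \<odot> a) = distr lborel borel (\<lambda>x. - (- a \<odot> - x))"
    by (simp add: minus_mul)
  also have "\<dots> = distr (distr (distr lborel borel uminus) borel (\<lambda>x. - a \<odot> x)) borel uminus"
    by (simp add: distr_distr o_def)
  finally show ?thesis by (simp add: distr_lborel_uminus distr_mul_left)
qed

lemma nn_integral_mul_left:
  "f \<in> borel_measurable borel \<Longrightarrow> (\<integral>\<^sup>+x. f (a \<odot> x) \<partial>lborel) = (\<integral>\<^sup>+x. f x \<partial>lborel)"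
  by (subst distr_mul_left[of a, symmetric], subst nn_integral_distr) auto

lemma nn_integral_mul_right:
  "f \<in> borel_measurable borel \<Longrightarrow> (\<integral>\<^sup>+x. f (x \<odot> a) \<partial>lborel) = (\<integral>\<^sup>+x. f x \<partial>lborel)"
  by (subst distr_mul_right[of a, symmetric], subst nn_integral_distr) auto

lemma nn_integral_uminus:
  fixes f :: "real^'n \<Rightarrow> ennreal"
  shows "f \<in> borel_measurable borel \<Longrightarrow> (\<integral>\<^sup>+x. f (- x) \<partial>lborel) = (\<integral>\<^sup>+x. f x \<partial>lborel)"
  by (subst distr_lborel_uminus[symmetric], subst nn_integral_distr) auto

lemma hom_dim_eq: "hom_dim k wt = (\<Sum>i\<in>UNIV. wt i)"
proof -
  have "dim (layer wt j) = card {i. wt i = j}" for j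
  proof -
    let ?B = "(\<lambda>i. axis i 1 :: real^'n) ` {i. wt i = j}"
    have "?B \<subseteq> Basis" by (auto simp: Basis_vec_def)
    then have "independent ?B" using independent_Basis independent_mono by blast
    then have "dim (layer wt j) = card ?B" by (simp add: layer_def dim_eq_card_independent)
    also have "\<dots> = card {i. wt i = j}" by (rule card_image) (auto simp: inj_on_def axis_eq_axis)
    finally show ?thesis .
  qed
  then have "hom_dim k wt = (\<Sum>j=1..k. \<Sum>i\<in>{i. wt i = j}. wt i)"
    by (simp add: hom_dim_def mult.commute)
  also have "\<dots> = (\<Sum>i\<in>UNIV. wt i)"
    using sum.group[of UNIV "{1..k}" wt wt] wt_range by (simp add: image_subset_iff)
  finally show ?thesis .
qed

lemma hom_dim_pos: "hom_dim k wt \<ge> 1"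
proof -
  have "wt i \<le> hom_dim k wt" for i unfolding hom_dim_eq by (rule member_le_sum) auto
  then show ?thesis using wt_range by (meson atLeastAtMost_iff le_trans)
qed

text \<open>The dilation is diagonal with entries \<open>l ^ wt i\<close>; the weights add up to the
  homogeneous dimension by \<open>hom_dim_eq\<close>.\<close>

lemma lborel_dilation:
  assumes "l > 0"
  shows "lborel = density (distr lborel borel (dilation wt l)) (\<lambda>_. ennreal (l ^ hom_dim k wt))"
proof -
  define c where "c j = l ^ wt (axis_index j)" for j :: "real^'n"
  have "(\<Sum>j\<in>Basis. (c j * (x \<bullet> j)) *\<^sub>R j) = dilation wt l x" for x :: "real^'n"
  proof (rule vec_eq_iff[THEN iffD2, rule_format])
    fix i
    have "(\<Sum>j\<in>Basis. (c j * (x \<bullet> j)) *\<^sub>R j) \<bullet> axis i 1 = c (axis i 1) * (x \<bullet> axis i 1)"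
      by (simp add: inner_sum_left_Basis)
    then show "(\<Sum>j\<in>Basis. (c j * (x \<bullet> j)) *\<^sub>R j) $ i = dilation wt l x $ i"
      by (simp add: inner_axis c_def dilation_def axis_index_axis)
  qed
  moreover have "(\<Prod>j\<in>(Basis::(real^'n) set). \<bar>c j\<bar>) = l ^ hom_dim k wt"
    using assms by (simp add: prod_Basis_vec c_def axis_index_axis hom_dim_eq power_sum)
  ultimately show ?thesis
    using lborel_affine_euclidean[of c 0] assms by (auto simp: c_def)
qed

end

section \<open>Density of the semigroup generated by the first layer\<close>

context carnot_group
begin

lemma tendsto_mul [tendsto_intros]:
  assumes "(f \<longlongrightarrow> a) F" "(g \<longlongrightarrow> b) F"
  shows "((\<lambda>x. f x \<odot> g x) \<longlongrightarrow> a \<odot> b) F"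
proof -
  have "isCont MUL (a, b)"
    using MUL_differentiable differentiable_imp_continuous_within by blast
  from isCont_tendsto_compose[OF this tendsto_Pair[OF assms]] show ?thesis
    by (simp add: MUL_def)
qed

lemma mul_quotient_left [simp]: "- (g \<odot> a) \<odot> (g \<odot> b) = - a \<odot> b"
  by (simp add: minus_mul mul_assoc)

text \<open>The directions \<open>v\<close> whose whole line lies in the closure form a Lie subalgebra: sums by
  Trotter's formula, brackets by differentiating the adjoint action.\<close>

lemma closure_semigroup_eq_UNIV:
  assumes mul: "\<And>x y. x \<in> S \<Longrightarrow> y \<in> S \<Longrightarrow> x \<odot> y \<in> S" and hor: "layer wt 1 \<subseteq> S"
  shows "closure S = UNIV"
proof -
  let ?K = "closure S"
  have K_mul: "x \<odot> y \<in> ?K" if xy: "x \<in> ?K" "y \<in> ?K" for x y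
  proof -
    obtain a b where "\<And>n. a n \<in> S" "a \<longlonglongrightarrow> x" "\<And>n. b n \<in> S" "b \<longlonglongrightarrow> y"
      using xy unfolding closure_sequential by auto
    then have "\<forall>n. a n \<odot> b n \<in> S" "(\<lambda>n. a n \<odot> b n) \<longlonglongrightarrow> x \<odot> y"
      using mul tendsto_mul by auto
    then show ?thesis unfolding closure_sequential by (intro exI[of _ "\<lambda>n. a n \<odot> b n"]) simp
  qed
  have K_pow: "real (Suc n) *\<^sub>R x \<in> ?K" if x: "x \<in> ?K" for n x
  proof (induction n)
    case (Suc n)
    then show ?case using K_mul x by (subst mul_scaleR_Suc)
  qed (use x in simp)
  define h where "h = {v. \<forall>t. t *\<^sub>R v \<in> ?K}"
  have add: "u + v \<in> h" if uv: "u \<in> h" "v \<in> h" for u v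
    unfolding h_def
  proof (intro CollectI allI)
    fix t :: real
    have "((\<lambda>s. s *\<^sub>R t *\<^sub>R u \<odot> s *\<^sub>R t *\<^sub>R v) has_vector_derivative DM (0 *\<^sub>R t *\<^sub>R u, 0 *\<^sub>R t *\<^sub>R v) (t *\<^sub>R u, t *\<^sub>R v)) (at 0)"
      by (intro mul_curve_has_vector_derivative) (auto intro!: derivative_eq_intros)
    from has_vector_derivative_sequentially[OF this]
    have lim: "(\<lambda>n. real (Suc n) *\<^sub>R ((1 / real (Suc n)) *\<^sub>R t *\<^sub>R u \<odot> (1 / real (Suc n)) *\<^sub>R t *\<^sub>R v)) \<longlonglongrightarrow> t *\<^sub>R u + t *\<^sub>R v"
      by (simp add: DM_00)
    have "real (Suc n) *\<^sub>R ((1 / real (Suc n)) *\<^sub>R t *\<^sub>R u \<odot> (1 / real (Suc n)) *\<^sub>R t *\<^sub>R v) \<in> ?K" for n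
    proof (intro K_pow K_mul)
      show "(1 / real (Suc n)) *\<^sub>R t *\<^sub>R u \<in> ?K" "(1 / real (Suc n)) *\<^sub>R t *\<^sub>R v \<in> ?K"
        using uv unfolding h_def scaleR_scaleR by blast+
    qed
    from closed_sequentially[OF closed_closure this lim] have "t *\<^sub>R u + t *\<^sub>R v \<in> ?K" .
    then show "t *\<^sub>R (u + v) \<in> ?K" by (simp add: scaleR_add_right)
  qed
  have "0 \<in> ?K"
    using hor subspace_0[OF subspace_layer] closure_subset by blast
  then have h: "subspace h"
    using add by (auto simp: subspace_def h_def)
  have Ad_h: "Ad (s *\<^sub>R u) v \<in> h" if uv: "u \<in> h" "v \<in> h" for u v s
    unfolding h_def
  proof (intro CollectI allI)
    fix t :: real
    have "t *\<^sub>R Ad (s *\<^sub>R u) v = Ad (s *\<^sub>R u) (t *\<^sub>R v)"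
      by (simp only: linear_cmul[OF Ad_linear])
    then have "t *\<^sub>R Ad (s *\<^sub>R u) v = (s *\<^sub>R u \<odot> t *\<^sub>R v) \<odot> (- s) *\<^sub>R u"
      by (simp add: Ad_def)
    then show "t *\<^sub>R Ad (s *\<^sub>R u) v \<in> ?K"
      using uv unfolding h_def by (auto intro!: K_mul simp del: scaleR_minus_left)
  qed
  have lb_h: "lb u v \<in> h" if uv: "u \<in> h" "v \<in> h" for u v
  proof -
    \<comment> \<open>Every difference quotient lies in \<open>h\<close>. A subspace of a
      finite-dimensional space is closed, so the limit \<open>lb u v\<close> lies there too.\<close>
    have "real (Suc n) *\<^sub>R (Ad ((1 / real (Suc n)) *\<^sub>R u) v - Ad (0 *\<^sub>R u) v) \<in> h" for n
      using uv by (intro subspace_scale[OF h] subspace_diff[OF h] Ad_h)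
    from closed_sequentially[OF closed_subspace[OF h] this
        has_vector_derivative_sequentially[OF Ad_has_vector_derivative]] show ?thesis .
  qed
  have hor_h: "layer wt 1 \<subseteq> h"
  proof
    fix v assume "v \<in> layer wt 1"
    then have "t *\<^sub>R v \<in> S" for t
      using hor subspace_scale[OF subspace_layer] by blast
    then show "v \<in> h" using closure_subset by (auto simp: h_def)
  qed
  have layers: "layer wt j \<subseteq> h" if "1 \<le> j" for j
    using that
  proof (induction j rule: nat_induct_at_least)
    case base
    show ?case by (rule hor_h)
  next
    case (Suc j)
    show ?case
    proof (cases "j < k")
      case True
      show ?thesis
        unfolding bracket_step[OF Suc.hyps True]
        by (intro span_minimal h) (use Suc.IH hor_h lb_h in blast)
    next
      case False
      then show ?thesis using layer_above[of "Suc j"] subspace_0[OF h] by auto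
    qed
  qed
  have "axis i 1 \<in> h" for i
    using layers[of "wt i"] axis_in_layer[of i] wt_range[of i] by auto
  then have "Basis \<subseteq> h" by (auto simp: Basis_vec_def)
  then have "span Basis \<subseteq> h" by (intro span_minimal h)
  then have "x \<in> h" for x by auto
  then have "1 *\<^sub>R x \<in> ?K" for x unfolding h_def by blast
  then show ?thesis by auto
qed

end

section \<open>Homogeneous norms and chains\<close>

locale carnot_norm = carnot_group +
  fixes nrm :: "real^'a \<Rightarrow> real"
  assumes hom_nrm: "homogeneous_norm iv wt nrm"
begin

lemma nrm_continuous: "continuous_on S nrm"
  using hom_nrm unfolding homogeneous_norm_def by (blast intro: continuous_on_subset)

lemma nrm_nonneg [simp]: "nrm x \<ge> 0"
  using hom_nrm by (simp add: homogeneous_norm_def)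

lemma nrm_eq_0 [simp]: "nrm x = 0 \<longleftrightarrow> x = 0"
  using hom_nrm by (simp add: homogeneous_norm_def)

lemma nrm_zero [simp]: "nrm 0 = 0" by simp

lemma nrm_minus [simp]: "nrm (- x) = nrm x"
  using hom_nrm by (simp add: homogeneous_norm_def iv_eq)

lemma nrm_dilation: "l \<ge> 0 \<Longrightarrow> nrm (dilation wt l x) = l * nrm x"
  using hom_nrm by (cases "l = 0") (auto simp: homogeneous_norm_def)

lemma nrm_scaleR_layer_1: "v \<in> layer wt 1 \<Longrightarrow> s \<ge> 0 \<Longrightarrow> nrm (s *\<^sub>R v) = s * nrm v"
  using nrm_dilation[of s v] dilation_layer[of v 1 s] by simp

lemma nrm_quotient_commute: "nrm (- y \<odot> x) = nrm (- x \<odot> y)"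
  using nrm_minus[of "- y \<odot> x"] by (simp add: minus_mul)

lemma nrm_measurable [measurable]: "nrm \<in> borel_measurable borel"
  by (rule borel_measurable_continuous_onI[OF nrm_continuous])

text \<open>The norm attains a positive minimum on the Euclidean unit sphere. A point outside the
  unit ball is shrunk onto the sphere by a dilation with factor at most 1, found by the intermediate
  value theorem, and this cannot increase the norm.\<close>

lemma nrm_lower_bound: "\<exists>c>0. \<forall>x. norm x \<ge> 1 \<longrightarrow> nrm x \<ge> c"
proof -
  have "(axis undefined 1 :: real^'a) \<in> sphere 0 1" by (simp add: norm_axis_1)
  then have "sphere (0 :: real^'a) 1 \<noteq> {}" by blast
  then obtain x0 where x0: "x0 \<in> sphere 0 1" "\<And>y. y \<in> sphere 0 1 \<Longrightarrow> nrm x0 \<le> nrm y"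
    using continuous_attains_inf[OF compact_sphere _ nrm_continuous] by metis
  then have "x0 \<noteq> 0" by auto
  then have "nrm x0 > 0" using nrm_nonneg[of x0] nrm_eq_0[of x0] by linarith
  moreover have "nrm x \<ge> nrm x0" if x: "norm x \<ge> 1" for x
  proof -
    have "\<exists>l\<ge>0. l \<le> 1 \<and> norm (dilation wt l x) = 1"
      using x by (intro IVT') (auto intro!: continuous_intros continuous_on_subset[OF continuous_on_dilation])
    then obtain l where l: "l \<ge> 0" "l \<le> 1" "norm (dilation wt l x) = 1" by blast
    have "nrm x0 \<le> nrm (dilation wt l x)" using l by (intro x0) auto
    also have "\<dots> \<le> nrm x" using l by (simp add: nrm_dilation mult_left_le_one_le)
    finally show ?thesis .
  qed
  ultimately show ?thesis by blast
qed

lemma bounded_nrm_le: "bounded {x. nrm x \<le> r}"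
proof -
  obtain c where c: "c > 0" "\<And>x. norm x \<ge> 1 \<Longrightarrow> nrm x \<ge> c" using nrm_lower_bound by blast
  \<comment> \<open>The maximum with 1 keeps the dilation factor well defined when \<open>r\<close>
    is zero or negative.\<close>
  define s where "s = max r 1"
  define l where "l = c / (2 * s)"
  have s: "s > 0" "r \<le> s" by (auto simp: s_def)
  have l: "l > 0" using c s by (simp add: l_def)
  have "{x. nrm x \<le> r} \<subseteq> dilation wt (1 / l) ` ball 0 1"
  proof
    fix x assume "x \<in> {x. nrm x \<le> r}"
    then have "l * nrm x \<le> l * s" using s l by (intro mult_left_mono) auto
    also have "\<dots> < c" using c s by (simp add: l_def)
    finally have "nrm (dilation wt l x) < c" using l by (simp add: nrm_dilation)
    then have "norm (dilation wt l x) < 1" using c(2) by (meson not_le)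
    moreover have "x = dilation wt (1 / l) (dilation wt l x)" using l by (simp add: dilation_dilation)
    ultimately show "x \<in> dilation wt (1 / l) ` ball 0 1" by (metis image_eqI mem_ball_0)
  qed
  moreover have "bounded (dilation wt (1 / l) ` ball 0 1)"
    using linear_dilation by (intro bounded_linear_image) (auto simp: linear_conv_bounded_linear)
  ultimately show ?thesis by (rule bounded_subset[rotated])
qed

lemma compact_nrm_le: "compact {x. nrm x \<le> r}"
proof -
  have "closed {x. nrm x \<le> r}"
    by (intro closed_Collect_le nrm_continuous continuous_on_const)
  then show ?thesis by (simp add: compact_eq_bounded_closed bounded_nrm_le)
qed

text \<open>Compactness of the closed unit ball bounds the norm of products there. Dilations are
  automorphisms, so rescaling by the larger norm gives the general case.\<close>

lemma quasi_triangle_ex: "\<exists>K\<ge>1. \<forall>x y. nrm (x \<odot> y) \<le> K * max (nrm x) (nrm y)"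
proof -
  let ?C = "{x. nrm x \<le> 1}"
  have "continuous_on (?C \<times> ?C) (\<lambda>z. nrm (fst z \<odot> snd z))"
    by (intro continuous_on_compose2[OF nrm_continuous[of UNIV]] continuous_intros) auto
  then have "compact ((\<lambda>z. nrm (fst z \<odot> snd z)) ` (?C \<times> ?C))"
    by (intro compact_continuous_image compact_Times compact_nrm_le)
  then have "bdd_above ((\<lambda>z. nrm (fst z \<odot> snd z)) ` (?C \<times> ?C))"
    by (intro bounded_imp_bdd_above compact_imp_bounded)
  then obtain M where M: "\<And>z. z \<in> ?C \<times> ?C \<Longrightarrow> nrm (fst z \<odot> snd z) \<le> M"
    unfolding bdd_above_def by blast
  have "nrm (x \<odot> y) \<le> max 1 M * max (nrm x) (nrm y)" for x y
  proof (cases "max (nrm x) (nrm y) = 0")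
    case True
    then have "nrm x = 0" "nrm y = 0" using nrm_nonneg[of x] nrm_nonneg[of y] by linarith+
    then show ?thesis by simp
  next
    case False
    define m where "m = max (nrm x) (nrm y)"
    have m: "m > 0" using False nrm_nonneg[of x] unfolding m_def by linarith
    have "nrm (dilation wt (1 / m) x) \<le> 1" "nrm (dilation wt (1 / m) y) \<le> 1"
      using m by (auto simp: nrm_dilation m_def)
    then have "nrm (dilation wt (1 / m) x \<odot> dilation wt (1 / m) y) \<le> M"
      using M[of "(dilation wt (1 / m) x, dilation wt (1 / m) y)"] by simp
    then have "1 / m * nrm (x \<odot> y) \<le> M"
      using m by (simp only: dilation_mul[symmetric] nrm_dilation divide_nonneg_pos zero_le_one)
    then have "nrm (x \<odot> y) \<le> M * m" using m by (simp add: field_simps)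
    also have "\<dots> \<le> max 1 M * m" using m by (intro mult_right_mono) auto
    finally show ?thesis by (simp add: m_def)
  qed
  then show ?thesis by (intro exI[of _ "max 1 M"]) auto
qed

definition K where "K = (SOME K. K \<ge> 1 \<and> (\<forall>x y. nrm (x \<odot> y) \<le> K * max (nrm x) (nrm y)))"

lemma K_ge_1: "K \<ge> 1" and nrm_mul_le: "nrm (x \<odot> y) \<le> K * max (nrm x) (nrm y)"
  unfolding K_def using someI_ex[OF quasi_triangle_ex] by blast+

lemma nrm_mul_bound: "nrm x \<le> a \<Longrightarrow> nrm y \<le> a \<Longrightarrow> nrm (x \<odot> y) \<le> K * a"
  by (rule order_trans[OF nrm_mul_le]) (use K_ge_1 in \<open>auto intro!: mult_left_mono\<close>)

text \<open>The points \<open>z i\<close> are partial products. The bound \<open>D\<close> on all of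
  them later confines the translates of a ball of radius R to a ball of comparable radius.\<close>

definition chain :: "real \<Rightarrow> real \<Rightarrow> nat \<Rightarrow> real^'a \<Rightarrow> bool" where
  "chain r D n h \<longleftrightarrow> (\<exists>z. z 0 = 0 \<and> z n = h \<and>
     (\<forall>i<n. nrm (- z i \<odot> z (Suc i)) \<le> r) \<and> (\<forall>i\<le>n. nrm (z i) \<le> D))"

lemma chain_mono: "chain r D n h \<Longrightarrow> r \<le> r' \<Longrightarrow> D \<le> D' \<Longrightarrow> chain r' D' n h"
  unfolding chain_def by (elim exE, rule exI) (auto intro: order_trans)

lemma chain_nonneg: "chain r D n h \<Longrightarrow> D \<ge> 0"
  unfolding chain_def using nrm_nonneg by (metis le0 order_trans)

lemma chain_dilation:
  assumes "chain r D n h" "l \<ge> 0"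
  shows "chain (l * r) (l * D) n (dilation wt l h)"
proof -
  obtain z where z: "z 0 = 0" "z n = h" "\<And>i. i < n \<Longrightarrow> nrm (- z i \<odot> z (Suc i)) \<le> r"
      "\<And>i. i \<le> n \<Longrightarrow> nrm (z i) \<le> D"
    using assms(1) unfolding chain_def by blast
  have "- dilation wt l (z i) \<odot> dilation wt l (z (Suc i)) = dilation wt l (- z i \<odot> z (Suc i))" for i
    by (simp only: dilation_mul linear_neg[OF linear_dilation])
  then show ?thesis
    unfolding chain_def using z assms(2)
    by (intro exI[of _ "\<lambda>i. dilation wt l (z i)"])
       (auto simp: nrm_dilation linear_0[OF linear_dilation] intro!: mult_left_mono)
qed

text \<open>The second chain is translated by \<open>g\<close> on the left and appended; quotients
  of neighbours are left-invariant. The position bound loses the factor \<open>K\<close> of the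
  quasi-triangle inequality.\<close>

lemma chain_mul:
  assumes "chain r D n g" "chain r D' m e"
  shows "chain r (K * max D D') (n + m) (g \<odot> e)"
proof -
  obtain z where z: "z 0 = 0" "z n = g" "\<And>i. i < n \<Longrightarrow> nrm (- z i \<odot> z (Suc i)) \<le> r"
      "\<And>i. i \<le> n \<Longrightarrow> nrm (z i) \<le> D"
    using assms(1) unfolding chain_def by blast
  obtain y where y: "y 0 = 0" "y m = e" "\<And>i. i < m \<Longrightarrow> nrm (- y i \<odot> y (Suc i)) \<le> r"
      "\<And>i. i \<le> m \<Longrightarrow> nrm (y i) \<le> D'"
    using assms(2) unfolding chain_def by blast
  define w where "w i = (if i \<le> n then z i else g \<odot> y (i - n))" for i
  have w1: "w i = z i" if "i \<le> n" for i using that by (simp add: w_def)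
  have w2: "w i = g \<odot> y (i - n)" if "i \<ge> n" for i
    using that z y by (auto simp: w_def)
  have D: "D \<ge> 0" using chain_nonneg[OF assms(1)] .
  have "nrm (- w i \<odot> w (Suc i)) \<le> r" if "i < n + m" for i
  proof (cases "i < n")
    case True
    then show ?thesis using z by (simp add: w1)
  next
    case False
    then have "Suc i - n = Suc (i - n)" by simp
    then show ?thesis using False that y(3)[of "i - n"] by (simp add: w2 del: diff_Suc_Suc)
  qed
  moreover have "nrm (w i) \<le> K * max D D'" if "i \<le> n + m" for i
  proof (cases "i \<le> n")
    case True
    then have "nrm (w i) \<le> max D D'" using z(4)[of i] by (simp add: w1)
    also have "\<dots> \<le> K * max D D'" using K_ge_1 D mult_right_mono[of 1 K "max D D'"] by simp
    finally show ?thesis .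
  next
    case False
    then have "i - n \<le> m" using that by simp
    then have "nrm (g \<odot> y (i - n)) \<le> K * max D D'"
      using z(2) z(4)[of n] y(4)[of "i - n"] by (intro nrm_mul_bound) auto
    then show ?thesis using False by (simp add: w2)
  qed
  ultimately show ?thesis
    unfolding chain_def using z(1) w2[of "n + m"] y(2) by (intro exI[of _ w]) (auto simp: w1)
qed

text \<open>In the first layer the norm is homogeneous of degree one under scalar multiplication, so
  cutting the segment to \<open>v\<close> into \<open>n\<close> equal parts makes steps of norm
  \<open>nrm v / n\<close>.\<close>

lemma chain_layer_1:
  assumes v: "v \<in> layer wt 1" and r: "r > 0"
  shows "chain r (nrm v) (nat \<lceil>nrm v / r\<rceil>) v"
proof -
  define n where "n = nat \<lceil>nrm v / r\<rceil>"
  define z where "z i = (real i / real n) *\<^sub>R v" for i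
  have le: "nrm v / r \<le> real n" unfolding n_def by linarith
  have "z n = v"
  proof (cases "n = 0")
    case True
    then have "nrm v / r \<le> 0" using le by simp
    then have "nrm v \<le> 0" using r by (simp add: divide_le_0_iff)
    then have "v = 0" using nrm_nonneg[of v] nrm_eq_0 by (metis order_antisym)
    then show ?thesis by (simp add: z_def)
  qed (simp add: z_def)
  moreover have "nrm (- z i \<odot> z (Suc i)) \<le> r" if "i < n" for i
  proof -
    have "- z i \<odot> z (Suc i) = (1 / real n) *\<^sub>R v"
      using one_param[of "- (real i / real n)" v "real (Suc i) / real n"]
      by (simp add: z_def flip: diff_divide_distrib)
    then show ?thesis using v that le r by (simp add: nrm_scaleR_layer_1 field_simps)
  qed
  moreover have "nrm (z i) \<le> nrm v" if "i \<le> n" for i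
  proof -
    have "real i / real n * nrm v \<le> nrm v"
      using that by (intro mult_left_le_one_le) (auto simp: divide_le_eq_1)
    then show ?thesis by (simp only: z_def nrm_scaleR_layer_1[OF v] divide_nonneg_nonneg of_nat_0_le_iff)
  qed
  ultimately show ?thesis
    unfolding chain_def n_def[symmetric] by (intro exI[of _ z]) (auto simp: z_def)
qed

text \<open>One constant serves all step sizes up to 1. The restriction \<open>r \<le> 1\<close>
  lets the \<open>+ 1\<close> of rounding up be absorbed into a bound proportional to
  \<open>1 / r\<close>.\<close>

definition reach :: "real \<Rightarrow> real^'a \<Rightarrow> bool" where
  "reach A g \<longleftrightarrow> (\<forall>r. 0 < r \<and> r \<le> 1 \<longrightarrow> (\<exists>n. real n \<le> A / r \<and> chain r A n g))"

lemma reach_nonneg: "reach A g \<Longrightarrow> A \<ge> 0"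
  unfolding reach_def using chain_nonneg by (meson order_refl zero_less_one)

lemma reach_mono: "reach A g \<Longrightarrow> A \<le> A' \<Longrightarrow> reach A' g"
  unfolding reach_def
  by (meson chain_mono divide_right_mono less_imp_le order_refl order_trans)

lemma reach_mul:
  assumes "reach A g" "reach A' e"
  shows "reach (K * (A + A')) (g \<odot> e)"
  unfolding reach_def
proof (intro allI impI)
  fix r :: real assume r: "0 < r \<and> r \<le> 1"
  obtain n where n: "real n \<le> A / r" "chain r A n g" using assms(1) r unfolding reach_def by blast
  obtain m where m: "real m \<le> A' / r" "chain r A' m e" using assms(2) r unfolding reach_def by blast
  have nonneg: "A \<ge> 0" "A' \<ge> 0" using assms reach_nonneg by auto
  have "chain r (K * (A + A')) (n + m) (g \<odot> e)"
    by (rule chain_mono[OF chain_mul[OF n(2) m(2)]]) (use nonneg K_ge_1 in \<open>auto intro!: mult_left_mono\<close>)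
  moreover have "1 * (A + A') \<le> K * (A + A')" using nonneg K_ge_1 by (intro mult_right_mono) auto
  then have "(A + A') / r \<le> K * (A + A') / r" using r by (intro divide_right_mono) auto
  then have "real (n + m) \<le> K * (A + A') / r" using n(1) m(1) by (simp add: add_divide_distrib)
  ultimately show "\<exists>n. real n \<le> K * (A + A') / r \<and> chain r (K * (A + A')) n (g \<odot> e)" by blast
qed

lemma reach_layer_1:
  assumes "v \<in> layer wt 1"
  shows "reach (nrm v + 1) v"
  unfolding reach_def
proof (intro allI impI)
  fix r :: real assume r: "0 < r \<and> r \<le> 1"
  have "real (nat \<lceil>nrm v / r\<rceil>) \<le> nrm v / r + 1"
    using r nrm_nonneg[of v] by (simp add: of_nat_nat)
  also have "\<dots> \<le> (nrm v + 1) / r" using r by (simp add: add_divide_distrib)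
  finally show "\<exists>n. real n \<le> (nrm v + 1) / r \<and> chain r (nrm v + 1) n v"
    using chain_mono[OF chain_layer_1[OF assms], of r r "nrm v + 1"] r by (intro exI[of _ "nat \<lceil>nrm v / r\<rceil>"]) simp
qed

lemma closure_reach: "closure {g. \<exists>A. reach A g} = UNIV"
proof (rule closure_semigroup_eq_UNIV)
  show "x \<odot> y \<in> {g. \<exists>A. reach A g}" if "x \<in> {g. \<exists>A. reach A g}" "y \<in> {g. \<exists>A. reach A g}" for x y
    using that reach_mul by blast
  show "layer wt 1 \<subseteq> {g. \<exists>A. reach A g}" using reach_layer_1 by blast
qed

text \<open>The neighbourhoods of the points that can be reached cover the compact unit ball by
  density. A finite subcover suffices, and the sum of its finitely many constants dominates each of
  them.\<close>

lemma reach_uniform: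
  assumes eps: "\<epsilon> > 0"
  shows "\<exists>A\<ge>0. \<forall>h. nrm h \<le> 1 \<longrightarrow> (\<exists>g. reach A g \<and> nrm (- g \<odot> h) \<le> \<epsilon>)"
proof -
  let ?S = "{g. \<exists>A. reach A g}" and ?C = "{h. nrm h \<le> 1}"
  have 1: "open {h. nrm (- g \<odot> h) < \<epsilon>}" for g
    by (intro open_Collect_less continuous_on_compose2[OF nrm_continuous[of UNIV]] continuous_intros) auto
  have 2: "?C \<subseteq> (\<Union>g\<in>?S. {h. nrm (- g \<odot> h) < \<epsilon>})"
  proof
    fix h :: "real^'a"
    have "open {g. nrm (- g \<odot> h) < \<epsilon>}"
      by (intro open_Collect_less continuous_on_compose2[OF nrm_continuous[of UNIV]] continuous_intros) auto
    moreover have "h \<in> {g. nrm (- g \<odot> h) < \<epsilon>} \<inter> closure ?S"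
      using eps closure_reach by simp
    ultimately have "{g. nrm (- g \<odot> h) < \<epsilon>} \<inter> ?S \<noteq> {}"
      using open_Int_closure_eq_empty by blast
    then show "h \<in> (\<Union>g\<in>?S. {h. nrm (- g \<odot> h) < \<epsilon>})" by blast
  qed
  obtain F where F: "F \<subseteq> ?S" "finite F" "?C \<subseteq> (\<Union>g\<in>F. {h. nrm (- g \<odot> h) < \<epsilon>})"
    by (rule compactE_image[OF compact_nrm_le 1 2])
  have "\<forall>g\<in>F. \<exists>A. reach A g" using F(1) by blast
  then obtain a where a: "\<And>g. g \<in> F \<Longrightarrow> reach (a g) g" by metis
  have "reach (sum a F) g" if "g \<in> F" for g
    using a that F(2) by (intro reach_mono[OF a[OF that]] member_le_sum) (auto dest: reach_nonneg)
  moreover have "sum a F \<ge> 0" by (intro sum_nonneg reach_nonneg[OF a])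
  moreover have "\<exists>g\<in>F. nrm (- g \<odot> h) \<le> \<epsilon>" if "nrm h \<le> 1" for h
    using subsetD[OF F(3), of h] that by (auto intro: less_imp_le)
  ultimately show ?thesis by blast
qed

text \<open>Dilate \<open>h\<close> to norm one, approximate there with step size
  \<open>r / nrm h\<close>, which is at most 1, and dilate back.\<close>

lemma reach_uniform_scaled:
  assumes A: "\<And>h. nrm h \<le> 1 \<Longrightarrow> \<exists>g. reach A g \<and> nrm (- g \<odot> h) \<le> \<epsilon>"
    and r: "0 < r" "r \<le> nrm h"
  shows "\<exists>g n. real n \<le> A * nrm h / r \<and> chain r (A * nrm h) n g \<and> nrm (- g \<odot> h) \<le> \<epsilon> * nrm h"
proof -
  define t where "t = nrm h"
  have t: "t > 0" using r by (simp add: t_def)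
  have "nrm (dilation wt (1 / t) h) \<le> 1" using t by (simp add: nrm_dilation t_def)
  from A[OF this] obtain g where g: "reach A g" "nrm (- g \<odot> dilation wt (1 / t) h) \<le> \<epsilon>" by blast
  obtain n where n: "real n \<le> A / (r / t)" "chain (r / t) A n g"
    using g(1) r t unfolding reach_def t_def[symmetric] by (metis divide_le_eq_1_pos divide_pos_pos)
  have "chain r (A * t) n (dilation wt t g)"
    using chain_dilation[OF n(2), of t] t by (simp add: mult.commute)
  moreover have "nrm (- dilation wt t g \<odot> h) \<le> \<epsilon> * t"
  proof -
    have "- dilation wt t g \<odot> h = dilation wt t (- g \<odot> dilation wt (1 / t) h)"
      using t by (simp add: dilation_mul dilation_dilation linear_neg[OF linear_dilation])
    then show ?thesis using g(2) t by (simp add: nrm_dilation mult.commute)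
  qed
  ultimately show ?thesis using n(1) unfolding t_def[symmetric] by auto
qed

text \<open>Self-similarity: a first approximation of \<open>h\<close> leaves an error of norm at most \<open>nrm h / (2 * K)\<close>,
  and the lengths of the successive corrections form a geometric series.\<close>

theorem chain_ex:
  "\<exists>C\<ge>0. \<exists>D\<ge>0. \<forall>r>0. \<forall>h. \<exists>n. real n \<le> C * nrm h / r + 1 \<and> chain r (D * nrm h) n h"
proof -
  define \<epsilon> where "\<epsilon> = 1 / (2 * K)"
  have eps: "\<epsilon> > 0" "\<epsilon> \<le> 1 / 2" using K_ge_1 by (auto simp: \<epsilon>_def field_simps)
  obtain A where A: "A \<ge> 0" "\<And>h. nrm h \<le> 1 \<Longrightarrow> \<exists>g. reach A g \<and> nrm (- g \<odot> h) \<le> \<epsilon>"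
    using reach_uniform[OF eps(1)] by blast
  \<comment> \<open>\<open>C\<close> solves A + C / 2 = C: the first approximation costs
    \<open>A\<close>, the remainder has at most half the norm.\<close>
  define C where "C = 2 * A"
  \<comment> \<open>The 1 serves the chain with a single step, and \<open>K * A\<close> the first
    approximation. The remainder keeps within the same bound because \<open>\<epsilon>\<close>
    cancels the factor \<open>K\<close>.\<close>
  define D where "D = max 1 (K * A)"
  have D: "D \<ge> 1" "K * A \<le> D" by (auto simp: D_def)
  \<comment> \<open>The induction on \<open>j\<close> counts the halvings until
    \<open>nrm h \<le> r\<close>. From there one direct step suffices, which is the
    \<open>+ 1\<close> in the length.\<close>
  have main: "\<exists>n. real n \<le> C * nrm h / r + 1 \<and> chain r (D * nrm h) n h"
    if "r > 0" "nrm h \<le> 2 ^ j * r" for r h j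
    using that
  proof (induction j arbitrary: h)
    case 0
    have "nrm h \<le> D * nrm h" using D(1) mult_right_mono[of 1 D "nrm h"] by simp
    moreover have "0 \<le> D * nrm h" using D(1) by simp
    ultimately have "chain r (D * nrm h) 1 h"
      unfolding chain_def using 0
      by (intro exI[of _ "\<lambda>i. if i = 0 then 0 else h"]) auto
    then show ?case using A(1) 0 by (intro exI[of _ 1]) (auto simp: C_def)
  next
    case (Suc j)
    show ?case
    proof (cases "nrm h \<le> r")
      case True
      have "1 * r \<le> 2 ^ j * r" using Suc.prems by (intro mult_right_mono) auto
      then have "nrm h \<le> 2 ^ j * r" using True by linarith
      then show ?thesis by (rule Suc.IH[OF Suc.prems(1)])
    next
      case False
      define t where "t = nrm h"
      have t: "t \<ge> 0" by (simp add: t_def)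
      obtain g n where g: "real n \<le> A * t / r" "chain r (A * t) n g" "nrm (- g \<odot> h) \<le> \<epsilon> * t"
        using reach_uniform_scaled[OF A(2), of r h] False Suc.prems unfolding t_def by force
      let ?e = "- g \<odot> h"
      have e: "nrm ?e \<le> t / 2" using g(3) eps t mult_right_mono[of \<epsilon> "1/2" t] by simp
      then have "nrm ?e \<le> 2 ^ j * r" using Suc.prems(2) by (simp add: t_def)
      from Suc.IH[OF Suc.prems(1) this] obtain m
        where m: "real m \<le> C * nrm ?e / r + 1" "chain r (D * nrm ?e) m ?e" by blast
      have "chain r (K * max (A * t) (D * nrm ?e)) (n + m) h"
        using chain_mul[OF g(2) m(2)] by simp
      moreover have "K * max (A * t) (D * nrm ?e) \<le> D * t"
      proof -
        have "K * (A * t) \<le> D * t" using mult_right_mono[OF D(2) t] by (simp add: mult.assoc)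
        moreover have "K * (D * nrm ?e) \<le> K * (D * (\<epsilon> * t))"
          using g(3) D K_ge_1 by (intro mult_left_mono) auto
        then have "K * (D * nrm ?e) \<le> D * t"
          using K_ge_1 D t by (simp add: \<epsilon>_def)
        ultimately show ?thesis by (simp add: max_def)
      qed
      moreover have "C * nrm ?e / r \<le> C * (t / 2) / r"
        using e A(1) Suc.prems(1) by (intro divide_right_mono mult_left_mono) (auto simp: C_def)
      then have "real (n + m) \<le> C * t / r + 1"
        using g(1) m(1) by (simp add: C_def)
      ultimately show ?thesis unfolding t_def[symmetric] using chain_mono by blast
    qed
  qed
  have "\<exists>n. real n \<le> C * nrm h / r + 1 \<and> chain r (D * nrm h) n h" if "r > 0" for r h
  proof -
    obtain j where "nrm h / r < 2 ^ j" using real_arch_pow[of 2 "nrm h / r"] by auto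
    then show ?thesis using main[OF that, of h j] that by (simp add: pos_divide_less_eq less_imp_le)
  qed
  moreover have "C \<ge> 0" "D \<ge> 0" using A(1) D(1) by (auto simp: C_def)
  ultimately show ?thesis by blast
qed

end

section \<open>Convexity of powers\<close>

text \<open>If one point is 0, convexity reduces to \<open>s powr p \<le> s\<close> for 0 < s <
  1.\<close>

lemma powr_convex_atLeast:
  assumes p: "p \<ge> (1::real)"
  shows "convex_on {0..} (\<lambda>x. x powr p)"
proof (rule convex_onI)
  fix t x y :: real assume t: "0 < t" "t < 1" and xy: "x \<in> {0..}" "y \<in> {0..}"
  have le: "s powr p \<le> s" if "0 < s" "s < 1" for s :: real
    using powr_mono'[of 1 p s] that p by simp
  consider "x = 0" | "y = 0" | "x > 0" "y > 0" using xy by fastforce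
  then show "((1 - t) *\<^sub>R x + t *\<^sub>R y) powr p \<le> (1 - t) * x powr p + t * y powr p"
  proof cases
    case 1
    then show ?thesis using le[of t] t xy p by (simp add: powr_mult mult_right_mono)
  next
    case 2
    then show ?thesis using le[of "1 - t"] t xy p by (simp add: powr_mult mult_right_mono)
  next
    case 3
    then show ?thesis using convex_onD[OF powr_convex[OF p], of t x y] t by simp
  qed
qed simp

lemma abs_powr_convex:
  assumes p: "p \<ge> (1::real)"
  shows "convex_on UNIV (\<lambda>x. \<bar>x\<bar> powr p)"
proof (rule convex_onI)
  fix t x y :: real assume t: "0 < t" "t < 1"
  have "\<bar>(1 - t) * x + t * y\<bar> \<le> (1 - t) * \<bar>x\<bar> + t * \<bar>y\<bar>"
    using t abs_triangle_ineq[of "(1 - t) * x" "t * y"] by (simp add: abs_mult)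
  then have "\<bar>(1 - t) *\<^sub>R x + t *\<^sub>R y\<bar> powr p \<le> ((1 - t) *\<^sub>R \<bar>x\<bar> + t *\<^sub>R \<bar>y\<bar>) powr p"
    using p by (intro powr_mono2) auto
  also have "\<dots> \<le> (1 - t) * \<bar>x\<bar> powr p + t * \<bar>y\<bar> powr p"
    using convex_onD[OF powr_convex_atLeast[OF p], of t "\<bar>x\<bar>" "\<bar>y\<bar>"] t by simp
  finally show "\<bar>(1 - t) *\<^sub>R x + t *\<^sub>R y\<bar> powr p \<le> (1 - t) * \<bar>x\<bar> powr p + t * \<bar>y\<bar> powr p" .
qed simp

text \<open>Jensen's inequality for the mean of the \<open>n\<close> terms, multiplied by
  \<open>real n powr p\<close>.\<close>

lemma abs_sum_powr_le:
  fixes a :: "nat \<Rightarrow> real"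
  assumes p: "p \<ge> 1"
  shows "\<bar>\<Sum>i<n. a i\<bar> powr p \<le> real n powr (p - 1) * (\<Sum>i<n. \<bar>a i\<bar> powr p)"
proof (cases "n = 0")
  case False
  have "\<bar>\<Sum>i<n. (1 / real n) *\<^sub>R a i\<bar> powr p \<le> (\<Sum>i<n. 1 / real n * \<bar>a i\<bar> powr p)"
    using False by (intro convex_on_sum[OF _ _ abs_powr_convex[OF p]]) auto
  then have "\<bar>(\<Sum>i<n. a i) / real n\<bar> powr p \<le> (\<Sum>i<n. \<bar>a i\<bar> powr p) / real n"
    by (simp add: sum_divide_distrib)
  then have "\<bar>\<Sum>i<n. a i\<bar> powr p / real n powr p \<le> (\<Sum>i<n. \<bar>a i\<bar> powr p) / real n"
    by (simp add: powr_divide)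
  then have "\<bar>\<Sum>i<n. a i\<bar> powr p \<le> (\<Sum>i<n. \<bar>a i\<bar> powr p) / real n * real n powr p"
    using False by (simp add: pos_divide_le_eq)
  also have "\<dots> = real n powr (p - 1) * (\<Sum>i<n. \<bar>a i\<bar> powr p)"
    using False by (simp add: powr_diff)
  finally show ?thesis .
qed (use p in simp)

lemma abs_add_powr_le:
  fixes a b :: real
  assumes p: "p \<ge> 1"
  shows "\<bar>a + b\<bar> powr p \<le> 2 powr (p - 1) * (\<bar>a\<bar> powr p + \<bar>b\<bar> powr p)"
  using abs_sum_powr_le[OF p, of "\<lambda>i. if i = 0 then a else b" 2]
  by (simp add: numeral_2_eq_2)

text \<open>Values in \<open>ennreal\<close> allow infinite integrals and free interchange of their
  order.\<close>

definition osc :: "('x \<Rightarrow> real) \<Rightarrow> real \<Rightarrow> 'x \<Rightarrow> 'x \<Rightarrow> ennreal" where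
  "osc f p x y = ennreal (\<bar>f x - f y\<bar> powr p)"

lemma osc_self [simp]: "osc f p x x = 0"
  by (simp add: osc_def)

lemma osc_measurable [measurable (raw)]:
  assumes [measurable]: "f \<in> borel_measurable borel" "a \<in> borel_measurable M" "b \<in> borel_measurable M"
  shows "(\<lambda>x. osc f p (a x) (b x)) \<in> borel_measurable M"
  unfolding osc_def by measurable

lemma osc_chain:
  assumes p: "p \<ge> 1"
  shows "osc f p (z 0) (z n) \<le> ennreal (real n powr (p - 1)) * (\<Sum>i<n. osc f p (z i) (z (Suc i)))"
proof -
  have "f (z 0) - f (z n) = (\<Sum>i<n. f (z i) - f (z (Suc i)))"
    by (rule sum_lessThan_telescope'[of "\<lambda>i. f (z i)", symmetric])
  then have "\<bar>f (z 0) - f (z n)\<bar> powr p \<le> real n powr (p - 1) * (\<Sum>i<n. \<bar>f (z i) - f (z (Suc i))\<bar> powr p)"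
    using abs_sum_powr_le[OF p] by metis
  then show ?thesis
    unfolding osc_def by (subst sum_ennreal, simp) (simp add: ennreal_mult[symmetric] sum_nonneg ennreal_leI)
qed

lemma osc_triangle:
  assumes p: "p \<ge> 1"
  shows "osc f p x z \<le> ennreal (2 powr (p - 1)) * (osc f p x y + osc f p y z)"
  using abs_add_powr_le[OF p, of "f x - f y" "f y - f z"]
  unfolding osc_def
  by (simp add: ennreal_mult[symmetric] ennreal_plus[symmetric] ennreal_leI del: ennreal_plus)

section \<open>The estimate at a single scale\<close>

context carnot_norm
begin

abbreviation hdim where "hdim \<equiv> hom_dim k wt"

definition nball where "nball r = {x. nrm x < r}"

lemma nball_iff: "x \<in> nball r \<longleftrightarrow> nrm x < r" by (simp add: nball_def)

lemma open_nball: "open (nball r)"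
  unfolding nball_def by (intro open_Collect_less nrm_continuous continuous_on_const)

lemma nball_measurable [measurable]: "nball r \<in> sets borel"
  using open_nball by simp

lemma emeasure_nball_finite: "emeasure lborel (nball r) < \<infinity>"
proof (rule emeasure_bounded_finite)
  show "bounded (nball r)"
    by (rule bounded_subset[OF bounded_nrm_le[of r]]) (auto simp: nball_def)
qed

definition cB where "cB = measure lborel (nball 1)"

lemma cB_pos: "cB > 0"
proof -
  have "0 \<in> nball 1" by (simp add: nball_def)
  then have "nball 1 \<notin> null_sets lborel" using open_not_negligible[OF open_nball, of 1]
    by (metis empty_iff negligible_iff_null_sets null_sets_completionI)
  then have "emeasure lborel (nball 1) \<noteq> 0" by auto
  then show ?thesis
    using emeasure_nball_finite[of 1] by (simp add: cB_def measure_def enn2real_positive_iff zero_less_iff_neq_zero)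
qed

lemma emeasure_nball:
  assumes r: "r > 0"
  shows "emeasure lborel (nball r) = ennreal (cB * r ^ hdim)"
proof -
  have [measurable]: "dilation wt r \<in> borel_measurable borel"
    using linear_dilation by (intro borel_measurable_continuous_onI linear_continuous_on)
      (simp add: linear_conv_bounded_linear)
  have "dilation wt r -` nball r = nball 1"
    using r by (auto simp: nball_def nrm_dilation)
  then have "emeasure (density (distr lborel borel (dilation wt r)) (\<lambda>_. ennreal (r ^ hdim))) (nball r)
      = ennreal (r ^ hdim) * emeasure lborel (nball 1)"
    using r by (simp add: emeasure_density_const emeasure_distr)
  moreover have "emeasure lborel (nball 1) = ennreal cB"
    unfolding cB_def using emeasure_nball_finite[of 1] by (simp add: emeasure_eq_ennreal_measure top.not_eq_extremum)
  ultimately show ?thesis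
    using r cB_pos by (subst lborel_dilation[OF r]) (simp add: ennreal_mult[symmetric] mult.commute)
qed

text \<open>The increment \<open>h\<close> acts on the right, so the distance from \<open>x\<close>
  to \<open>x \<odot> h\<close> is \<open>nrm h\<close> for every \<open>x\<close>, and increments
  along a chain compose.\<close>

definition trosc :: "(real^'a \<Rightarrow> real) \<Rightarrow> real \<Rightarrow> real \<Rightarrow> real^'a \<Rightarrow> ennreal" where
  "trosc f p D h = (\<integral>\<^sup>+x. indicator (nball D) x * osc f p x (x \<odot> h) \<partial>lborel)"

lemma trosc_measurable [measurable]:
  assumes [measurable]: "f \<in> borel_measurable borel"
  shows "trosc f p D \<in> borel_measurable borel"
  unfolding trosc_def[abs_def] by measurable

text \<open>The double integral at one scale: its kernel is the indicator of distance less than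
  \<open>s\<close>, and weighted integrals over \<open>s\<close> build the decreasing kernels from
  it.\<close>

definition near_osc :: "(real^'a \<Rightarrow> real) \<Rightarrow> real \<Rightarrow> real \<Rightarrow> real \<Rightarrow> ennreal" where
  "near_osc f p D s = (\<integral>\<^sup>+x. \<integral>\<^sup>+y. indicator (nball D) x * indicator (nball D) y *
     (indicator {..<s} (nrm (- x \<odot> y)) * osc f p x y) \<partial>lborel \<partial>lborel)"

context
  fixes f :: "real^'a \<Rightarrow> real" and p :: real
  assumes f_meas [measurable]: "f \<in> borel_measurable borel" and p: "p \<ge> 1"
begin

text \<open>Substitute \<open>y = x \<odot> h\<close> by left invariance and exchange the integrals;
  two points of the ball differ by an \<open>h\<close> of norm at most \<open>K * R\<close>.\<close>

lemma osc_ball_le_trosc: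
  "(\<integral>\<^sup>+x. \<integral>\<^sup>+y. indicator (nball R) x * indicator (nball R) y * osc f p x y \<partial>lborel \<partial>lborel)
   \<le> (\<integral>\<^sup>+h. indicator {h. nrm h \<le> K * R} h * trosc f p R h \<partial>lborel)"
proof -
  have "(\<integral>\<^sup>+x. \<integral>\<^sup>+y. indicator (nball R) x * indicator (nball R) y * osc f p x y \<partial>lborel \<partial>lborel)
     = (\<integral>\<^sup>+x. \<integral>\<^sup>+h. indicator (nball R) x * indicator (nball R) (x \<odot> h) * osc f p x (x \<odot> h) \<partial>lborel \<partial>lborel)"
    by (intro nn_integral_cong nn_integral_mul_left[symmetric]) measurable
  also have "\<dots> \<le> (\<integral>\<^sup>+x. \<integral>\<^sup>+h. indicator {h. nrm h \<le> K * R} h * (indicator (nball R) x * osc f p x (x \<odot> h)) \<partial>lborel \<partial>lborel)"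
  proof (intro nn_integral_mono)
    fix x h
    have "nrm h \<le> K * R" if "nrm x < R" "nrm (x \<odot> h) < R"
      using nrm_mul_bound[of "- x" R "x \<odot> h"] that by simp
    then show "indicator (nball R) x * indicator (nball R) (x \<odot> h) * osc f p x (x \<odot> h)
      \<le> indicator {h. nrm h \<le> K * R} h * (indicator (nball R) x * osc f p x (x \<odot> h))"
      by (auto simp: indicator_def nball_iff)
  qed
  also have "\<dots> = (\<integral>\<^sup>+h. \<integral>\<^sup>+x. indicator {h. nrm h \<le> K * R} h * (indicator (nball R) x * osc f p x (x \<odot> h)) \<partial>lborel \<partial>lborel)"
    by (rule lborel_pair.Fubini') measurable
  also have "\<dots> = (\<integral>\<^sup>+h. indicator {h. nrm h \<le> K * R} h * trosc f p R h \<partial>lborel)"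
    unfolding trosc_def by (intro nn_integral_cong nn_integral_cmult) measurable
  finally show ?thesis .
qed

lemma trosc_translate_le:
  assumes "\<And>x. nrm x < D \<Longrightarrow> nrm (x \<odot> g) < D'"
  shows "(\<integral>\<^sup>+x. indicator (nball D) x * osc f p (x \<odot> g) (x \<odot> e) \<partial>lborel) \<le> trosc f p D' (- g \<odot> e)"
proof -
  have "(\<integral>\<^sup>+x. indicator (nball D) x * osc f p (x \<odot> g) (x \<odot> e) \<partial>lborel)
     \<le> (\<integral>\<^sup>+x. indicator (nball D') (x \<odot> g) * osc f p (x \<odot> g) ((x \<odot> g) \<odot> (- g \<odot> e)) \<partial>lborel)"
    using assms by (intro nn_integral_mono) (auto simp: indicator_def nball_iff mul_assoc)
  also have "\<dots> = trosc f p D' (- g \<odot> e)"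
    unfolding trosc_def
    by (rule nn_integral_mul_right[where f = "\<lambda>x. indicator (nball D') x * osc f p x (x \<odot> (- g \<odot> e))"]) measurable
  finally show ?thesis .
qed

text \<open>Telescoping costs \<open>real n powr (p - 1)\<close>, and summing \<open>n\<close>
  increments, each at most \<open>M\<close> after a right translation, costs one more factor
  \<open>n\<close>. The ball of radius \<open>D'\<close> contains all translates of the ball of
  radius \<open>D\<close> by points of the chain.\<close>

lemma trosc_chain_le:
  assumes ch: "chain r E n h" and D': "K * max D E < D'"
    and M: "\<And>e. nrm e \<le> r \<Longrightarrow> trosc f p D' e \<le> M"
  shows "trosc f p D h \<le> ennreal (real n powr p) * M"
proof -
  obtain z where z: "z 0 = 0" "z n = h" "\<And>i. i < n \<Longrightarrow> nrm (- z i \<odot> z (Suc i)) \<le> r"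
      "\<And>i. i \<le> n \<Longrightarrow> nrm (z i) \<le> E"
    using ch unfolding chain_def by blast
  have "trosc f p D h \<le> (\<integral>\<^sup>+x. ennreal (real n powr (p - 1)) *
      (\<Sum>i<n. indicator (nball D) x * osc f p (x \<odot> z i) (x \<odot> z (Suc i))) \<partial>lborel)"
    unfolding trosc_def
  proof (intro nn_integral_mono)
    fix x
    show "indicator (nball D) x * osc f p x (x \<odot> h) \<le> ennreal (real n powr (p - 1)) *
      (\<Sum>i<n. indicator (nball D) x * osc f p (x \<odot> z i) (x \<odot> z (Suc i)))"
      using osc_chain[OF p, of f "\<lambda>i. x \<odot> z i" n] z(1,2) by (auto simp: indicator_def)
  qed
  also have "\<dots> = ennreal (real n powr (p - 1)) *
      (\<Sum>i<n. \<integral>\<^sup>+x. indicator (nball D) x * osc f p (x \<odot> z i) (x \<odot> z (Suc i)) \<partial>lborel)"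
    by (subst nn_integral_cmult, measurable) (subst nn_integral_sum, measurable)
  also have "\<dots> \<le> ennreal (real n powr (p - 1)) * (\<Sum>i<n. M)"
  proof (intro mult_left_mono sum_mono)
    fix i assume i: "i \<in> {..<n}"
    have "nrm (x \<odot> z i) < D'" if "nrm x < D" for x
    proof -
      have "nrm (x \<odot> z i) \<le> K * max D E"
        using that z(4)[of i] i by (intro nrm_mul_bound) auto
      then show ?thesis using D' by linarith
    qed
    from trosc_translate_le[OF this, of D "z (Suc i)"] M[OF z(3)[of i]] i
    show "(\<integral>\<^sup>+x. indicator (nball D) x * osc f p (x \<odot> z i) (x \<odot> z (Suc i)) \<partial>lborel) \<le> M"
      by (auto intro: order_trans)
  qed simp
  also have "\<dots> = ennreal (real n powr p) * M"
  proof (cases "n = 0")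
    case False
    then have "real n powr (p - 1) * real n = real n powr p" by (simp add: powr_diff)
    then show ?thesis by (simp add: mult.assoc[symmetric] ennreal_of_nat_eq_real_of_nat ennreal_mult[symmetric])
  qed (use p in simp)
  finally show ?thesis .
qed

text \<open>A fixed increment \<open>e\<close> is replaced by an average: the path from
  \<open>x\<close> to \<open>x \<odot> e\<close> passes through \<open>x \<odot> g\<close> with
  \<open>g\<close> in the ball of radius \<open>r\<close>. The two legs have increments
  \<open>g\<close> and \<open>- g \<odot> e\<close>, both of norm at most
  \<open>K * r\<close>.\<close>

lemma trosc_average_le:
  assumes r: "0 < r" "r \<le> D" and e: "nrm e \<le> r"
  shows "emeasure lborel (nball r) * trosc f p D e \<le>
    ennreal (2 powr p) * (\<integral>\<^sup>+g. indicator {g. nrm g \<le> K * r} g * trosc f p ((K + 1) * D) g \<partial>lborel)"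
    (is "_ \<le> _ * ?G")
proof -
  let ?D' = "(K + 1) * D"
  have KD: "D \<le> ?D'" "K * D < ?D'" using K_ge_1 r by (auto simp: algebra_simps)
  have "emeasure lborel (nball r) * trosc f p D e = (\<integral>\<^sup>+g. indicator (nball r) g * trosc f p D e \<partial>lborel)"
    by (subst nn_integral_multc) auto
  also have "\<dots> \<le> (\<integral>\<^sup>+g. ennreal (2 powr (p - 1)) * (indicator (nball r) g * trosc f p D g
      + indicator (nball r) g * trosc f p ?D' (- g \<odot> e)) \<partial>lborel)"
  proof (intro nn_integral_mono)
    fix g
    show "indicator (nball r) g * trosc f p D e \<le> ennreal (2 powr (p - 1)) *
       (indicator (nball r) g * trosc f p D g + indicator (nball r) g * trosc f p ?D' (- g \<odot> e))"
    proof (cases "g \<in> nball r")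
      case True
      have "nrm (x \<odot> g) < ?D'" if "nrm x < D" for x
        using that True r by (intro le_less_trans[OF nrm_mul_bound KD(2)]) (auto simp: nball_iff)
      note tr = trosc_translate_le[OF this]
      have "trosc f p D e \<le> (\<integral>\<^sup>+x. ennreal (2 powr (p - 1)) * (indicator (nball D) x * osc f p x (x \<odot> g)
          + indicator (nball D) x * osc f p (x \<odot> g) (x \<odot> e)) \<partial>lborel)"
        unfolding trosc_def
        by (intro nn_integral_mono) (auto simp: indicator_def osc_triangle[OF p])
      also have "\<dots> = ennreal (2 powr (p - 1)) * (trosc f p D g
          + (\<integral>\<^sup>+x. indicator (nball D) x * osc f p (x \<odot> g) (x \<odot> e) \<partial>lborel))"
        unfolding trosc_def by (subst nn_integral_cmult, measurable) (subst nn_integral_add, auto)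
      also have "\<dots> \<le> ennreal (2 powr (p - 1)) * (trosc f p D g + trosc f p ?D' (- g \<odot> e))"
        by (intro mult_left_mono add_left_mono tr) auto
      finally show ?thesis using True by simp
    qed simp
  qed
  also have "\<dots> = ennreal (2 powr (p - 1)) * ((\<integral>\<^sup>+g. indicator (nball r) g * trosc f p D g \<partial>lborel)
      + (\<integral>\<^sup>+g. indicator (nball r) g * trosc f p ?D' (- g \<odot> e) \<partial>lborel))"
    by (subst nn_integral_cmult, measurable) (subst nn_integral_add, auto)
  also have "\<dots> \<le> ennreal (2 powr (p - 1)) * (?G + ?G)"
  proof (intro mult_left_mono add_mono)
    have "trosc f p D g \<le> trosc f p ?D' g" for g
      unfolding trosc_def using KD(1)
      by (intro nn_integral_mono mult_right_mono) (auto simp: indicator_def nball_iff)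
    moreover have "r \<le> K * r" using K_ge_1 r by simp
    then have "indicator (nball r) g \<le> (indicator {g. nrm g \<le> K * r} g :: ennreal)" for g
      by (auto simp: indicator_def nball_iff)
    ultimately show "(\<integral>\<^sup>+g. indicator (nball r) g * trosc f p D g \<partial>lborel) \<le> ?G"
      by (intro nn_integral_mono mult_mono) auto
  next
    \<comment> \<open>Inversion of \<open>g\<close> followed by a right translation by
      \<open>e\<close> turns the increment \<open>- g \<odot> e\<close> into the integration
      variable.\<close>
    have "(\<integral>\<^sup>+g. indicator (nball r) g * trosc f p ?D' (- g \<odot> e) \<partial>lborel)
        = (\<integral>\<^sup>+g. indicator (nball r) (- g) * trosc f p ?D' (g \<odot> e) \<partial>lborel)"
      by (subst nn_integral_uminus[symmetric]) (auto, measurable)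
    also have "\<dots> = (\<integral>\<^sup>+g. indicator (nball r) (- ((g \<odot> e) \<odot> - e)) * trosc f p ?D' (g \<odot> e) \<partial>lborel)"
      by simp
    also have "\<dots> = (\<integral>\<^sup>+g. indicator (nball r) (- (g \<odot> - e)) * trosc f p ?D' g \<partial>lborel)"
      by (rule nn_integral_mul_right[where f = "\<lambda>g. indicator (nball r) (- (g \<odot> - e)) * trosc f p ?D' g"]) measurable
    also have "\<dots> \<le> ?G"
    proof (intro nn_integral_mono mult_right_mono)
      fix g
      have "nrm g \<le> K * r" if "nrm (g \<odot> - e) < r"
        using nrm_mul_bound[of "g \<odot> - e" r e] that e by simp
      then show "indicator (nball r) (- (g \<odot> - e)) \<le> (indicator {g. nrm g \<le> K * r} g :: ennreal)"
        by (auto simp: indicator_def nball_iff)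
    qed simp
    finally show "(\<integral>\<^sup>+g. indicator (nball r) g * trosc f p ?D' (- g \<odot> e) \<partial>lborel) \<le> ?G" .
  qed simp
  also have "\<dots> = ennreal (2 powr p) * ?G"
  proof -
    have "2 powr p = 2 powr (p - 1) * 2" by (simp add: powr_diff)
    then show ?thesis by (simp add: ennreal_mult mult_2[symmetric] mult.assoc)
  qed
  finally show ?thesis .
qed

lemma trosc_integral_le_near_osc:
  assumes "s \<le> D"
  shows "(\<integral>\<^sup>+g. indicator (nball s) g * trosc f p D g \<partial>lborel) \<le> near_osc f p ((K + 1) * D) s"
proof -
  have "(\<integral>\<^sup>+g. indicator (nball s) g * trosc f p D g \<partial>lborel)
     = (\<integral>\<^sup>+g. \<integral>\<^sup>+x. indicator (nball s) g * (indicator (nball D) x * osc f p x (x \<odot> g)) \<partial>lborel \<partial>lborel)"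
    unfolding trosc_def by (intro nn_integral_cong nn_integral_cmult[symmetric]) measurable
  also have "\<dots> = (\<integral>\<^sup>+x. \<integral>\<^sup>+g. indicator (nball s) g * (indicator (nball D) x * osc f p x (x \<odot> g)) \<partial>lborel \<partial>lborel)"
    by (rule lborel_pair.Fubini') measurable
  also have "\<dots> = (\<integral>\<^sup>+x. \<integral>\<^sup>+g. indicator (nball s) (- x \<odot> (x \<odot> g)) * (indicator (nball D) x * osc f p x (x \<odot> g)) \<partial>lborel \<partial>lborel)"
    by simp
  also have "\<dots> = (\<integral>\<^sup>+x. \<integral>\<^sup>+y. indicator (nball s) (- x \<odot> y) * (indicator (nball D) x * osc f p x y) \<partial>lborel \<partial>lborel)"
    by (intro nn_integral_cong nn_integral_mul_left) measurable
  also have "\<dots> \<le> near_osc f p ((K + 1) * D) s"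
    unfolding near_osc_def
  proof (intro nn_integral_mono)
    fix x y
    have "nrm x < (K + 1) * D \<and> nrm y < (K + 1) * D" if "nrm x < D" "nrm (- x \<odot> y) < s"
    proof -
      have D: "D > 0" using that(1) nrm_nonneg[of x] by linarith
      have "nrm (x \<odot> (- x \<odot> y)) \<le> K * D" using that assms by (intro nrm_mul_bound) auto
      moreover have "K * D < (K + 1) * D" "D \<le> (K + 1) * D" using D K_ge_1 by (auto simp: algebra_simps)
      ultimately show ?thesis using that by auto
    qed
    then show "indicator (nball s) (- x \<odot> y) * (indicator (nball D) x * osc f p x y)
      \<le> indicator (nball ((K + 1) * D)) x * indicator (nball ((K + 1) * D)) y *
        (indicator {..<s} (nrm (- x \<odot> y)) * osc f p x y)"
      by (auto simp: indicator_def nball_iff)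
  qed
  finally show ?thesis .
qed

end

lemma ennreal_le_divide_cmult:
  assumes "ennreal x * T \<le> ennreal y * G" "x > 0" "y \<ge> 0"
  shows "T \<le> ennreal (y / x) * G"
proof -
  have "T = ennreal (1 / x) * (ennreal x * T)"
    using assms by (simp add: mult.assoc[symmetric] ennreal_mult[symmetric])
  also have "\<dots> \<le> ennreal (1 / x) * (ennreal y * G)" by (intro mult_left_mono assms) auto
  also have "\<dots> = ennreal (y / x) * G"
    using assms by (simp add: mult.assoc[symmetric] ennreal_mult[symmetric])
  finally show ?thesis .
qed

theorem osc_ball_le_near_osc:
  "\<exists>\<mu>>0. \<forall>p\<ge>1. \<exists>C>0. \<forall>f\<in>borel_measurable borel. \<forall>R s. 0 < s \<longrightarrow> s \<le> R \<longrightarrow>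
     (\<integral>\<^sup>+x. \<integral>\<^sup>+y. indicator (nball R) x * indicator (nball R) y * osc f p x y \<partial>lborel \<partial>lborel)
     \<le> ennreal (C * R ^ hdim * R powr p / (s powr p * s ^ hdim)) * near_osc f p (\<mu> * R) s"
proof -
  obtain C0 D0 where C0: "C0 \<ge> 0" and D0: "D0 \<ge> 0"
    and ch: "\<And>r h. r > 0 \<Longrightarrow> \<exists>n. real n \<le> C0 * nrm h / r + 1 \<and> chain r (D0 * nrm h) n h"
    using chain_ex by blast
  \<comment> \<open>A chain to some \<open>h\<close> of norm at most \<open>K * R\<close> stays
    within \<open>D0 * K * R\<close>, so \<open>a * R\<close> bounds all translates of the ball; the
    summand 1 makes the inequality strict.\<close>
  define a where "a = K * max 1 (D0 * K) + 1"
  \<comment> \<open>Averaging an increment and passing from increments to pairs each enlarge the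
    radius by the factor \<open>K + 1\<close>.\<close>
  define \<mu> where "\<mu> = (K + 1) * ((K + 1) * a)"
  \<comment> \<open>Chosen so that \<open>b * R / s\<close> bounds the number of steps of size
    \<open>s / (2 * K)\<close>.\<close>
  define b where "b = (C0 * K + 1) * (2 * K)"
  have K: "K \<ge> 1" by (rule K_ge_1)
  have a: "a \<ge> 1" using K by (simp add: a_def)
  have b: "b > 0" using K C0 by (simp add: b_def add_nonneg_pos)
  have \<mu>: "\<mu> > 0" using K a by (simp add: \<mu>_def)
  have "\<exists>C>0. \<forall>f\<in>borel_measurable borel. \<forall>R s. 0 < s \<longrightarrow> s \<le> R \<longrightarrow>
     (\<integral>\<^sup>+x. \<integral>\<^sup>+y. indicator (nball R) x * indicator (nball R) y * osc f p x y \<partial>lborel \<partial>lborel)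
     \<le> ennreal (C * R ^ hdim * R powr p / (s powr p * s ^ hdim)) * near_osc f p (\<mu> * R) s"
    if p: "p \<ge> 1" for p
  proof (intro exI[of _ "b powr p * 2 powr p * (2 * K) ^ hdim * (2 * K) ^ hdim"] conjI ballI allI impI)
    show "b powr p * 2 powr p * (2 * K) ^ hdim * (2 * K) ^ hdim > 0" using b K by simp
    fix f :: "real^'a \<Rightarrow> real" and R s :: real
    assume f [measurable]: "f \<in> borel_measurable borel" and s: "0 < s" "s \<le> R"
    \<comment> \<open>Averaging produces increments of norm up to \<open>K * r\<close>; this choice
      keeps them strictly below \<open>s\<close>.\<close>
    define r where "r = s / (2 * K)"
    have r: "r > 0" "K * r < s" using s K by (auto simp: r_def)
    have "1 * r \<le> K * r" using K r(1) by (intro mult_right_mono) auto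
    then have rR: "r \<le> R" using r s by linarith
    have R: "R > 0" using s by simp
    have aR: "R \<le> a * R" using a R mult_right_mono[of 1 a R] by simp
    have KaR: "a * R \<le> (K + 1) * (a * R)" using K aR R mult_right_mono[of 1 "K + 1" "a * R"] by simp
    define G where "G = near_osc f p (\<mu> * R) s"
    define M where "M = ennreal (2 powr p / (cB * r ^ hdim)) * G"
    have M: "trosc f p (a * R) e \<le> M" if e: "nrm e \<le> r" for e
      unfolding M_def
    proof (rule ennreal_le_divide_cmult)
      have "ennreal (cB * r ^ hdim) * trosc f p (a * R) e = emeasure lborel (nball r) * trosc f p (a * R) e"
        using r by (simp add: emeasure_nball)
      also have "\<dots> \<le> ennreal (2 powr p) *
          (\<integral>\<^sup>+g. indicator {g. nrm g \<le> K * r} g * trosc f p ((K + 1) * (a * R)) g \<partial>lborel)"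
        by (rule trosc_average_le[OF f p r(1) order_trans[OF rR aR] e])
      also have "\<dots> \<le> ennreal (2 powr p) *
          (\<integral>\<^sup>+g. indicator (nball s) g * trosc f p ((K + 1) * (a * R)) g \<partial>lborel)"
        using r by (intro mult_left_mono nn_integral_mono mult_right_mono) (auto simp: indicator_def nball_iff)
      also have "\<dots> \<le> ennreal (2 powr p) * near_osc f p ((K + 1) * ((K + 1) * (a * R))) s"
        by (intro mult_left_mono trosc_integral_le_near_osc f p order_trans[OF s(2) order_trans[OF aR KaR]]) auto
      also have "(K + 1) * ((K + 1) * (a * R)) = \<mu> * R" by (simp add: \<mu>_def)
      finally show "ennreal (cB * r ^ hdim) * trosc f p (a * R) e \<le> ennreal (2 powr p) * G"
        by (simp add: G_def)
    qed (use r cB_pos in auto)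
    define N where "N = b * R / s"
    have T: "trosc f p R h \<le> ennreal (N powr p) * M" if h: "nrm h \<le> K * R" for h
    proof -
      obtain n where n: "real n \<le> C0 * nrm h / r + 1" "chain r (D0 * nrm h) n h" using ch r(1) by blast
      have "D0 * nrm h \<le> D0 * (K * R)" using h D0 by (intro mult_left_mono) auto
      then have "chain r (D0 * (K * R)) n h" by (rule chain_mono[OF n(2) order_refl])
      moreover have "K * max R (D0 * (K * R)) < a * R"
      proof -
        have "max R (D0 * (K * R)) = max 1 (D0 * K) * R" using R by (simp add: max_mult_distrib_right)
        then show ?thesis using R by (simp add: a_def algebra_simps)
      qed
      ultimately have "trosc f p R h \<le> ennreal (real n powr p) * M"
        by (rule trosc_chain_le[OF f p _ _ M])
      also have "\<dots> \<le> ennreal (N powr p) * M"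
      proof (intro mult_right_mono ennreal_leI powr_mono2)
        have "C0 * nrm h / r \<le> C0 * (K * R) / r" using h C0 r by (intro divide_right_mono mult_left_mono) auto
        \<comment> \<open>The additional step of the chain is absorbed into
          \<open>R / r\<close>.\<close>
        moreover have "1 \<le> R / r" using rR r by simp
        ultimately have "real n \<le> C0 * (K * R) / r + R / r" using n(1) by linarith
        also have "\<dots> = N" using K s by (simp add: N_def b_def r_def field_simps)
        finally show "real n \<le> N" .
      qed (use p in auto)
      finally show ?thesis .
    qed
    have "(\<integral>\<^sup>+x. \<integral>\<^sup>+y. indicator (nball R) x * indicator (nball R) y * osc f p x y \<partial>lborel \<partial>lborel)
       \<le> (\<integral>\<^sup>+h. indicator {h. nrm h \<le> K * R} h * trosc f p R h \<partial>lborel)"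
      by (rule osc_ball_le_trosc[OF f p])
    also have "\<dots> \<le> (\<integral>\<^sup>+h. indicator (nball (2 * K * R)) h * (ennreal (N powr p) * M) \<partial>lborel)"
    proof (intro nn_integral_mono)
      fix h
      have "K * R < 2 * K * R" using K R by simp
      then have "nrm h < 2 * K * R" if "nrm h \<le> K * R" using that by linarith
      then show "indicator {h. nrm h \<le> K * R} h * trosc f p R h \<le> indicator (nball (2 * K * R)) h * (ennreal (N powr p) * M)"
        using T[of h] by (auto simp: indicator_def nball_iff)
    qed
    also have "\<dots> = emeasure lborel (nball (2 * K * R)) * (ennreal (N powr p) * M)"
      by (subst nn_integral_multc) auto
    also have "emeasure lborel (nball (2 * K * R)) = ennreal (cB * (2 * K * R) ^ hdim)"
      using K R by (intro emeasure_nball) simp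
    also have "ennreal (cB * (2 * K * R) ^ hdim) * (ennreal (N powr p) * M)
       = ennreal (cB * (2 * K * R) ^ hdim * (N powr p * (2 powr p / (cB * r ^ hdim)))) * G"
      unfolding M_def using cB_pos K R r by (simp add: mult.assoc[symmetric] ennreal_mult[symmetric])
    also have "cB * (2 * K * R) ^ hdim * (N powr p * (2 powr p / (cB * r ^ hdim)))
       = b powr p * 2 powr p * (2 * K) ^ hdim * (2 * K) ^ hdim * R ^ hdim * R powr p / (s powr p * s ^ hdim)"
    proof -
      have "N powr p = b powr p * R powr p / s powr p"
        using b R s by (simp add: N_def powr_divide powr_mult)
      moreover have "(2 * K * R) ^ hdim = (2 * K) ^ hdim * R ^ hdim" "r ^ hdim = s ^ hdim / (2 * K) ^ hdim"
        by (simp_all add: r_def power_mult_distrib power_divide)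
      moreover have "cB \<noteq> 0" "(2 * K) ^ hdim \<noteq> 0" "s ^ hdim \<noteq> 0" "s powr p \<noteq> 0" using cB_pos K s by auto
      ultimately show ?thesis by (simp only:) (simp add: field_simps)
    qed
    finally show "(\<integral>\<^sup>+x. \<integral>\<^sup>+y. indicator (nball R) x * indicator (nball R) y * osc f p x y \<partial>lborel \<partial>lborel)
     \<le> ennreal (b powr p * 2 powr p * (2 * K) ^ hdim * (2 * K) ^ hdim * R ^ hdim * R powr p / (s powr p * s ^ hdim)) *
        near_osc f p (\<mu> * R) s" by (simp add: G_def)
  qed
  with \<mu> show ?thesis by blast
qed

end

section \<open>Integration over the scales\<close>

text \<open>On the tail \<open>\<psi> s\<close> is at most \<open>\<psi> d\<close>, and the
  remaining power integrates to \<open>d powr (- c) / c\<close>; the factor \<open>1 / c\<close> is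
  at most 1.\<close>

lemma powr_tail_integral_le:
  fixes \<psi> :: "real \<Rightarrow> real"
  assumes anti: "antimono_on {0<..} \<psi>" and nonneg: "\<And>r. r > 0 \<Longrightarrow> \<psi> r \<ge> 0"
    and d: "d > 0" and c: "c \<ge> 1"
  shows "(\<integral>\<^sup>+s. indicator {d<..} s * ennreal (\<psi> s * s powr (- c - 1)) \<partial>lborel) \<le> ennreal (\<psi> d * d powr (- c))"
proof -
  have F: "((\<lambda>s. - (s powr (- c)) / c) has_real_derivative s powr (- c - 1)) (at s)" if "d \<le> s" for s
    using that d c by (auto intro!: derivative_eq_intros)
  have lim: "((\<lambda>s. - (s powr (- c)) / c) \<longlongrightarrow> - 0 / c) at_top"
    using c by (intro tendsto_intros tendsto_neg_powr filterlim_ident) auto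
  have "(\<integral>\<^sup>+s. indicator {d<..} s * ennreal (\<psi> s * s powr (- c - 1)) \<partial>lborel)
      \<le> (\<integral>\<^sup>+s. ennreal (\<psi> d) * (ennreal (s powr (- c - 1)) * indicator {d..} s) \<partial>lborel)"
  proof (intro nn_integral_mono)
    fix s
    have "\<psi> s \<le> \<psi> d" if "d < s" using monotone_onD[OF anti, of d s] that d by auto
    then show "indicator {d<..} s * ennreal (\<psi> s * s powr (- c - 1)) \<le>
        ennreal (\<psi> d) * (ennreal (s powr (- c - 1)) * indicator {d..} s)"
      using nonneg[OF d] by (auto simp: indicator_def ennreal_mult[symmetric] intro!: ennreal_leI mult_right_mono)
  qed
  also have "\<dots> = ennreal (\<psi> d) * (\<integral>\<^sup>+s. ennreal (s powr (- c - 1)) * indicator {d..} s \<partial>lborel)"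
    by (rule nn_integral_cmult) measurable
  also have "(\<integral>\<^sup>+s. ennreal (s powr (- c - 1)) * indicator {d..} s \<partial>lborel) = ennreal (- 0 / c - (- (d powr (- c)) / c))"
    by (rule nn_integral_FTC_atLeast[OF _ F _ lim]) auto
  also have "ennreal (\<psi> d) * ennreal (- 0 / c - (- (d powr (- c)) / c)) = ennreal (\<psi> d * (d powr (- c) / c))"
    using nonneg[OF d] c by (simp add: ennreal_mult[symmetric])
  also have "\<dots> \<le> ennreal (\<psi> d * d powr (- c))"
    using nonneg[OF d] c by (intro ennreal_leI mult_left_mono) (auto simp: divide_le_eq mult_le_cancel_left1)
  finally show ?thesis .
qed

context carnot_norm
begin

lemma near_osc_measurable:
  assumes [measurable]: "f \<in> borel_measurable borel"
  shows "near_osc f p D \<in> borel_measurable borel"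
proof -
  have "near_osc f p D = (\<lambda>s. \<integral>\<^sup>+x. \<integral>\<^sup>+y. indicator (nball D) x * indicator (nball D) y *
     (if nrm (- x \<odot> y) < s then osc f p x y else 0) \<partial>lborel \<partial>lborel)"
    unfolding near_osc_def by (intro ext nn_integral_cong) (simp add: indicator_def)
  then show ?thesis by simp
qed

text \<open>With the integral over \<open>s\<close> moved inside, a pair at distance d sees only the
  scales \<open>s > d\<close>. Dropping the upper limit \<open>R\<close> leaves the tail
  integral.\<close>

lemma near_osc_weighted_integral_le:
  fixes \<psi> :: "real \<Rightarrow> real"
  assumes f [measurable]: "f \<in> borel_measurable borel"
    and \<psi> [measurable]: "\<psi> \<in> borel_measurable borel"
    and anti: "antimono_on {0<..} \<psi>" and nonneg: "\<And>r. r > 0 \<Longrightarrow> \<psi> r \<ge> 0" and c: "c \<ge> 1"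
  shows "(\<integral>\<^sup>+s. indicator {0<..<R} s * ennreal (\<psi> s * s powr (- c - 1)) * near_osc f p D s \<partial>lborel)
    \<le> (\<integral>\<^sup>+x. \<integral>\<^sup>+y. indicator (nball D) x * indicator (nball D) y *
        (osc f p x y * ennreal (\<psi> (nrm (- x \<odot> y)) * nrm (- x \<odot> y) powr (- c))) \<partial>lborel \<partial>lborel)"
proof -
  define w where "w s = indicator {0<..<R} s * ennreal (\<psi> s * s powr (- c - 1))" for s
  have w [measurable]: "w \<in> borel_measurable borel" unfolding w_def[abs_def] by measurable
  define H where "H s x y = w s * (indicator (nball D) x * indicator (nball D) y *
     (indicator {..<s} (nrm (- x \<odot> y)) * osc f p x y))" for s x y
  have [measurable]: "(\<lambda>z. H (a z) (b z) (e z)) \<in> borel_measurable M"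
    if [measurable]: "a \<in> borel_measurable M" "b \<in> borel_measurable M" "e \<in> borel_measurable M"
    for a b e and M :: "'z measure"
  proof -
    have "(\<lambda>z. indicator {..<a z} (nrm (- b z \<odot> e z)) :: ennreal) = (\<lambda>z. if nrm (- b z \<odot> e z) < a z then 1 else 0)"
      by (auto simp: indicator_def)
    then have [measurable]: "(\<lambda>z. indicator {..<a z} (nrm (- b z \<odot> e z)) :: ennreal) \<in> borel_measurable M" by simp
    show ?thesis unfolding H_def by measurable
  qed
  have "(\<integral>\<^sup>+s. w s * near_osc f p D s \<partial>lborel) = (\<integral>\<^sup>+s. \<integral>\<^sup>+x. \<integral>\<^sup>+y. H s x y \<partial>lborel \<partial>lborel \<partial>lborel)"
  proof (intro nn_integral_cong)
    fix s
    have "w s * near_osc f p D s = (\<integral>\<^sup>+x. w s * (\<integral>\<^sup>+y. indicator (nball D) x * indicator (nball D) y *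
     (indicator {..<s} (nrm (- x \<odot> y)) * osc f p x y) \<partial>lborel) \<partial>lborel)"
      unfolding near_osc_def by (subst nn_integral_cmult) measurable
    also have "\<dots> = (\<integral>\<^sup>+x. \<integral>\<^sup>+y. H s x y \<partial>lborel \<partial>lborel)"
      unfolding H_def by (intro nn_integral_cong nn_integral_cmult[symmetric]) measurable
    finally show "w s * near_osc f p D s = (\<integral>\<^sup>+x. \<integral>\<^sup>+y. H s x y \<partial>lborel \<partial>lborel)" .
  qed
  also have "\<dots> = (\<integral>\<^sup>+x. \<integral>\<^sup>+s. \<integral>\<^sup>+y. H s x y \<partial>lborel \<partial>lborel \<partial>lborel)"
    by (rule lborel_pair.Fubini') measurable
  also have "\<dots> = (\<integral>\<^sup>+x. \<integral>\<^sup>+y. \<integral>\<^sup>+s. H s x y \<partial>lborel \<partial>lborel \<partial>lborel)"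
    by (intro nn_integral_cong lborel_pair.Fubini') measurable
  also have "\<dots> \<le> (\<integral>\<^sup>+x. \<integral>\<^sup>+y. indicator (nball D) x * indicator (nball D) y *
        (osc f p x y * ennreal (\<psi> (nrm (- x \<odot> y)) * nrm (- x \<odot> y) powr (- c))) \<partial>lborel \<partial>lborel)"
  proof (intro nn_integral_mono)
    fix x y
    let ?d = "nrm (- x \<odot> y)"
    show "(\<integral>\<^sup>+s. H s x y \<partial>lborel) \<le> indicator (nball D) x * indicator (nball D) y *
        (osc f p x y * ennreal (\<psi> ?d * ?d powr (- c)))"
    \<comment> \<open>On the diagonal nothing is known about \<open>\<psi>\<close>, but the
      oscillation vanishes there.\<close>
    proof (cases "?d = 0")
      case True
      then have "- x \<odot> y = 0" by simp
      then have "x \<odot> (- x \<odot> y) = x" by simp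
      then have "x = y" by simp
      then show ?thesis by (simp add: H_def)
    next
      case False
      then have d: "?d > 0" using nrm_nonneg[of "- x \<odot> y"] by linarith
      have "(\<integral>\<^sup>+s. H s x y \<partial>lborel) \<le> (\<integral>\<^sup>+s. (indicator (nball D) x * indicator (nball D) y * osc f p x y) *
          (indicator {?d<..} s * ennreal (\<psi> s * s powr (- c - 1))) \<partial>lborel)"
        by (intro nn_integral_mono) (auto simp: H_def w_def indicator_def mult.commute)
      also have "\<dots> = (indicator (nball D) x * indicator (nball D) y * osc f p x y) *
          (\<integral>\<^sup>+s. indicator {?d<..} s * ennreal (\<psi> s * s powr (- c - 1)) \<partial>lborel)"
        by (rule nn_integral_cmult) measurable
      also have "\<dots> \<le> (indicator (nball D) x * indicator (nball D) y * osc f p x y) *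
          ennreal (\<psi> ?d * ?d powr (- c))"
        by (intro mult_left_mono powr_tail_integral_le anti nonneg d c) auto
      finally show ?thesis by (simp add: mult.assoc)
    qed
  qed
  finally show ?thesis by (simp add: w_def)
qed

text \<open>The left side of the estimate at one scale does not depend on \<open>s\<close>, so
  integrating it against the weight multiplies it by the integral of
  \<open>\<psi> \<tau> * \<tau> ^ q\<close>, by which one then divides.\<close>

theorem osc_ball_le_weighted:
  "\<exists>\<mu>>0. \<forall>p\<ge>1. \<exists>C>0. \<forall>f\<in>borel_measurable borel. \<forall>\<psi>\<in>borel_measurable borel. \<forall>R>0. \<forall>q. q + 1 \<le> hdim \<longrightarrow>
     antimono_on {0<..} \<psi> \<longrightarrow> (\<forall>r>0. \<psi> r \<ge> 0) \<longrightarrow>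
     set_integrable lborel {0<..<R} (\<lambda>\<tau>. \<psi> \<tau> * \<tau> ^ q) \<longrightarrow> (LINT \<tau>:{0<..<R}|lborel. \<psi> \<tau> * \<tau> ^ q) > 0 \<longrightarrow>
     (\<integral>\<^sup>+x. \<integral>\<^sup>+y. indicator (nball R) x * indicator (nball R) y * osc f p x y \<partial>lborel \<partial>lborel)
     \<le> ennreal (C * R ^ hdim * R powr p / (LINT \<tau>:{0<..<R}|lborel. \<psi> \<tau> * \<tau> ^ q)) *
       (\<integral>\<^sup>+x. \<integral>\<^sup>+y. indicator (nball (\<mu> * R)) x * indicator (nball (\<mu> * R)) y *
        (osc f p x y * ennreal (\<psi> (nrm (- x \<odot> y)) * nrm (- x \<odot> y) powr (real q + 1 - p - real hdim))) \<partial>lborel \<partial>lborel)"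
proof -
  obtain \<mu> where \<mu>: "\<mu> > 0" and C_ex: "\<And>p. p \<ge> 1 \<Longrightarrow> \<exists>C>0. \<forall>f\<in>borel_measurable borel. \<forall>R s. 0 < s \<longrightarrow> s \<le> R \<longrightarrow>
     (\<integral>\<^sup>+x. \<integral>\<^sup>+y. indicator (nball R) x * indicator (nball R) y * osc f p x y \<partial>lborel \<partial>lborel)
     \<le> ennreal (C * R ^ hdim * R powr p / (s powr p * s ^ hdim)) * near_osc f p (\<mu> * R) s"
    using osc_ball_le_near_osc by blast
  show ?thesis
  proof (rule exI[of _ \<mu>], intro conjI \<mu> allI impI)
    fix p :: real assume p: "p \<ge> 1"
    obtain C where C: "C > 0" and single: "\<And>f R s. f \<in> borel_measurable borel \<Longrightarrow> 0 < s \<Longrightarrow> s \<le> R \<Longrightarrow>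
     (\<integral>\<^sup>+x. \<integral>\<^sup>+y. indicator (nball R) x * indicator (nball R) y * osc f p x y \<partial>lborel \<partial>lborel)
     \<le> ennreal (C * R ^ hdim * R powr p / (s powr p * s ^ hdim)) * near_osc f p (\<mu> * R) s"
      using C_ex[OF p] by blast
    show "\<exists>C>0. \<forall>f\<in>borel_measurable borel. \<forall>\<psi>\<in>borel_measurable borel. \<forall>R>0. \<forall>q. q + 1 \<le> hdim \<longrightarrow>
     antimono_on {0<..} \<psi> \<longrightarrow> (\<forall>r>0. \<psi> r \<ge> 0) \<longrightarrow>
     set_integrable lborel {0<..<R} (\<lambda>\<tau>. \<psi> \<tau> * \<tau> ^ q) \<longrightarrow> (LINT \<tau>:{0<..<R}|lborel. \<psi> \<tau> * \<tau> ^ q) > 0 \<longrightarrow>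
     (\<integral>\<^sup>+x. \<integral>\<^sup>+y. indicator (nball R) x * indicator (nball R) y * osc f p x y \<partial>lborel \<partial>lborel)
     \<le> ennreal (C * R ^ hdim * R powr p / (LINT \<tau>:{0<..<R}|lborel. \<psi> \<tau> * \<tau> ^ q)) *
       (\<integral>\<^sup>+x. \<integral>\<^sup>+y. indicator (nball (\<mu> * R)) x * indicator (nball (\<mu> * R)) y *
        (osc f p x y * ennreal (\<psi> (nrm (- x \<odot> y)) * nrm (- x \<odot> y) powr (real q + 1 - p - real hdim))) \<partial>lborel \<partial>lborel)"
    proof (intro exI[of _ C] conjI C ballI allI impI)
      fix f :: "real^'a \<Rightarrow> real" and \<psi> :: "real \<Rightarrow> real" and R :: real and q :: nat
      assume f: "f \<in> borel_measurable borel" and \<psi> [measurable]: "\<psi> \<in> borel_measurable borel" and R: "R > 0"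
        and q: "q + 1 \<le> hdim" and anti: "antimono_on {0<..} \<psi>" and nonneg': "\<forall>r>0. \<psi> r \<ge> 0"
        and int: "set_integrable lborel {0<..<R} (\<lambda>\<tau>. \<psi> \<tau> * \<tau> ^ q)"
        and pos: "(LINT \<tau>:{0<..<R}|lborel. \<psi> \<tau> * \<tau> ^ q) > 0"
      have nonneg: "\<psi> r \<ge> 0" if "r > 0" for r using nonneg' that by blast
      define L where "L = (LINT \<tau>:{0<..<R}|lborel. \<psi> \<tau> * \<tau> ^ q)"
      define X where "X = (\<integral>\<^sup>+x. \<integral>\<^sup>+y. indicator (nball R) x * indicator (nball R) y * osc f p x y \<partial>lborel \<partial>lborel)"
      \<comment> \<open>The powers of \<open>s\<close> in the weight and in the estimate at one
        scale combine to \<open>s powr (- c - 1)\<close>. From \<open>q + 1 \<le> hdim\<close> and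
        \<open>p \<ge> 1\<close> follows \<open>c \<ge> 1\<close>.\<close>
      define c where "c = p + real hdim - real q - 1"
      have c: "c \<ge> 1" using p q by (simp add: c_def)
      have "ennreal L = (\<integral>\<^sup>+s. ennreal (indicator {0<..<R} s * (\<psi> s * s ^ q)) \<partial>lborel)"
        unfolding L_def set_lebesgue_integral_def
        using nn_integral_eq_integral[OF int[unfolded set_integrable_def]] nonneg
        by (auto simp: indicator_def intro!: AE_I2)
      then have "ennreal L * X = (\<integral>\<^sup>+s. ennreal (indicator {0<..<R} s * (\<psi> s * s ^ q)) * X \<partial>lborel)"
        by (simp add: nn_integral_multc)
      also have "\<dots> \<le> (\<integral>\<^sup>+s. ennreal (C * R ^ hdim * R powr p) *
          (indicator {0<..<R} s * ennreal (\<psi> s * s powr (- c - 1)) * near_osc f p (\<mu> * R) s) \<partial>lborel)"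
      proof (intro nn_integral_mono)
        fix s
        show "ennreal (indicator {0<..<R} s * (\<psi> s * s ^ q)) * X \<le> ennreal (C * R ^ hdim * R powr p) *
          (indicator {0<..<R} s * ennreal (\<psi> s * s powr (- c - 1)) * near_osc f p (\<mu> * R) s)"
        proof (cases "s \<in> {0<..<R}")
          case True
          then have s: "s > 0" "s \<le> R" by auto
          have "ennreal (\<psi> s * s ^ q) * X \<le> ennreal (\<psi> s * s ^ q) *
            (ennreal (C * R ^ hdim * R powr p / (s powr p * s ^ hdim)) * near_osc f p (\<mu> * R) s)"
            unfolding X_def by (intro mult_left_mono single f s) auto
          also have "\<dots> = ennreal ((\<psi> s * s ^ q) * (C * R ^ hdim * R powr p / (s powr p * s ^ hdim))) * near_osc f p (\<mu> * R) s"
            using nonneg[OF s(1)] s C by (simp add: ennreal_mult[symmetric] mult.assoc[symmetric])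
          also have "(\<psi> s * s ^ q) * (C * R ^ hdim * R powr p / (s powr p * s ^ hdim))
            = (C * R ^ hdim * R powr p) * (\<psi> s * s powr (- c - 1))"
          proof -
            have "s powr (- c - 1) = s powr real q / (s powr p * s powr real hdim)"
              by (simp add: c_def powr_diff[symmetric] powr_add[symmetric] algebra_simps)
            also have "\<dots> = s ^ q / (s powr p * s ^ hdim)" using s by (simp add: powr_realpow)
            finally show ?thesis by simp
          qed
          also have "ennreal \<dots> * near_osc f p (\<mu> * R) s = ennreal (C * R ^ hdim * R powr p) *
             (ennreal (\<psi> s * s powr (- c - 1)) * near_osc f p (\<mu> * R) s)"
            using nonneg[OF s(1)] s C R by (simp add: ennreal_mult mult.assoc)
          finally show ?thesis using True by simp
        qed simp
      qed
      also have "\<dots> = ennreal (C * R ^ hdim * R powr p) *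
          (\<integral>\<^sup>+s. indicator {0<..<R} s * ennreal (\<psi> s * s powr (- c - 1)) * near_osc f p (\<mu> * R) s \<partial>lborel)"
      proof (rule nn_integral_cmult)
        note near_osc_measurable[OF f, measurable]
        show "(\<lambda>s. indicator {0<..<R} s * ennreal (\<psi> s * s powr (- c - 1)) * near_osc f p (\<mu> * R) s) \<in> borel_measurable lborel"
          by measurable
      qed
      also have "\<dots> \<le> ennreal (C * R ^ hdim * R powr p) *
        (\<integral>\<^sup>+x. \<integral>\<^sup>+y. indicator (nball (\<mu> * R)) x * indicator (nball (\<mu> * R)) y *
        (osc f p x y * ennreal (\<psi> (nrm (- x \<odot> y)) * nrm (- x \<odot> y) powr (- c))) \<partial>lborel \<partial>lborel)"
        by (intro mult_left_mono near_osc_weighted_integral_le f \<psi> anti nonneg c) auto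
      finally have *: "ennreal L * X \<le> ennreal (C * R ^ hdim * R powr p) *
        (\<integral>\<^sup>+x. \<integral>\<^sup>+y. indicator (nball (\<mu> * R)) x * indicator (nball (\<mu> * R)) y *
        (osc f p x y * ennreal (\<psi> (nrm (- x \<odot> y)) * nrm (- x \<odot> y) powr (- c))) \<partial>lborel \<partial>lborel)" .
      have "- c = real q + 1 - p - real hdim" by (simp add: c_def)
      with ennreal_le_divide_cmult[OF *] pos C R
      show "(\<integral>\<^sup>+x. \<integral>\<^sup>+y. indicator (nball R) x * indicator (nball R) y * osc f p x y \<partial>lborel \<partial>lborel)
     \<le> ennreal (C * R ^ hdim * R powr p / (LINT \<tau>:{0<..<R}|lborel. \<psi> \<tau> * \<tau> ^ q)) *
       (\<integral>\<^sup>+x. \<integral>\<^sup>+y. indicator (nball (\<mu> * R)) x * indicator (nball (\<mu> * R)) y *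
        (osc f p x y * ennreal (\<psi> (nrm (- x \<odot> y)) * nrm (- x \<odot> y) powr (real q + 1 - p - real hdim))) \<partial>lborel \<partial>lborel)"
        by (simp add: X_def L_def)
    qed
  qed
qed

end

section \<open>Deviation from the mean\<close>

text \<open>Jensen's inequality for the uniform probability on \<open>B\<close>, applied to
  \<open>f x - f y\<close> as a function of \<open>y\<close>. Integrability of \<open>f\<close>
  itself comes from the bound by \<open>1 + \<bar>f x\<bar> powr p\<close>.\<close>

lemma deviation_from_mean_le:
  fixes f :: "'b \<Rightarrow> real"
  assumes "sigma_finite_measure M" and f [measurable]: "f \<in> borel_measurable M" and B [measurable]: "B \<in> sets M"
    and V: "emeasure M B = ennreal V" "V > 0" and p: "p \<ge> 1"
    and int: "set_integrable M B (\<lambda>x. \<bar>f x\<bar> powr p)"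
  shows "(\<integral>\<^sup>+x. ennreal (\<bar>f x - (LINT x:B|M. f x) / V\<bar> powr p) * indicator B x \<partial>M)
    \<le> ennreal (1 / V) * (\<integral>\<^sup>+x. \<integral>\<^sup>+y. indicator B x * indicator B y * osc f p x y \<partial>M \<partial>M)"
proof -
  interpret sigma_finite_measure M by fact
  define P where "P = density M (\<lambda>x. ennreal (indicator B x / V))"
  have [measurable_cong, simp]: "sets P = sets M" by (simp add: P_def)
  have "emeasure P (space P) = (\<integral>\<^sup>+x. ennreal (1 / V) * indicator B x \<partial>M)"
    unfolding P_def by (subst emeasure_density) (auto intro!: nn_integral_cong simp: indicator_def)
  also have "\<dots> = 1" using V by (simp add: nn_integral_cmult ennreal_mult[symmetric])
  finally interpret P: prob_space P by (rule prob_spaceI)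
  have intP: "integrable P h \<longleftrightarrow> set_integrable M B h" if [measurable]: "h \<in> borel_measurable M" for h :: "'b \<Rightarrow> real"
  proof -
    have "integrable P h \<longleftrightarrow> integrable M (\<lambda>x. (indicator B x / V) *\<^sub>R h x)"
      unfolding P_def using V(2) by (intro integrable_density) auto
    also have "(\<lambda>x. (indicator B x / V) *\<^sub>R h x) = (\<lambda>x. (1 / V) * (indicator B x *\<^sub>R h x))" by auto
    also have "integrable M \<dots> \<longleftrightarrow> set_integrable M B h"
      unfolding set_integrable_def using V(2) by (intro integrable_mult_left_iff[THEN trans]) auto
    finally show ?thesis .
  qed
  have expP: "P.expectation h = (LINT x:B|M. h x) / V" if [measurable]: "h \<in> borel_measurable M" for h :: "'b \<Rightarrow> real"
  proof -
    have "P.expectation h = integral\<^sup>L M (\<lambda>x. (indicator B x / V) *\<^sub>R h x)"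
      unfolding P_def using V(2) by (intro integral_density) auto
    also have "(\<lambda>x. (indicator B x / V) *\<^sub>R h x) = (\<lambda>x. (indicator B x *\<^sub>R h x) / V)" by auto
    finally show ?thesis by (simp add: set_lebesgue_integral_def)
  qed
  have intp: "integrable P (\<lambda>x. \<bar>f x\<bar> powr p)" using int by (subst intP) auto
  have intf: "integrable P f"
  proof (rule Bochner_Integration.integrable_bound)
    show "integrable P (\<lambda>x. 1 + \<bar>f x\<bar> powr p)" using intp by auto
    show "AE x in P. norm (f x) \<le> norm (1 + \<bar>f x\<bar> powr p)"
    proof (intro AE_I2)
      fix x
      have "\<bar>f x\<bar> \<le> 1 + \<bar>f x\<bar> powr p"
      proof (cases "\<bar>f x\<bar> \<le> 1")
        case False
        then have "\<bar>f x\<bar> powr 1 \<le> \<bar>f x\<bar> powr p" using p by (intro powr_mono) auto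
        then show ?thesis using False by simp
      qed (simp add: add_increasing2)
      then show "norm (f x) \<le> norm (1 + \<bar>f x\<bar> powr p)" by simp
    qed
  qed (simp add: P_def)
  have key: "ennreal (\<bar>f x - (LINT x:B|M. f x) / V\<bar> powr p) \<le> ennreal (1 / V) * (\<integral>\<^sup>+y. indicator B y * osc f p x y \<partial>M)" for x
  proof -
    have intd: "integrable P (\<lambda>y. \<bar>f x - f y\<bar> powr p)"
    proof (rule Bochner_Integration.integrable_bound)
      show "integrable P (\<lambda>y. 2 powr (p - 1) * (\<bar>f x\<bar> powr p + \<bar>f y\<bar> powr p))" using intp by auto
      show "AE y in P. norm (\<bar>f x - f y\<bar> powr p) \<le> norm (2 powr (p - 1) * (\<bar>f x\<bar> powr p + \<bar>f y\<bar> powr p))"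
        using abs_add_powr_le[OF p, of "f x" "- f _"] by (intro AE_I2) simp
    qed (simp add: P_def)
    have "\<bar>P.expectation (\<lambda>y. f x - f y)\<bar> powr p \<le> P.expectation (\<lambda>y. \<bar>f x - f y\<bar> powr p)"
      using intf by (intro P.jensens_inequality[where I = UNIV] abs_powr_convex p intd) auto
    moreover have "P.expectation (\<lambda>y. f x - f y) = f x - (LINT x:B|M. f x) / V"
      using intf P.prob_space by (simp add: expP[OF f, symmetric])
    moreover have "ennreal (P.expectation (\<lambda>y. \<bar>f x - f y\<bar> powr p)) = (\<integral>\<^sup>+y. osc f p x y \<partial>P)"
      unfolding osc_def using intd by (intro nn_integral_eq_integral[symmetric]) auto
    moreover have "(\<integral>\<^sup>+y. osc f p x y \<partial>P) = (\<integral>\<^sup>+y. ennreal (indicator B y / V) * osc f p x y \<partial>M)"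
      unfolding P_def osc_def by (intro nn_integral_density) auto
    moreover have "\<dots> = (\<integral>\<^sup>+y. ennreal (1 / V) * (indicator B y * osc f p x y) \<partial>M)"
      by (intro nn_integral_cong) (auto simp: indicator_def)
    moreover have "\<dots> = ennreal (1 / V) * (\<integral>\<^sup>+y. indicator B y * osc f p x y \<partial>M)"
      unfolding osc_def by (intro nn_integral_cmult) auto
    ultimately show ?thesis by (metis ennreal_leI)
  qed
  have "(\<integral>\<^sup>+x. ennreal (\<bar>f x - (LINT x:B|M. f x) / V\<bar> powr p) * indicator B x \<partial>M)
     \<le> (\<integral>\<^sup>+x. \<integral>\<^sup>+y. ennreal (1 / V) * (indicator B x * indicator B y * osc f p x y) \<partial>M \<partial>M)"
  proof (intro nn_integral_mono)
    fix x
    show "ennreal (\<bar>f x - (LINT x:B|M. f x) / V\<bar> powr p) * indicator B x \<le>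
       (\<integral>\<^sup>+y. ennreal (1 / V) * (indicator B x * indicator B y * osc f p x y) \<partial>M)"
    proof (cases "x \<in> B")
      case True
      have "(\<integral>\<^sup>+y. ennreal (1 / V) * (indicator B y * osc f p x y) \<partial>M) = ennreal (1 / V) * (\<integral>\<^sup>+y. indicator B y * osc f p x y \<partial>M)"
        unfolding osc_def by (intro nn_integral_cmult) auto
      then show ?thesis using key[of x] True by simp
    qed simp
  qed
  also have "\<dots> = ennreal (1 / V) * (\<integral>\<^sup>+x. \<integral>\<^sup>+y. indicator B x * indicator B y * osc f p x y \<partial>M \<partial>M)"
    unfolding osc_def by (simp add: nn_integral_cmult)
  finally show ?thesis .
qed

text \<open>Nothing is known about a profile outside the positive axis. There it is replaced by 0;
  on the axis monotonicity makes it Borel.\<close>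

lemma antimono_on_extend_measurable:
  fixes \<psi> :: "real \<Rightarrow> real"
  assumes "antimono_on {0<..} \<psi>"
  shows "(\<lambda>r. if r > 0 then \<psi> r else 0) \<in> borel_measurable borel"
proof -
  have "mono_on {0<..} (\<lambda>r. - \<psi> r)"
    using assms by (auto simp: monotone_on_def)
  then have "(\<lambda>r. - \<psi> r) \<in> borel_measurable (restrict_space borel {0<..})"
    by (rule borel_measurable_mono_on_fnc)
  then have "(\<lambda>r. indicator {0<..} r *\<^sub>R (- \<psi> r)) \<in> borel_measurable borel"
    by (subst (asm) borel_measurable_restrict_space_iff) auto
  then have "(\<lambda>r. - (indicator {0<..} r *\<^sub>R (- \<psi> r))) \<in> borel_measurable borel"
    by measurable
  moreover have "(\<lambda>r. - (indicator {0<..} r *\<^sub>R (- \<psi> r))) = (\<lambda>r. if r > 0 then \<psi> r else 0)"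
    by (auto simp: indicator_def)
  ultimately show ?thesis by simp
qed

context carnot_norm
begin

section \<open>Reduction to Borel functions on balls centred at the identity\<close>

lemma gball_iff: "y \<in> gball mul iv nrm a r \<longleftrightarrow> nrm (- a \<odot> y) < r"
  by (simp add: gball_def iv_eq nrm_quotient_commute)

lemma gball_0: "gball mul iv nrm 0 r = nball r"
  by (auto simp: gball_iff nball_iff)

lemma gball_measurable [measurable]: "gball mul iv nrm a r \<in> sets borel"
proof -
  have "gball mul iv nrm a r = {y \<in> space borel. nrm (- a \<odot> y) < r}" by (auto simp: gball_iff)
  then show ?thesis by simp
qed

lemma indicator_gball: "indicator (gball mul iv nrm a r) (a \<odot> x) = indicator (nball r) x"
  by (simp add: indicator_def gball_iff nball_iff)

lemma emeasure_gball:
  assumes "r > 0"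
  shows "emeasure lborel (gball mul iv nrm a r) = ennreal (cB * r ^ hdim)"
proof -
  have "emeasure lborel (gball mul iv nrm a r) = (\<integral>\<^sup>+x. indicator (gball mul iv nrm a r) x \<partial>lborel)"
    by simp
  also have "\<dots> = (\<integral>\<^sup>+x. indicator (gball mul iv nrm a r) (a \<odot> x) \<partial>lborel)"
    by (rule nn_integral_mul_left[symmetric]) measurable
  also have "\<dots> = (\<integral>\<^sup>+x. indicator (nball r) x \<partial>lborel)"
    by (intro nn_integral_cong) (simp add: indicator_gball)
  also have "\<dots> = emeasure lborel (nball r)" by simp
  finally show ?thesis using emeasure_nball[OF assms] by simp
qed

lemma nn_integral_double_translate:
  assumes [measurable]: "case_prod F \<in> borel_measurable (borel \<Otimes>\<^sub>M borel)"
  shows "(\<integral>\<^sup>+x. \<integral>\<^sup>+y. F x y \<partial>lborel \<partial>lborel) = (\<integral>\<^sup>+x. \<integral>\<^sup>+y. F (a \<odot> x) (a \<odot> y) \<partial>lborel \<partial>lborel)"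
proof -
  have "(\<integral>\<^sup>+x. \<integral>\<^sup>+y. F x y \<partial>lborel \<partial>lborel) = (\<integral>\<^sup>+x. \<integral>\<^sup>+y. F (a \<odot> x) y \<partial>lborel \<partial>lborel)"
    by (rule nn_integral_mul_left[symmetric]) measurable
  also have "\<dots> = (\<integral>\<^sup>+x. \<integral>\<^sup>+y. F (a \<odot> x) (a \<odot> y) \<partial>lborel \<partial>lborel)"
    by (intro nn_integral_cong nn_integral_mul_left[symmetric]) measurable
  finally show ?thesis .
qed

text \<open>The Borel representative \<open>g\<close> is translated by the centre \<open>a\<close>,
  which moves the ball to the identity. The ball lies in a compact translate of a closed ball, so
  \<open>f\<close> has the required integrability on it.\<close>

lemma deviation_le_osc:
  assumes f: "f \<in> Lp_loc p" and g [measurable]: "g \<in> borel_measurable borel" and fg: "AE x in lborel. f x = g x"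
    and p: "p \<ge> 1" and R: "R > 0"
  shows "(\<integral>\<^sup>+ x\<in>gball mul iv nrm a R.
          ennreal (\<bar>f x - average (gball mul iv nrm a R) f\<bar> powr p) \<partial>lebesgue)
    \<le> ennreal (1 / (cB * R ^ hdim)) * (\<integral>\<^sup>+x. \<integral>\<^sup>+y. indicator (nball R) x * indicator (nball R) y *
        osc (\<lambda>x. g (a \<odot> x)) p x y \<partial>lborel \<partial>lborel)"
proof -
  let ?B = "gball mul iv nrm a R"
  have V: "emeasure lborel ?B = ennreal (cB * R ^ hdim)" "cB * R ^ hdim > 0"
    using emeasure_gball[OF R] cB_pos R by auto
  have f_meas: "f \<in> borel_measurable lebesgue" using f by (simp add: Lp_loc_def)
  have fg': "AE x in lebesgue. f x = g x" using fg by (rule AE_completion)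
  have g': "g \<in> borel_measurable lebesgue" using g by (simp add: measurable_completion)
  have "measure lebesgue ?B = cB * R ^ hdim" using V by (simp add: measure_def)
  moreover have "(LINT x:?B|lebesgue. f x) = (LINT x:?B|lborel. g x)"
  proof -
    have "(LINT x:?B|lebesgue. f x) = (LINT x:?B|lebesgue. g x)"
      unfolding set_lebesgue_integral_def
      by (intro integral_cong_AE borel_measurable_scaleR borel_measurable_indicator f_meas g')
        (use fg' in auto)
    then show ?thesis unfolding set_lebesgue_integral_def by (simp add: integral_completion)
  qed
  ultimately have avg: "average ?B f = (LINT x:?B|lborel. g x) / (cB * R ^ hdim)" by (simp add: average_def)
  have int: "set_integrable lborel ?B (\<lambda>x. \<bar>g x\<bar> powr p)"
  proof -
    let ?C = "(\<lambda>x. a \<odot> x) ` {x. nrm x \<le> R}"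
    have "compact ?C" by (intro compact_continuous_image continuous_intros compact_nrm_le)
    then have intC: "set_integrable lebesgue ?C (\<lambda>x. \<bar>f x\<bar> powr p)" using f by (simp add: Lp_loc_def)
    have BC: "?B \<subseteq> ?C"
    proof
      fix y assume "y \<in> ?B"
      then have "y = a \<odot> (- a \<odot> y)" "nrm (- a \<odot> y) \<le> R" by (simp_all add: gball_iff)
      then show "y \<in> ?C" by blast
    qed
    have "set_integrable lebesgue ?B (\<lambda>x. \<bar>f x\<bar> powr p)"
      by (rule set_integrable_subset[OF intC _ BC]) simp
    then have "set_integrable lebesgue ?B (\<lambda>x. \<bar>g x\<bar> powr p)"
      unfolding set_integrable_def
      by (rule integrable_cong_AE_imp) (use fg' in \<open>auto intro!: measurable_completion\<close>)
    then show ?thesis unfolding set_integrable_def by (subst (asm) integrable_completion) auto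
  qed
  have "(\<integral>\<^sup>+ x\<in>?B. ennreal (\<bar>f x - average ?B f\<bar> powr p) \<partial>lebesgue)
     = (\<integral>\<^sup>+ x\<in>?B. ennreal (\<bar>f x - average ?B f\<bar> powr p) \<partial>lborel)"
    by (rule nn_integral_completion)
  also have "\<dots> = (\<integral>\<^sup>+ x\<in>?B. ennreal (\<bar>g x - average ?B f\<bar> powr p) \<partial>lborel)"
    using fg by (intro nn_integral_cong_AE) auto
  also have "\<dots> \<le> ennreal (1 / (cB * R ^ hdim)) *
      (\<integral>\<^sup>+x. \<integral>\<^sup>+y. indicator ?B x * indicator ?B y * osc g p x y \<partial>lborel \<partial>lborel)"
    unfolding avg by (intro deviation_from_mean_le V p int) (auto intro: sigma_finite_lborel)
  also have "(\<integral>\<^sup>+x. \<integral>\<^sup>+y. indicator ?B x * indicator ?B y * osc g p x y \<partial>lborel \<partial>lborel)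
     = (\<integral>\<^sup>+x. \<integral>\<^sup>+y. indicator ?B (a \<odot> x) * indicator ?B (a \<odot> y) * osc g p (a \<odot> x) (a \<odot> y) \<partial>lborel \<partial>lborel)"
    by (rule nn_integral_double_translate) measurable
  also have "\<dots> = (\<integral>\<^sup>+x. \<integral>\<^sup>+y. indicator (nball R) x * indicator (nball R) y *
        osc (\<lambda>x. g (a \<odot> x)) p x y \<partial>lborel \<partial>lborel)"
    by (simp add: indicator_gball osc_def)
  finally show ?thesis .
qed

text \<open>The two profiles may differ at 0, but this affects only the diagonal, where the
  oscillation is zero.\<close>

lemma kernel_integral_eq:
  assumes g [measurable]: "g \<in> borel_measurable borel" and fg: "AE x in lborel. f x = g x"
    and w' [measurable]: "w' \<in> borel_measurable borel" and w: "\<And>r. r > 0 \<Longrightarrow> w r = w' r"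
  shows "(\<integral>\<^sup>+ y\<in>gball mul iv nrm a S. (\<integral>\<^sup>+ x\<in>gball mul iv nrm a S.
      ennreal (\<bar>f y - f x\<bar> powr p * w (nrm (mul (iv y) x))) \<partial>lebesgue) \<partial>lebesgue)
    = (\<integral>\<^sup>+x. \<integral>\<^sup>+y. indicator (nball S) x * indicator (nball S) y *
        (osc (\<lambda>x. g (a \<odot> x)) p x y * ennreal (w' (nrm (- x \<odot> y)))) \<partial>lborel \<partial>lborel)"
proof -
  let ?B = "gball mul iv nrm a S"
  have "(\<integral>\<^sup>+ y\<in>?B. (\<integral>\<^sup>+ x\<in>?B. ennreal (\<bar>f y - f x\<bar> powr p * w (nrm (mul (iv y) x))) \<partial>lebesgue) \<partial>lebesgue)
     = (\<integral>\<^sup>+ y\<in>?B. (\<integral>\<^sup>+ x\<in>?B. ennreal (\<bar>f y - f x\<bar> powr p * w (nrm (mul (iv y) x))) \<partial>lborel) \<partial>lborel)"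
    by (simp only: nn_integral_completion)
  also have "\<dots> = (\<integral>\<^sup>+ y\<in>?B. (\<integral>\<^sup>+ x\<in>?B. ennreal (\<bar>g y - g x\<bar> powr p * w (nrm (mul (iv y) x))) \<partial>lborel) \<partial>lborel)"
  proof (rule nn_integral_cong_AE)
    show "AE y in lborel. (\<integral>\<^sup>+ x\<in>?B. ennreal (\<bar>f y - f x\<bar> powr p * w (nrm (mul (iv y) x))) \<partial>lborel) * indicator ?B y
       = (\<integral>\<^sup>+ x\<in>?B. ennreal (\<bar>g y - g x\<bar> powr p * w (nrm (mul (iv y) x))) \<partial>lborel) * indicator ?B y"
      using fg
    proof eventually_elim
      case (elim y)
      have "(\<integral>\<^sup>+ x\<in>?B. ennreal (\<bar>f y - f x\<bar> powr p * w (nrm (mul (iv y) x))) \<partial>lborel)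
         = (\<integral>\<^sup>+ x\<in>?B. ennreal (\<bar>g y - g x\<bar> powr p * w (nrm (mul (iv y) x))) \<partial>lborel)"
        using fg elim by (intro nn_integral_cong_AE) auto
      then show ?case by simp
    qed
  qed
  also have "\<dots> = (\<integral>\<^sup>+x. \<integral>\<^sup>+y. indicator ?B x * indicator ?B y *
        (osc g p x y * ennreal (w' (nrm (- x \<odot> y)))) \<partial>lborel \<partial>lborel)"
  proof (intro nn_integral_cong)
    fix y
    have *: "ennreal (\<bar>g y - g x\<bar> powr p * w (nrm (mul (iv y) x))) = osc g p y x * ennreal (w' (nrm (- y \<odot> x)))" for x
    proof (cases "nrm (- y \<odot> x) = 0")
      case True
      then have "- y \<odot> x = 0" by simp
      then have "y \<odot> (- y \<odot> x) = y" by simp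
      then have "y = x" by simp
      then show ?thesis by simp
    next
      case False
      then have "nrm (- y \<odot> x) > 0" using nrm_nonneg[of "- y \<odot> x"] by linarith
      then show ?thesis by (simp add: osc_def iv_eq w ennreal_mult')
    qed
    show "(\<integral>\<^sup>+ x\<in>?B. ennreal (\<bar>g y - g x\<bar> powr p * w (nrm (mul (iv y) x))) \<partial>lborel) * indicator ?B y
      = (\<integral>\<^sup>+x. indicator ?B y * indicator ?B x * (osc g p y x * ennreal (w' (nrm (- y \<odot> x)))) \<partial>lborel)"
      unfolding * by (cases "y \<in> ?B") (simp_all add: mult.commute)
  qed
  also have "\<dots> = (\<integral>\<^sup>+x. \<integral>\<^sup>+y. indicator ?B (a \<odot> x) * indicator ?B (a \<odot> y) *
        (osc g p (a \<odot> x) (a \<odot> y) * ennreal (w' (nrm (- (a \<odot> x) \<odot> (a \<odot> y))))) \<partial>lborel \<partial>lborel)"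
    by (rule nn_integral_double_translate) measurable
  finally show ?thesis
    by (simp add: indicator_gball osc_def)
qed

theorem nonlocal_poincare:
  obtains \<mu> Cp where "\<mu> > 0" and "\<forall>p\<ge>1. Cp p > 0"
    and "\<forall>p\<ge>1. \<forall>R>0. \<forall>a. \<forall>f\<in>Lp_loc p. \<forall>\<psi> q. q + 1 \<le> hdim \<longrightarrow>
     antimono_on {0<..} \<psi> \<longrightarrow> (\<forall>r>0. \<psi> r \<ge> 0) \<longrightarrow> (LINT \<tau>:{0<..<R}|lborel. \<psi> \<tau> * \<tau> ^ q) > 0 \<longrightarrow>
     (\<integral>\<^sup>+ x\<in>gball mul iv nrm a R.
          ennreal (\<bar>f x - average (gball mul iv nrm a R) f\<bar> powr p) \<partial>lebesgue)
     \<le> ennreal (Cp p * R powr p / (LINT \<tau>:{0<..<R}|lborel. \<psi> \<tau> * \<tau> ^ q)) *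
       (\<integral>\<^sup>+ y\<in>gball mul iv nrm a (\<mu> * R). (\<integral>\<^sup>+ x\<in>gball mul iv nrm a (\<mu> * R).
          ennreal (\<bar>f y - f x\<bar> powr p *
            (\<psi> (nrm (mul (iv y) x)) * nrm (mul (iv y) x) powr (real q + 1 - p - real hdim))) \<partial>lebesgue) \<partial>lebesgue)"
proof -
  define bound where "bound \<mu> p C \<longleftrightarrow> (\<forall>f\<in>borel_measurable borel. \<forall>\<psi>\<in>borel_measurable borel. \<forall>R>0. \<forall>q. q + 1 \<le> hdim \<longrightarrow>
     antimono_on {0<..} \<psi> \<longrightarrow> (\<forall>r>0. \<psi> r \<ge> 0) \<longrightarrow>
     set_integrable lborel {0<..<R} (\<lambda>\<tau>. \<psi> \<tau> * \<tau> ^ q) \<longrightarrow> (LINT \<tau>:{0<..<R}|lborel. \<psi> \<tau> * \<tau> ^ q) > 0 \<longrightarrow>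
     (\<integral>\<^sup>+x. \<integral>\<^sup>+y. indicator (nball R) x * indicator (nball R) y * osc f p x y \<partial>lborel \<partial>lborel)
     \<le> ennreal (C * R ^ hdim * R powr p / (LINT \<tau>:{0<..<R}|lborel. \<psi> \<tau> * \<tau> ^ q)) *
       (\<integral>\<^sup>+x. \<integral>\<^sup>+y. indicator (nball (\<mu> * R)) x * indicator (nball (\<mu> * R)) y *
        (osc f p x y * ennreal (\<psi> (nrm (- x \<odot> y)) * nrm (- x \<odot> y) powr (real q + 1 - p - real hdim))) \<partial>lborel \<partial>lborel))"
    for \<mu> p C :: real
  have "\<exists>\<mu>>0. \<forall>p\<ge>1. \<exists>C>0. bound \<mu> p C"
    unfolding bound_def by (rule osc_ball_le_weighted)
  then obtain \<mu> C where \<mu>: "\<mu> > 0" and C: "\<And>p. p \<ge> 1 \<Longrightarrow> C p > 0" and bound: "\<And>p. p \<ge> 1 \<Longrightarrow> bound \<mu> p (C p)"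
    by metis
  show ?thesis
  \<comment> \<open>The mean contributes \<open>1 / (cB * R ^ hdim)\<close>: the power of
    \<open>R\<close> cancels, and \<open>cB\<close> enters the constant.\<close>
  proof (rule that[of \<mu> "\<lambda>p. C p / cB", OF \<mu>], goal_cases)
    case 1
    then show ?case using C cB_pos by simp
  next
    case 2
    show ?case
    proof (intro allI impI ballI)
    fix p R :: real and a :: "real^'a" and f :: "real^'a \<Rightarrow> real" and \<psi> :: "real \<Rightarrow> real" and q :: nat
    assume p: "p \<ge> 1" and R: "R > 0" and f: "f \<in> Lp_loc p" and q: "q + 1 \<le> hdim"
      and anti: "antimono_on {0<..} \<psi>" and nonneg: "\<forall>r>0. \<psi> r \<ge> 0"
      and pos: "(LINT \<tau>:{0<..<R}|lborel. \<psi> \<tau> * \<tau> ^ q) > 0"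
    define \<psi>' where "\<psi>' r = (if r > 0 then \<psi> r else 0)" for r
    have \<psi>' [measurable]: "\<psi>' \<in> borel_measurable borel"
      unfolding \<psi>'_def[abs_def] by (rule antimono_on_extend_measurable[OF anti])
    define L where "L = (LINT \<tau>:{0<..<R}|lborel. \<psi> \<tau> * \<tau> ^ q)"
    have ind: "(\<lambda>\<tau>. indicator {0<..<R} \<tau> *\<^sub>R (\<psi>' \<tau> * \<tau> ^ q)) = (\<lambda>\<tau>. indicator {0<..<R} \<tau> *\<^sub>R (\<psi> \<tau> * \<tau> ^ q))"
      by (auto simp: \<psi>'_def indicator_def)
    then have L': "(LINT \<tau>:{0<..<R}|lborel. \<psi>' \<tau> * \<tau> ^ q) = L"
      by (simp only: L_def set_lebesgue_integral_def)
    have L: "L > 0" using pos by (simp add: L_def)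
    \<comment> \<open>The Bochner integral of a function that is not integrable is 0, so a positive
      value entails integrability.\<close>
    have int: "set_integrable lborel {0<..<R} (\<lambda>\<tau>. \<psi>' \<tau> * \<tau> ^ q)"
    proof (rule ccontr)
      assume "\<not> set_integrable lborel {0<..<R} (\<lambda>\<tau>. \<psi>' \<tau> * \<tau> ^ q)"
      then have "(LINT \<tau>:{0<..<R}|lborel. \<psi>' \<tau> * \<tau> ^ q) = 0"
        unfolding set_integrable_def set_lebesgue_integral_def by (rule not_integrable_integral_eq)
      with L L' show False by simp
    qed
    have "f \<in> borel_measurable (completion lborel)" using f by (simp add: Lp_loc_def)
    then obtain g where g: "g \<in> borel_measurable borel" and fg: "AE x in lborel. f x = g x"
      using completion_ex_borel_measurable_real[of f lborel] by auto
    define e where "e = real q + 1 - p - real hdim"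
    define G where "G x = g (a \<odot> x)" for x
    have G: "G \<in> borel_measurable borel" unfolding G_def[abs_def] using g by measurable
    define X where "X = (\<integral>\<^sup>+x. \<integral>\<^sup>+y. indicator (nball R) x * indicator (nball R) y * osc G p x y \<partial>lborel \<partial>lborel)"
    define I where "I = (\<integral>\<^sup>+x. \<integral>\<^sup>+y. indicator (nball (\<mu> * R)) x * indicator (nball (\<mu> * R)) y *
        (osc G p x y * ennreal (\<psi>' (nrm (- x \<odot> y)) * nrm (- x \<odot> y) powr e)) \<partial>lborel \<partial>lborel)"
    have 1: "(\<integral>\<^sup>+ x\<in>gball mul iv nrm a R.
          ennreal (\<bar>f x - average (gball mul iv nrm a R) f\<bar> powr p) \<partial>lebesgue) \<le> ennreal (1 / (cB * R ^ hdim)) * X"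
      unfolding X_def G_def by (rule deviation_le_osc[OF f g fg p R])
    have anti': "antimono_on {0<..} \<psi>'" using anti by (auto simp: monotone_on_def \<psi>'_def)
    have 2: "X \<le> ennreal (C p * R ^ hdim * R powr p / L) * I"
      unfolding X_def I_def L'[symmetric] e_def
      by (rule bound[OF p, unfolded bound_def, rule_format, OF G \<psi>' R q anti' _ int]) (use nonneg L L' in \<open>auto simp: \<psi>'_def\<close>)
    have 3: "(\<integral>\<^sup>+ y\<in>gball mul iv nrm a (\<mu> * R). (\<integral>\<^sup>+ x\<in>gball mul iv nrm a (\<mu> * R).
          ennreal (\<bar>f y - f x\<bar> powr p *
            (\<psi> (nrm (mul (iv y) x)) * nrm (mul (iv y) x) powr e)) \<partial>lebesgue) \<partial>lebesgue) = I"
      unfolding I_def G_def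
    proof (rule kernel_integral_eq[where w = "\<lambda>r. \<psi> r * r powr e", OF g fg])
      show "(\<lambda>r. \<psi>' r * r powr e) \<in> borel_measurable borel" by measurable
    qed (simp add: \<psi>'_def)
    have "(\<integral>\<^sup>+ x\<in>gball mul iv nrm a R.
          ennreal (\<bar>f x - average (gball mul iv nrm a R) f\<bar> powr p) \<partial>lebesgue)
       \<le> ennreal (1 / (cB * R ^ hdim)) * (ennreal (C p * R ^ hdim * R powr p / L) * I)"
      by (rule order_trans[OF 1 mult_left_mono[OF 2]]) simp
    also have "\<dots> = ennreal (1 / (cB * R ^ hdim) * (C p * R ^ hdim * R powr p / L)) * I"
      using cB_pos R C[OF p] L by (simp add: mult.assoc[symmetric] ennreal_mult[symmetric])
    also have "1 / (cB * R ^ hdim) * (C p * R ^ hdim * R powr p / L) = C p / cB * R powr p / L"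
      using R by simp
    finally show "(\<integral>\<^sup>+ x\<in>gball mul iv nrm a R.
          ennreal (\<bar>f x - average (gball mul iv nrm a R) f\<bar> powr p) \<partial>lebesgue)
     \<le> ennreal (C p / cB * R powr p / (LINT \<tau>:{0<..<R}|lborel. \<psi> \<tau> * \<tau> ^ q)) *
       (\<integral>\<^sup>+ y\<in>gball mul iv nrm a (\<mu> * R). (\<integral>\<^sup>+ x\<in>gball mul iv nrm a (\<mu> * R).
          ennreal (\<bar>f y - f x\<bar> powr p *
            (\<psi> (nrm (mul (iv y) x)) * nrm (mul (iv y) x) powr (real q + 1 - p - real hdim))) \<partial>lebesgue) \<partial>lebesgue)"
      unfolding 3[symmetric, unfolded e_def] L_def .
    qed
  qed
qed

section \<open>Polar coordinates\<close>

text \<open>Both measures give the half-line below \<open>r > 0\<close> the volume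
  \<open>cB * r ^ hdim\<close> of a ball, whose derivative in \<open>r\<close> is the density.
  Half-lines are stable under intersection and generate the Borel sets.\<close>

lemma distr_nrm:
  "distr lborel borel nrm = density lborel (\<lambda>r. indicator {0<..} r * ennreal (real hdim * cB * r ^ (hdim - 1)))"
    (is "?M = ?N")
proof (rule measure_eqI_generator_eq)
  let ?E = "range (lessThan :: real \<Rightarrow> real set)"
  show "Int_stable ?E"
  proof (rule Int_stableI, safe)
    fix a b :: real
    have "{..<a} \<inter> {..<b} = {..<min a b}" by auto
    then show "{..<a} \<inter> {..<b} \<in> ?E" by (metis rangeI)
  qed
  show "?E \<subseteq> Pow UNIV" by simp
  show "sets ?M = sigma_sets UNIV ?E" "sets ?N = sigma_sets UNIV ?E"
    by (simp_all add: borel_Iio)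
  have M: "emeasure ?M {..<r} = (if r > 0 then ennreal (cB * r ^ hdim) else 0)" for r
  proof -
    have "emeasure ?M {..<r} = emeasure lborel (nball r)"
      by (subst emeasure_distr) (auto simp: nball_def vimage_def)
    moreover have "nball r = {}" if "r \<le> 0" using that by (auto simp: nball_def not_less intro: order_trans[OF _ nrm_nonneg])
    ultimately show ?thesis by (auto simp: emeasure_nball)
  qed
  have N: "emeasure ?N {..<r} = (if r > 0 then ennreal (cB * r ^ hdim) else 0)" for r
  proof -
    have "emeasure ?N {..<r} = (\<integral>\<^sup>+s. ennreal (real hdim * cB * s ^ (hdim - 1)) * indicator {0<..<r} s \<partial>lborel)"
      by (subst emeasure_density) (auto intro!: nn_integral_cong simp: indicator_def)
    also have "\<dots> = (\<integral>\<^sup>+s. ennreal (real hdim * cB * s ^ (hdim - 1)) * indicator {0..r} s \<partial>lborel)"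
    proof (rule nn_integral_cong_AE)
      show "AE s in lborel. ennreal (real hdim * cB * s ^ (hdim - 1)) * indicator {0<..<r} s =
         ennreal (real hdim * cB * s ^ (hdim - 1)) * indicator {0..r} s"
        using AE_lborel_singleton[of 0] AE_lborel_singleton[of r] by eventually_elim (auto simp: indicator_def)
    qed
    also have "\<dots> = (if r > 0 then ennreal (cB * r ^ hdim) else 0)"
    proof (cases "r > 0")
      case True
      have "(\<integral>\<^sup>+s. ennreal (real hdim * cB * s ^ (hdim - 1)) * indicator {0..r} s \<partial>lborel) = ennreal (cB * r ^ hdim - cB * 0 ^ hdim)"
        using True cB_pos
        by (intro nn_integral_FTC_Icc) (auto intro!: derivative_eq_intros simp: mult_ac)
      then show ?thesis using True hom_dim_pos by (simp add: power_0_left)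
    next
      case False
      have "(\<integral>\<^sup>+s. ennreal (real hdim * cB * s ^ (hdim - 1)) * indicator {0..r} s \<partial>lborel) = (\<integral>\<^sup>+s. 0 \<partial>(lborel :: real measure))"
      proof (rule nn_integral_cong_AE)
        show "AE s in lborel. ennreal (real hdim * cB * s ^ (hdim - 1)) * indicator {0..r} s = 0"
          using AE_lborel_singleton[of 0] by eventually_elim (use False in \<open>auto simp: indicator_def\<close>)
      qed
      then show ?thesis using False by simp
    qed
    finally show ?thesis .
  qed
  show "emeasure ?M X = emeasure ?N X" if "X \<in> ?E" for X using that M N by auto
  show "range (\<lambda>i::nat. {..<real i}) \<subseteq> ?E" by auto
  show "(\<Union>i::nat. {..<real i}) = UNIV" by (auto simp: reals_Archimedean2)
  show "emeasure ?M {..<real i} \<noteq> \<infinity>" for i by (simp add: M)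
qed

text \<open>Converts the concentration condition on the group into one on the normalized profile:
  the density of \<open>distr_nrm\<close> cancels against the factor in \<open>\<rho>\<close>. The
  monotone \<open>\<rho>\<close> also supplies the measurability.\<close>

lemma polar_tail:
  fixes \<sigma> \<rho> :: "real \<Rightarrow> real"
  assumes nonneg: "\<And>r. r > 0 \<Longrightarrow> \<sigma> r \<ge> 0" and \<rho>: "\<And>r. r > 0 \<Longrightarrow> \<rho> r = real hdim * cB * \<sigma> r"
    and anti: "antimono_on {0<..} \<rho>" and \<delta>: "\<delta> > 0"
  shows "(LINT x:(- gball mul iv nrm 0 \<delta>)|lebesgue. \<sigma> (nrm x)) = (LINT r:{\<delta>..}|lborel. \<rho> r * r ^ (hdim - 1))"
proof -
  have Qc: "real hdim * cB > 0" using hom_dim_pos cB_pos by simp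
  define \<rho>' where "\<rho>' r = (if r > 0 then \<rho> r else 0)" for r
  have [measurable]: "\<rho>' \<in> borel_measurable borel"
    unfolding \<rho>'_def[abs_def] by (rule antimono_on_extend_measurable[OF anti])
  define h where "h r = indicator {\<delta>..} r * (\<rho>' r / (real hdim * cB))" for r
  have h [measurable]: "h \<in> borel_measurable borel" unfolding h_def[abs_def] by measurable
  have h_nonneg: "h r \<ge> 0" for r
    using \<delta> nonneg[of r] Qc by (auto simp: h_def \<rho>'_def \<rho> indicator_def)
  have "indicator (- gball mul iv nrm 0 \<delta>) x *\<^sub>R \<sigma> (nrm x) = h (nrm x)" for x
    using \<delta> Qc by (auto simp: h_def \<rho>'_def \<rho> indicator_def gball_0 nball_iff)
  then have "(LINT x:(- gball mul iv nrm 0 \<delta>)|lebesgue. \<sigma> (nrm x)) = (LINT x|lebesgue. h (nrm x))"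
    by (simp add: set_lebesgue_integral_def)
  also have "\<dots> = (LINT x|lborel. h (nrm x))" by (rule integral_completion) measurable
  also have "\<dots> = (LINT r|distr lborel borel nrm. h r)" by (subst integral_distr) auto
  also have "\<dots> = (LINT r|lborel. (indicator {0<..} r * (real hdim * cB * r ^ (hdim - 1))) *\<^sub>R h r)"
  proof -
    have "density lborel (\<lambda>r. indicator {0<..} r * ennreal (real hdim * cB * r ^ (hdim - 1))) =
       density lborel (\<lambda>r. ennreal (indicator {0<..} r * (real hdim * cB * r ^ (hdim - 1))))"
      by (intro density_cong) (auto simp: indicator_def)
    then show ?thesis unfolding distr_nrm
      using cB_pos by (subst integral_density[symmetric]) (auto simp: indicator_def)
  qed
  also have "\<dots> = (LINT r:{\<delta>..}|lborel. \<rho> r * r ^ (hdim - 1))"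
    unfolding set_lebesgue_integral_def
    using \<delta> Qc by (intro Bochner_Integration.integral_cong) (auto simp: h_def \<rho>'_def indicator_def)
  finally show ?thesis .
qed

end

section \<open>The inequality for general kernels and for mollifiers\<close>

theorem corollary4p6:
  fixes mul :: "real ^ 'n::finite \<Rightarrow> real ^ 'n \<Rightarrow> real ^ 'n"
    and iv :: "real ^ 'n \<Rightarrow> real ^ 'n"
    and k :: nat
    and wt :: "'n \<Rightarrow> nat"
    and nrm :: "real ^ 'n \<Rightarrow> real"
    and Q :: nat
    and c\<^sub>B :: real
  assumes "carnot_group mul iv k wt"
    and "homogeneous_norm iv wt nrm"
    and "Q = hom_dim k wt"
    and "c\<^sub>B = measure lebesgue (gball mul iv nrm 0 1)"
  shows "\<exists>\<beta>>0. \<exists>\<mu>>0. \<exists>Cp :: real \<Rightarrow> real. (\<forall>p\<ge>1. Cp p > 0) \<and>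
    (\<forall>p\<ge>1. \<forall>R>0. \<forall>a. \<forall>f\<in>Lp_loc p. \<forall>\<phi> :: real \<Rightarrow> real.
       (\<forall>r>0. \<phi> r \<ge> 0) \<longrightarrow> antimono_on {0<..} \<phi> \<longrightarrow> (\<exists>r>0. \<phi> r \<noteq> 0) \<longrightarrow>
       (\<forall>b>0. set_integrable lborel {0<..<b} \<phi>) \<longrightarrow>
       (\<integral>\<^sup>+ x\<in>gball mul iv nrm a R.
          ennreal (\<bar>f x - average (gball mul iv nrm a R) f\<bar> powr p) \<partial>lebesgue)
       \<le> ennreal (Cp p * R powr p) *
         (\<integral>\<^sup>+ y\<in>gball mul iv nrm a (\<mu> * R). (\<integral>\<^sup>+ x\<in>gball mul iv nrm a (\<mu> * R).
            ennreal (\<bar>f y - f x\<bar> powr p / nrm (mul (iv y) x) powr (p + real Q - 1) *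
              (\<phi> (nrm (mul (iv y) x)) / (LINT \<tau>:{0<..<\<beta> * R}|lborel. \<phi> \<tau>)))
            \<partial>lebesgue) \<partial>lebesgue)) \<and>
    (\<forall>\<sigma> \<rho> :: real \<Rightarrow> real \<Rightarrow> real.
       radial_mollifiers mul iv nrm \<sigma> \<longrightarrow>
       (\<forall>n>0. \<forall>r>0. \<rho> n r = real Q * c\<^sub>B * \<sigma> n r) \<longrightarrow>
       (\<forall>n>0. antimono_on {0<..} (\<rho> n)) \<longrightarrow>
       (\<forall>n>0. (LINT r:{0<..}|lborel. \<rho> n r * r ^ (Q - 1)) = 1) \<longrightarrow>
       (\<forall>p\<ge>1. \<forall>R>0. \<forall>a. \<forall>C>Cp p.
          (\<exists>n\<^sub>0\<ge>0. \<forall>n>n\<^sub>0. (LINT \<tau>:{0<..<\<beta> * R}|lborel. \<rho> n \<tau> * \<tau> ^ (Q - 1)) > Cp p / C) \<and>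
          (\<forall>n\<^sub>0\<ge>0.
             (\<forall>n>n\<^sub>0. (LINT \<tau>:{0<..<\<beta> * R}|lborel. \<rho> n \<tau> * \<tau> ^ (Q - 1)) > Cp p / C) \<longrightarrow>
             (\<forall>n>n\<^sub>0. \<forall>f\<in>Lp_loc p.
                (\<integral>\<^sup>+ x\<in>gball mul iv nrm a R.
                   ennreal (\<bar>f x - average (gball mul iv nrm a R) f\<bar> powr p) \<partial>lebesgue)
                \<le> ennreal (C * R powr p) *
                  (\<integral>\<^sup>+ x\<in>gball mul iv nrm a (\<mu> * R). (\<integral>\<^sup>+ y\<in>gball mul iv nrm a (\<mu> * R).
                     ennreal (\<bar>f x - f y\<bar> powr p / nrm (mul (iv y) x) powr p *
                       \<rho> n (nrm (mul (iv y) x)))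
                     \<partial>lebesgue) \<partial>lebesgue)))))"
proof -
  interpret carnot_norm mul iv k wt nrm
    using assms(1,2) by (intro carnot_norm.intro carnot_norm_axioms.intro)
  have cB: "c\<^sub>B = cB"
    unfolding assms(4) cB_def gball_0 by simp
  have Q1: "Q \<ge> 1" using hom_dim_pos assms(3) by simp
  obtain \<mu> Cp where \<mu>: "\<mu> > 0" and Cp: "\<forall>p\<ge>1. Cp p > 0"
    and poincare: "\<forall>p\<ge>1. \<forall>R>0. \<forall>a. \<forall>f\<in>Lp_loc p. \<forall>\<psi> q. q + 1 \<le> Q \<longrightarrow>
     antimono_on {0<..} \<psi> \<longrightarrow> (\<forall>r>0. \<psi> r \<ge> 0) \<longrightarrow> (LINT \<tau>:{0<..<R}|lborel. \<psi> \<tau> * \<tau> ^ q) > 0 \<longrightarrow>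
     (\<integral>\<^sup>+ x\<in>gball mul iv nrm a R.
          ennreal (\<bar>f x - average (gball mul iv nrm a R) f\<bar> powr p) \<partial>lebesgue)
     \<le> ennreal (Cp p * R powr p / (LINT \<tau>:{0<..<R}|lborel. \<psi> \<tau> * \<tau> ^ q)) *
       (\<integral>\<^sup>+ y\<in>gball mul iv nrm a (\<mu> * R). (\<integral>\<^sup>+ x\<in>gball mul iv nrm a (\<mu> * R).
          ennreal (\<bar>f y - f x\<bar> powr p *
            (\<psi> (nrm (mul (iv y) x)) * nrm (mul (iv y) x) powr (real q + 1 - p - real Q))) \<partial>lebesgue) \<partial>lebesgue)"
    by (rule nonlocal_poincare[folded assms(3)])
  show ?thesis
  proof (rule exI[of _ 1], rule conjI[OF zero_less_one], rule exI[of _ \<mu>], rule conjI[OF \<mu>],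
      rule exI[of _ Cp], unfold mult_1, intro conjI)
    show "\<forall>p\<ge>1. Cp p > 0" by (rule Cp)
  next
    show "\<forall>p\<ge>1. \<forall>R>0. \<forall>a. \<forall>f\<in>Lp_loc p. \<forall>\<phi> :: real \<Rightarrow> real.
       (\<forall>r>0. \<phi> r \<ge> 0) \<longrightarrow> antimono_on {0<..} \<phi> \<longrightarrow> (\<exists>r>0. \<phi> r \<noteq> 0) \<longrightarrow>
       (\<forall>b>0. set_integrable lborel {0<..<b} \<phi>) \<longrightarrow>
       (\<integral>\<^sup>+ x\<in>gball mul iv nrm a R.
          ennreal (\<bar>f x - average (gball mul iv nrm a R) f\<bar> powr p) \<partial>lebesgue)
       \<le> ennreal (Cp p * R powr p) *
         (\<integral>\<^sup>+ y\<in>gball mul iv nrm a (\<mu> * R). (\<integral>\<^sup>+ x\<in>gball mul iv nrm a (\<mu> * R).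
            ennreal (\<bar>f y - f x\<bar> powr p / nrm (mul (iv y) x) powr (p + real Q - 1) *
              (\<phi> (nrm (mul (iv y) x)) / (LINT \<tau>:{0<..<R}|lborel. \<phi> \<tau>)))
            \<partial>lebesgue) \<partial>lebesgue)"
    proof (intro allI ballI impI)
      fix p R :: real and a :: "real^'n" and f :: "real^'n \<Rightarrow> real" and \<phi> :: "real \<Rightarrow> real"
      assume p: "p \<ge> 1" and R: "R > 0" and f: "f \<in> Lp_loc p" and nonneg: "\<forall>r>0. \<phi> r \<ge> 0"
        and anti: "antimono_on {0<..} \<phi>" and nz: "\<exists>r>0. \<phi> r \<noteq> 0" and int: "\<forall>b>0. set_integrable lborel {0<..<b} \<phi>"
      define L where "L = (LINT \<tau>:{0<..<R}|lborel. \<phi> \<tau>)"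
      have L: "L > 0"
      proof -
        \<comment> \<open>Left of a point where it is positive, a nonincreasing \<phi> stays at
          least as large, which bounds its integral from below.\<close>
        obtain r where r: "r > 0" "\<phi> r > 0" using nz nonneg by (metis order_le_less)
        define s where "s = min r R"
        have s: "s > 0" "s \<le> r" "s \<le> R" using r R by (auto simp: s_def)
        have int_s: "set_integrable lborel {0<..<s} (\<lambda>_. \<phi> r)"
          unfolding set_integrable_def using s by (intro integrable_scaleR_left integrable_real_indicator) (simp_all add: less_imp_le)
        have "0 < s * \<phi> r" using s r by simp
        also have "s * \<phi> r = (LINT \<tau>:{0<..<s}|lborel. \<phi> r)"
          using s by (simp add: set_integral_const)
        also have "\<dots> = (LINT \<tau>|lborel. indicator {0<..<s} \<tau> *\<^sub>R \<phi> r)" by (simp add: set_lebesgue_integral_def)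
        also have "\<dots> \<le> (LINT \<tau>|lborel. indicator {0<..<R} \<tau> *\<^sub>R \<phi> \<tau>)"
        proof (rule integral_mono)
          show "integrable lborel (\<lambda>\<tau>. indicator {0<..<s} \<tau> *\<^sub>R \<phi> r)" using int_s by (simp add: set_integrable_def)
          show "integrable lborel (\<lambda>\<tau>. indicator {0<..<R} \<tau> *\<^sub>R \<phi> \<tau>)" using int R by (simp add: set_integrable_def)
          show "indicator {0<..<s} \<tau> *\<^sub>R \<phi> r \<le> indicator {0<..<R} \<tau> *\<^sub>R \<phi> \<tau>" for \<tau>
            using monotone_onD[OF anti, of \<tau> r] s r nonneg by (auto simp: indicator_def)
        qed
        finally show ?thesis by (simp add: L_def set_lebesgue_integral_def)
      qed
      \<comment> \<open>Normalized to integral 1 over (0, R), so that the quotient already stands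
        inside the double integral, as in the claim.\<close>
      define \<psi> where "\<psi> r = \<phi> r / L" for r
      have \<psi>L: "(LINT \<tau>:{0<..<R}|lborel. \<psi> \<tau> * \<tau> ^ 0) = 1"
        using L by (simp add: \<psi>_def L_def)
      have "antimono_on {0<..} \<psi>" "\<forall>r>0. \<psi> r \<ge> 0"
        using anti nonneg L by (auto simp: monotone_on_def \<psi>_def intro!: divide_right_mono)
      from poincare[rule_format, OF p R f _ this(1) this(2)[rule_format], of 0 a] \<psi>L Q1
      have main: "(\<integral>\<^sup>+ x\<in>gball mul iv nrm a R.
          ennreal (\<bar>f x - average (gball mul iv nrm a R) f\<bar> powr p) \<partial>lebesgue)
         \<le> ennreal (Cp p * R powr p) * (\<integral>\<^sup>+ y\<in>gball mul iv nrm a (\<mu> * R). (\<integral>\<^sup>+ x\<in>gball mul iv nrm a (\<mu> * R).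
          ennreal (\<bar>f y - f x\<bar> powr p *
            (\<psi> (nrm (mul (iv y) x)) * nrm (mul (iv y) x) powr (1 - p - real Q))) \<partial>lebesgue) \<partial>lebesgue)"
        by simp
      have "b * (\<psi> d * d powr (1 - p - real Q)) = b / d powr (p + real Q - 1) * (\<phi> d / L)" for b d
        using powr_minus_divide[of d "p + real Q - 1"] by (simp add: \<psi>_def algebra_simps)
      then show "(\<integral>\<^sup>+ x\<in>gball mul iv nrm a R.
          ennreal (\<bar>f x - average (gball mul iv nrm a R) f\<bar> powr p) \<partial>lebesgue)
       \<le> ennreal (Cp p * R powr p) *
         (\<integral>\<^sup>+ y\<in>gball mul iv nrm a (\<mu> * R). (\<integral>\<^sup>+ x\<in>gball mul iv nrm a (\<mu> * R).
            ennreal (\<bar>f y - f x\<bar> powr p / nrm (mul (iv y) x) powr (p + real Q - 1) *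
              (\<phi> (nrm (mul (iv y) x)) / (LINT \<tau>:{0<..<R}|lborel. \<phi> \<tau>)))
            \<partial>lebesgue) \<partial>lebesgue)"
        using main unfolding L_def[symmetric] by (simp only:)
    qed
  next
    show "\<forall>\<sigma> \<rho> :: real \<Rightarrow> real \<Rightarrow> real.
       radial_mollifiers mul iv nrm \<sigma> \<longrightarrow>
       (\<forall>n>0. \<forall>r>0. \<rho> n r = real Q * c\<^sub>B * \<sigma> n r) \<longrightarrow>
       (\<forall>n>0. antimono_on {0<..} (\<rho> n)) \<longrightarrow>
       (\<forall>n>0. (LINT r:{0<..}|lborel. \<rho> n r * r ^ (Q - 1)) = 1) \<longrightarrow>
       (\<forall>p\<ge>1. \<forall>R>0. \<forall>a. \<forall>C>Cp p.
          (\<exists>n\<^sub>0\<ge>0. \<forall>n>n\<^sub>0. (LINT \<tau>:{0<..<R}|lborel. \<rho> n \<tau> * \<tau> ^ (Q - 1)) > Cp p / C) \<and>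
          (\<forall>n\<^sub>0\<ge>0.
             (\<forall>n>n\<^sub>0. (LINT \<tau>:{0<..<R}|lborel. \<rho> n \<tau> * \<tau> ^ (Q - 1)) > Cp p / C) \<longrightarrow>
             (\<forall>n>n\<^sub>0. \<forall>f\<in>Lp_loc p.
                (\<integral>\<^sup>+ x\<in>gball mul iv nrm a R.
                   ennreal (\<bar>f x - average (gball mul iv nrm a R) f\<bar> powr p) \<partial>lebesgue)
                \<le> ennreal (C * R powr p) *
                  (\<integral>\<^sup>+ x\<in>gball mul iv nrm a (\<mu> * R). (\<integral>\<^sup>+ y\<in>gball mul iv nrm a (\<mu> * R).
                     ennreal (\<bar>f x - f y\<bar> powr p / nrm (mul (iv y) x) powr p *
                       \<rho> n (nrm (mul (iv y) x)))
                     \<partial>lebesgue) \<partial>lebesgue))))"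
    proof (intro allI impI)
      fix \<sigma> \<rho> :: "real \<Rightarrow> real \<Rightarrow> real" and p R C :: real and a :: "real^'n"
      assume mol: "radial_mollifiers mul iv nrm \<sigma>" and \<rho>: "\<forall>n>0. \<forall>r>0. \<rho> n r = real Q * c\<^sub>B * \<sigma> n r"
        and anti: "\<forall>n>0. antimono_on {0<..} (\<rho> n)"
        and one: "\<forall>n>0. (LINT r:{0<..}|lborel. \<rho> n r * r ^ (Q - 1)) = 1"
        and p: "p \<ge> 1" and R: "R > 0" and C: "C > Cp p"
      define L where "L n = (LINT \<tau>:{0<..<R}|lborel. \<rho> n \<tau> * \<tau> ^ (Q - 1))" for n
      have Cpos: "C > 0" "Cp p > 0" using C Cp[rule_format, OF p] by auto
      have \<sigma>: "\<sigma> n r \<ge> 0" if "n > 0" "r > 0" for n r using mol that unfolding radial_mollifiers_def by blast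
      have \<rho>_nonneg: "\<rho> n r \<ge> 0" if "n > 0" "r > 0" for n r
        using \<rho> \<sigma>[OF that] that cB_pos by (simp add: cB)
      \<comment> \<open>The total mass 1 is split at \<open>R\<close>, and polar coordinates
        identify the outer part with the tail of the mollifier.\<close>
      have L_eq: "L n = 1 - (LINT x:(- gball mul iv nrm 0 R)|lebesgue. \<sigma> n (nrm x))" if n: "n > 0" for n
      proof -
        have int: "set_integrable lborel {0<..} (\<lambda>r. \<rho> n r * r ^ (Q - 1))"
        proof (rule ccontr)
          assume "\<not> ?thesis"
          then have "(LINT r:{0<..}|lborel. \<rho> n r * r ^ (Q - 1)) = 0"
            unfolding set_integrable_def set_lebesgue_integral_def by (rule not_integrable_integral_eq)
          with one n show False by simp
        qed
        have "{0<..<R} \<union> {R..} = {0<..}" using R by auto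
        then have "1 = (LINT r:({0<..<R} \<union> {R..})|lborel. \<rho> n r * r ^ (Q - 1))" using one n by simp
        also have "\<dots> = L n + (LINT r:{R..}|lborel. \<rho> n r * r ^ (Q - 1))"
          unfolding L_def using R by (intro set_integral_Un set_integrable_subset[OF int]) auto
        also have "(LINT r:{R..}|lborel. \<rho> n r * r ^ (Q - 1)) = (LINT x:(- gball mul iv nrm 0 R)|lebesgue. \<sigma> n (nrm x))"
          unfolding assms(3) using \<sigma>[OF n] \<rho> anti n R
          by (intro polar_tail[symmetric]) (auto simp: cB assms(3))
        finally show ?thesis by simp
      qed
      have "((\<lambda>n. LINT x:(- gball mul iv nrm 0 R)|lebesgue. \<sigma> n (nrm x)) \<longlongrightarrow> 0) at_top"
        using mol R unfolding radial_mollifiers_def by blast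
      then have "\<forall>\<^sub>F n in at_top. (LINT x:(- gball mul iv nrm 0 R)|lebesgue. \<sigma> n (nrm x)) < 1 - Cp p / C"
        by (rule order_tendstoD) (use C Cpos in simp)
      then obtain N where N: "\<And>n. n \<ge> N \<Longrightarrow> (LINT x:(- gball mul iv nrm 0 R)|lebesgue. \<sigma> n (nrm x)) < 1 - Cp p / C"
        unfolding eventually_at_top_linorder by blast
      have ex: "\<exists>n\<^sub>0\<ge>0. \<forall>n>n\<^sub>0. L n > Cp p / C"
      \<comment> \<open>The maximum with 0 ensures \<open>n > 0\<close>, where the hypotheses on the
        family hold.\<close>
      proof (intro exI[of _ "max 0 N"] conjI allI impI)
        fix n assume "n > max 0 N"
        then show "L n > Cp p / C" using L_eq[of n] N[of n] by simp
      qed simp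
      have main: "(\<integral>\<^sup>+ x\<in>gball mul iv nrm a R.
                   ennreal (\<bar>f x - average (gball mul iv nrm a R) f\<bar> powr p) \<partial>lebesgue)
                \<le> ennreal (C * R powr p) *
                  (\<integral>\<^sup>+ x\<in>gball mul iv nrm a (\<mu> * R). (\<integral>\<^sup>+ y\<in>gball mul iv nrm a (\<mu> * R).
                     ennreal (\<bar>f x - f y\<bar> powr p / nrm (mul (iv y) x) powr p *
                       \<rho> n (nrm (mul (iv y) x)))
                     \<partial>lebesgue) \<partial>lebesgue)"
        if n: "n > 0" and Ln: "L n > Cp p / C" and f: "f \<in> Lp_loc p" for n f
      proof -
        have "Cp p / C > 0" using Cpos by simp
        then have L: "L n > 0" using Ln by linarith
        \<comment> \<open>For \<open>q = Q - 1\<close> the homogeneous dimension drops out of the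
          exponent; \<open>Q \<ge> 1\<close> makes the truncated subtraction exact.\<close>
        have e: "real (Q - 1) + 1 - p - real Q = - p" using Q1 by (simp add: of_nat_diff)
        have "(\<integral>\<^sup>+ x\<in>gball mul iv nrm a R.
                   ennreal (\<bar>f x - average (gball mul iv nrm a R) f\<bar> powr p) \<partial>lebesgue)
           \<le> ennreal (Cp p * R powr p / L n) *
            (\<integral>\<^sup>+ y\<in>gball mul iv nrm a (\<mu> * R). (\<integral>\<^sup>+ x\<in>gball mul iv nrm a (\<mu> * R).
          ennreal (\<bar>f y - f x\<bar> powr p *
            (\<rho> n (nrm (mul (iv y) x)) * nrm (mul (iv y) x) powr - p)) \<partial>lebesgue) \<partial>lebesgue)"
          unfolding L_def e[symmetric]
          by (rule poincare[rule_format, OF p R f]) (use Q1 anti n \<rho>_nonneg L in \<open>auto simp: L_def\<close>)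
        also have "\<dots> \<le> ennreal (C * R powr p) *
            (\<integral>\<^sup>+ y\<in>gball mul iv nrm a (\<mu> * R). (\<integral>\<^sup>+ x\<in>gball mul iv nrm a (\<mu> * R).
          ennreal (\<bar>f y - f x\<bar> powr p *
            (\<rho> n (nrm (mul (iv y) x)) * nrm (mul (iv y) x) powr - p)) \<partial>lebesgue) \<partial>lebesgue)"
        proof (intro mult_right_mono ennreal_leI)
          have "Cp p / L n \<le> C" using Ln L Cpos by (simp add: field_simps)
          then have "Cp p / L n * R powr p \<le> C * R powr p" by (intro mult_right_mono) auto
          then show "Cp p * R powr p / L n \<le> C * R powr p" by simp
        qed simp
        also have "(\<integral>\<^sup>+ y\<in>gball mul iv nrm a (\<mu> * R). (\<integral>\<^sup>+ x\<in>gball mul iv nrm a (\<mu> * R).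
          ennreal (\<bar>f y - f x\<bar> powr p *
            (\<rho> n (nrm (mul (iv y) x)) * nrm (mul (iv y) x) powr - p)) \<partial>lebesgue) \<partial>lebesgue)
          = (\<integral>\<^sup>+ x\<in>gball mul iv nrm a (\<mu> * R). (\<integral>\<^sup>+ y\<in>gball mul iv nrm a (\<mu> * R).
                     ennreal (\<bar>f x - f y\<bar> powr p / nrm (mul (iv y) x) powr p *
                       \<rho> n (nrm (mul (iv y) x)))
                     \<partial>lebesgue) \<partial>lebesgue)"
        \<comment> \<open>The two forms differ by exchanging the names of the variables; the norm of
          the quotient is symmetric in them.\<close>
        proof -
          have "b * (\<rho> n (nrm (mul (iv x) y)) * nrm (mul (iv x) y) powr - p) =
             b / nrm (mul (iv y) x) powr p * \<rho> n (nrm (mul (iv y) x))" for b x y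
            using nrm_quotient_commute[of x y] by (simp add: iv_eq powr_minus_divide)
          then show ?thesis by (simp only:)
        qed
        finally show ?thesis .
      qed
      show "(\<exists>n\<^sub>0\<ge>0. \<forall>n>n\<^sub>0. (LINT \<tau>:{0<..<R}|lborel. \<rho> n \<tau> * \<tau> ^ (Q - 1)) > Cp p / C) \<and>
          (\<forall>n\<^sub>0\<ge>0.
             (\<forall>n>n\<^sub>0. (LINT \<tau>:{0<..<R}|lborel. \<rho> n \<tau> * \<tau> ^ (Q - 1)) > Cp p / C) \<longrightarrow>
             (\<forall>n>n\<^sub>0. \<forall>f\<in>Lp_loc p.
                (\<integral>\<^sup>+ x\<in>gball mul iv nrm a R.
                   ennreal (\<bar>f x - average (gball mul iv nrm a R) f\<bar> powr p) \<partial>lebesgue)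
                \<le> ennreal (C * R powr p) *
                  (\<integral>\<^sup>+ x\<in>gball mul iv nrm a (\<mu> * R). (\<integral>\<^sup>+ y\<in>gball mul iv nrm a (\<mu> * R).
                     ennreal (\<bar>f x - f y\<bar> powr p / nrm (mul (iv y) x) powr p *
                       \<rho> n (nrm (mul (iv y) x)))
                     \<partial>lebesgue) \<partial>lebesgue)))"
        unfolding L_def[symmetric]
      proof (intro conjI allI impI ballI)
        fix n\<^sub>0 n and f :: "real^'n \<Rightarrow> real"
        assume "0 \<le> n\<^sub>0" "\<forall>n>n\<^sub>0. Cp p / C < L n" "n\<^sub>0 < n" and f: "f \<in> Lp_loc p"
        then have "n > 0" "L n > Cp p / C" by auto
        from main[OF this f]
        show "(\<integral>\<^sup>+ x\<in>gball mul iv nrm a R.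
                   ennreal (\<bar>f x - average (gball mul iv nrm a R) f\<bar> powr p) \<partial>lebesgue)
                \<le> ennreal (C * R powr p) *
                  (\<integral>\<^sup>+ x\<in>gball mul iv nrm a (\<mu> * R). (\<integral>\<^sup>+ y\<in>gball mul iv nrm a (\<mu> * R).
                     ennreal (\<bar>f x - f y\<bar> powr p / nrm (mul (iv y) x) powr p *
                       \<rho> n (nrm (mul (iv y) x)))
                     \<partial>lebesgue) \<partial>lebesgue)" .
      qed (rule ex)
    qed
  qed
qed

end
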